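(* Over a field $\mathbb{K}$ of characteristic zero, one has (as operads, up to canonical isomorphism) $$\mathbf{sLeib} = \mathbf{Lie} \circ \mathbf{sPerm}, \qquad \mathbf{sDiAss} = \mathbf{Ass} \circ \mathbf{sPerm}, \qquad \mathbf{sPerm} = \mathbf{Com} \circ \mathbf{sPerm},$$ where $\circ$ denotes the Manin white product of binary quadratic operads.
   Context: All operads are symmetric operads in $\mathbb{K}$-vector spaces. $\mathbf{Lie}$, $\mathbf{Ass}$, $\mathbf{Com}$ are the operads of Lie, associative and commutative associative algebras (non-unital). The other operads are the binary quadratic operads describing the following types of algebras (all multiplications bilinear, identities required for all elements). $\mathbf{sLeib}$: symmetric Leibniz algebras, i.e. vector spaces with a multiplication $\cdot$ with $a \cdot (b \cdot c) = (a \cdot b) \cdot c + b \cdot (a \cdot c)$ and $(a \cdot b) \cdot c = a \cdot (b \cdot c) + (a \cdot c) \cdot b$. $\mathbf{sDiAss}$: symmetric dialgebras, i.e. vector spaces with two associative multiplications $\vdash,\dashv$ such that $(a \circ_1 b) \circ_2 c = a \circ_3 (b \circ_4 c)$ for all choices of $\circ_1,\circ_2,\circ_3,\circ_4 \in \{\vdash,\dashv\}$. $\mathbf{sPerm}$: symmetric Perm-algebras, i.e. vector spaces with an associative multiplication such that $a \cdot b \cdot c = a \cdot c \cdot b = b \cdot a \cdot c$. Manin white product: for binary quadratic operads $\mathcal{P} = \mathbb{F}(V)/(R)$ and $\mathcal{Q} = \mathbb{F}(W)/(S)$, where $\mathbb{F}$ denotes the free operad, $V,W$ are $S_2$-modules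 placed in arity 2, and $R \subset \mathbb{F}(V)(3)$, $S \subset \mathbb{F}(W)(3)$, let $\Phi : \mathbb{F}(V \otimes W) \to \mathbb{F}(V) \otimes_H \mathbb{F}(W)$ be the operad morphism extending the identity of $V \otimes W$ in arity 2, where $(\mathcal{O} \otimes_H \mathcal{O}')(n) = \mathcal{O}(n) \otimes \mathcal{O}'(n)$ is the Hadamard product. Then $\mathcal{P} \circ \mathcal{Q} = \mathbb{F}(V \otimes W)/(T)$ with $T = \Phi_3^{-1}\big(R \otimes \mathbb{F}(W)(3) + \mathbb{F}(V)(3) \otimes S\big)\subset \mathbb{F}(V\otimes W)(3)$, where $\Phi_3$ is the arity 3 component of $\Phi$. *)

theory Defs
  imports Complex_Main "HOL-Library.Poly_Mapping" "HOL-Combinatorics.Permutations"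
begin

section \<open>Vector spaces with explicit carriers\<close>

text \<open>
  Quotients and tensor products force the operations to be carried by a record. The records below
  hold data only; all the spaces and operads used later are obtained by explicit constructions.
\<close>

record ('k, 'a) vspace =
  carrier :: "'a set"
  vzero :: 'a
  vadd :: "'a \<Rightarrow> 'a \<Rightarrow> 'a"
  vscale :: "'k \<Rightarrow> 'a \<Rightarrow> 'a"

definition vsubspace :: "('k, 'a, 'm) vspace_scheme \<Rightarrow> 'a set \<Rightarrow> bool" where
  "vsubspace V N \<longleftrightarrow> N \<subseteq> carrier V \<and> vzero V \<in> N \<and>
     (\<forall>x\<in>N. \<forall>y\<in>N. vadd V x y \<in> N) \<and> (\<forall>c. \<forall>x\<in>N. vscale V c x \<in> N)"

definition vspan :: "('k, 'a, 'm) vspace_scheme \<Rightarrow> 'a set \<Rightarrow> 'a set" where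
  "vspan V S = \<Inter>{N. vsubspace V N \<and> S \<subseteq> N}"

definition vlinear ::
    "('k, 'a, 'm) vspace_scheme \<Rightarrow> ('k, 'b, 'n) vspace_scheme \<Rightarrow> ('a \<Rightarrow> 'b) \<Rightarrow> bool" where
  "vlinear V W f \<longleftrightarrow> f ` carrier V \<subseteq> carrier W \<and>
     (\<forall>x\<in>carrier V. \<forall>y\<in>carrier V. f (vadd V x y) = vadd W (f x) (f y)) \<and>
     (\<forall>c. \<forall>x\<in>carrier V. f (vscale V c x) = vscale W c (f x))"

subsection \<open>Quotients\<close>

definition coset :: "('k, 'a, 'm) vspace_scheme \<Rightarrow> 'a set \<Rightarrow> 'a \<Rightarrow> 'a set" where
  "coset V N x = vadd V x ` N"

text \<open>
  A map given on representatives, with values taken modulo the subspace \<open>N\<close> of \<open>V\<close>; the union is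
  over equal cosets whenever the map is compatible with the equivalences involved.
\<close>

definition qlift ::
    "('k, 'b, 'm) vspace_scheme \<Rightarrow> 'b set \<Rightarrow> ('a \<Rightarrow> 'b) \<Rightarrow> 'a set \<Rightarrow> 'b set" where
  "qlift V N f X = (\<Union>x\<in>X. coset V N (f x))"

definition qlift2 ::
    "('k, 'c, 'm) vspace_scheme \<Rightarrow> 'c set \<Rightarrow> ('a \<Rightarrow> 'b \<Rightarrow> 'c) \<Rightarrow> 'a set \<Rightarrow> 'b set \<Rightarrow> 'c set" where
  "qlift2 V N f X Y = (\<Union>x\<in>X. \<Union>y\<in>Y. coset V N (f x y))"

definition vquot :: "('k, 'a, 'm) vspace_scheme \<Rightarrow> 'a set \<Rightarrow> ('k, 'a set) vspace" where
  "vquot V N = \<lparr> carrier = coset V N ` carrier V, vzero = coset V N (vzero V),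
     vadd = qlift2 V N (vadd V), vscale = (\<lambda>c. qlift V N (vscale V c)) \<rparr>"

subsection \<open>Free vector spaces\<close>

definition mono :: "'x \<Rightarrow> 'x \<Rightarrow>\<^sub>0 'k::field" where
  "mono x = Poly_Mapping.single x 1"

definition free_vspace :: "'x set \<Rightarrow> ('k::field, 'x \<Rightarrow>\<^sub>0 'k) vspace" where
  "free_vspace X = \<lparr> carrier = {p. Poly_Mapping.keys p \<subseteq> X}, vzero = 0,
     vadd = (+), vscale = (\<lambda>c. Poly_Mapping.map ((*) c)) \<rparr>"

text \<open>The linear, respectively bilinear, extension of a map between bases.\<close>

definition push :: "('x \<Rightarrow> 'y) \<Rightarrow> ('x \<Rightarrow>\<^sub>0 'k::field) \<Rightarrow> 'y \<Rightarrow>\<^sub>0 'k" where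
  "push f p = (\<Sum>x\<in>Poly_Mapping.keys p. Poly_Mapping.single (f x) (Poly_Mapping.lookup p x))"

definition push2 ::
    "('x \<Rightarrow> 'y \<Rightarrow> 'z) \<Rightarrow> ('x \<Rightarrow>\<^sub>0 'k::field) \<Rightarrow> ('y \<Rightarrow>\<^sub>0 'k) \<Rightarrow> 'z \<Rightarrow>\<^sub>0 'k" where
  "push2 f p q = (\<Sum>x\<in>Poly_Mapping.keys p. \<Sum>y\<in>Poly_Mapping.keys q.
     Poly_Mapping.single (f x y) (Poly_Mapping.lookup p x * Poly_Mapping.lookup q y))"

subsection \<open>Tensor products\<close>

definition tensor_free ::
    "('k::field, 'a, 'm) vspace_scheme \<Rightarrow> ('k, 'b, 'n) vspace_scheme \<Rightarrow>
     ('k, 'a \<times> 'b \<Rightarrow>\<^sub>0 'k) vspace" where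
  "tensor_free V W = free_vspace (carrier V \<times> carrier W)"

definition tensor_null ::
    "('k::field, 'a, 'm) vspace_scheme \<Rightarrow> ('k, 'b, 'n) vspace_scheme \<Rightarrow>
     ('a \<times> 'b \<Rightarrow>\<^sub>0 'k) set" where
  "tensor_null V W = vspan (tensor_free V W)
    ({mono (vadd V v v', w) - mono (v, w) - mono (v', w) | v v' w.
        v \<in> carrier V \<and> v' \<in> carrier V \<and> w \<in> carrier W} \<union>
     {mono (v, vadd W w w') - mono (v, w) - mono (v, w') | v w w'.
        v \<in> carrier V \<and> w \<in> carrier W \<and> w' \<in> carrier W} \<union>
     {mono (vscale V c v, w) - Poly_Mapping.single (v, w) c | c v w.
        v \<in> carrier V \<and> w \<in> carrier W} \<union>
     {mono (v, vscale W c w) - Poly_Mapping.single (v, w) c | c v w.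
        v \<in> carrier V \<and> w \<in> carrier W})"

definition tensor ::
    "('k::field, 'a, 'm) vspace_scheme \<Rightarrow> ('k, 'b, 'n) vspace_scheme \<Rightarrow>
     ('k, ('a \<times> 'b \<Rightarrow>\<^sub>0 'k) set) vspace" where
  "tensor V W = vquot (tensor_free V W) (tensor_null V W)"

definition pure_tensor ::
    "('k::field, 'a, 'm) vspace_scheme \<Rightarrow> ('k, 'b, 'n) vspace_scheme \<Rightarrow>
     'a \<Rightarrow> 'b \<Rightarrow> ('a \<times> 'b \<Rightarrow>\<^sub>0 'k) set" where
  "pure_tensor V W v w = coset (tensor_free V W) (tensor_null V W) (mono (v, w))"

text \<open>For subspaces \<open>A\<close> of \<open>V\<close> and \<open>B\<close> of \<open>W\<close>: the subspace \<open>A \<otimes> B\<close> of \<open>V \<otimes> W\<close>.\<close>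

definition tensor_sub ::
    "('k::field, 'a, 'm) vspace_scheme \<Rightarrow> ('k, 'b, 'n) vspace_scheme \<Rightarrow>
     'a set \<Rightarrow> 'b set \<Rightarrow> ('a \<times> 'b \<Rightarrow>\<^sub>0 'k) set set" where
  "tensor_sub V W A B = vspan (tensor V W) {pure_tensor V W a b | a b. a \<in> A \<and> b \<in> B}"


section \<open>Symmetric operads in vector spaces\<close>

text \<open>
  Operads in terms of partial compositions: \<open>pcomp P m n i p q\<close> is the operation
  \<open>p \<circ>\<^sub>i q\<close> for \<open>p\<close> of arity \<open>m\<close>, \<open>q\<close> of arity \<open>n\<close> and \<open>1 \<le> i \<le> m\<close>.
  The function \<open>act P n\<close> is the right action of the permutations of \<open>{1..n}\<close>.
\<close>

record ('k, 'a) operad =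
  ar :: "nat \<Rightarrow> ('k, 'a) vspace"
  act :: "nat \<Rightarrow> (nat \<Rightarrow> nat) \<Rightarrow> 'a \<Rightarrow> 'a"
  pcomp :: "nat \<Rightarrow> nat \<Rightarrow> nat \<Rightarrow> 'a \<Rightarrow> 'a \<Rightarrow> 'a"
  unit :: 'a

definition operad_hom ::
    "('k, 'a) operad \<Rightarrow> ('k, 'b) operad \<Rightarrow> (nat \<Rightarrow> 'a \<Rightarrow> 'b) \<Rightarrow> bool" where
  "operad_hom P Q \<phi> \<longleftrightarrow>
     (\<forall>n. vlinear (ar P n) (ar Q n) (\<phi> n)) \<and>
     (\<forall>n \<sigma>. \<sigma> permutes {1..n} \<longrightarrow>
        (\<forall>p\<in>carrier (ar P n). \<phi> n (act P n \<sigma> p) = act Q n \<sigma> (\<phi> n p))) \<and>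
     (\<forall>m n i. 1 \<le> i \<and> i \<le> m \<longrightarrow>
        (\<forall>p\<in>carrier (ar P m). \<forall>q\<in>carrier (ar P n).
           \<phi> (m + n - 1) (pcomp P m n i p q) = pcomp Q m n i (\<phi> m p) (\<phi> n q))) \<and>
     \<phi> 1 (unit P) = unit Q"

definition operad_iso ::
    "('k, 'a) operad \<Rightarrow> ('k, 'b) operad \<Rightarrow> (nat \<Rightarrow> 'a \<Rightarrow> 'b) \<Rightarrow> bool" where
  "operad_iso P Q \<phi> \<longleftrightarrow> operad_hom P Q \<phi> \<and>
     (\<forall>n. bij_betw (\<phi> n) (carrier (ar P n)) (carrier (ar Q n)))"

definition operad_ideal :: "('k, 'a) operad \<Rightarrow> (nat \<Rightarrow> 'a set) \<Rightarrow> bool" where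
  "operad_ideal P I \<longleftrightarrow>
     (\<forall>n. vsubspace (ar P n) (I n)) \<and>
     (\<forall>n \<sigma>. \<sigma> permutes {1..n} \<longrightarrow> (\<forall>p\<in>I n. act P n \<sigma> p \<in> I n)) \<and>
     (\<forall>m n i. 1 \<le> i \<and> i \<le> m \<longrightarrow>
        (\<forall>p\<in>carrier (ar P m). \<forall>q\<in>carrier (ar P n).
           p \<in> I m \<or> q \<in> I n \<longrightarrow> pcomp P m n i p q \<in> I (m + n - 1)))"

definition gen_ideal :: "('k, 'a) operad \<Rightarrow> nat \<Rightarrow> 'a set \<Rightarrow> nat \<Rightarrow> 'a set" where
  "gen_ideal P k R n = \<Inter>{I n | I. operad_ideal P I \<and> R \<subseteq> I k}"

definition quot_operad :: "('k, 'a) operad \<Rightarrow> (nat \<Rightarrow> 'a set) \<Rightarrow> ('k, 'a set) operad" where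
  "quot_operad P I =
     \<lparr> ar = (\<lambda>n. vquot (ar P n) (I n)),
       act = (\<lambda>n \<sigma>. qlift (ar P n) (I n) (act P n \<sigma>)),
       pcomp = (\<lambda>m n i. qlift2 (ar P (m + n - 1)) (I (m + n - 1)) (pcomp P m n i)),
       unit = coset (ar P 1) (I 1) (unit P) \<rparr>"

definition hadamard ::
    "('k::field, 'a) operad \<Rightarrow> ('k, 'b) operad \<Rightarrow> ('k, ('a \<times> 'b \<Rightarrow>\<^sub>0 'k) set) operad" where
  "hadamard P Q =
     \<lparr> ar = (\<lambda>n. tensor (ar P n) (ar Q n)),
       act = (\<lambda>n \<sigma>. qlift (tensor_free (ar P n) (ar Q n)) (tensor_null (ar P n) (ar Q n))
                (push (\<lambda>(p, q). (act P n \<sigma> p, act Q n \<sigma> q)))),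
       pcomp = (\<lambda>m n i. qlift2 (tensor_free (ar P (m + n - 1)) (ar Q (m + n - 1)))
                (tensor_null (ar P (m + n - 1)) (ar Q (m + n - 1)))
                (push2 (\<lambda>(p, q) (p', q'). (pcomp P m n i p p', pcomp Q m n i q q')))),
       unit = pure_tensor (ar P 1) (ar Q 1) (unit P) (unit Q) \<rparr>"


section \<open>The free operad on an \<open>S\<^sub>2\<close>-module\<close>

record ('k, 'a) s2_module = "('k, 'a) vspace" +
  swap :: "'a \<Rightarrow> 'a"

definition s2_tensor ::
    "('k::field, 'a) s2_module \<Rightarrow> ('k, 'b) s2_module \<Rightarrow>
     ('k, ('a \<times> 'b \<Rightarrow>\<^sub>0 'k) set) s2_module" where
  "s2_tensor V W = vspace.extend (tensor V W)
     (s2_module.fields (qlift (tensor_free V W) (tensor_null V W)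
        (push (\<lambda>(v, w). (swap V v, swap W w)))))"

text \<open>
  Binary trees with vertices decorated by elements of \<open>V\<close> and leaves numbered bijectively by
  \<open>{1..n}\<close>. The leaf \<open>k\<close> stands for the argument \<open>x\<^sub>k\<close>, and \<open>Node v l r\<close> for \<open>v (l, r)\<close>.
\<close>

datatype 'v tree = Leaf nat | Node 'v "'v tree" "'v tree"

primrec leaves :: "'v tree \<Rightarrow> nat list" where
  "leaves (Leaf k) = [k]"
| "leaves (Node v l r) = leaves l @ leaves r"

primrec labels :: "'v tree \<Rightarrow> 'v set" where
  "labels (Leaf k) = {}"
| "labels (Node v l r) = insert v (labels l \<union> labels r)"

primrec graft :: "(nat \<Rightarrow> 'v tree) \<Rightarrow> 'v tree \<Rightarrow> 'v tree" where
  "graft s (Leaf k) = s k"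
| "graft s (Node v l r) = Node v (graft s l) (graft s r)"

definition relabel :: "(nat \<Rightarrow> nat) \<Rightarrow> 'v tree \<Rightarrow> 'v tree" where
  "relabel f = graft (\<lambda>k. Leaf (f k))"

text \<open>The tree \<open>t \<circ>\<^sub>i s\<close>, where \<open>s\<close> has \<open>n\<close> leaves.\<close>

definition tree_comp :: "nat \<Rightarrow> nat \<Rightarrow> 'v tree \<Rightarrow> 'v tree \<Rightarrow> 'v tree" where
  "tree_comp n i t s = graft (\<lambda>k. if k < i then Leaf k
      else if k = i then relabel (\<lambda>j. j + i - 1) s else Leaf (k + n - 1)) t"

definition trees :: "('k, 'v, 'm) vspace_scheme \<Rightarrow> nat \<Rightarrow> 'v tree set" where
  "trees V n = {t. labels t \<subseteq> carrier V \<and> distinct (leaves t) \<and> set (leaves t) = {1..n}}"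

definition tree_free :: "('k::field, 'v) s2_module \<Rightarrow> nat \<Rightarrow> ('k, 'v tree \<Rightarrow>\<^sub>0 'k) vspace" where
  "tree_free V n = free_vspace (trees V n)"

text \<open>Trees with one hole.\<close>

inductive_set tree_contexts :: "('v tree \<Rightarrow> 'v tree) set" where
  "(\<lambda>t. t) \<in> tree_contexts"
| "C \<in> tree_contexts \<Longrightarrow> (\<lambda>t. Node v (C t) r) \<in> tree_contexts"
| "C \<in> tree_contexts \<Longrightarrow> (\<lambda>t. Node v l (C t)) \<in> tree_contexts"

text \<open>
  The space \<open>\<F>(V)(n)\<close> is spanned by these trees, subject to linearity in the decoration of each
  vertex and to \<open>(v \<cdot> \<tau>) (l, r) = v (r, l)\<close>, where \<open>\<tau>\<close> is the transposition in \<open>S\<^sub>2\<close>.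
\<close>

definition tree_null :: "('k::field, 'v) s2_module \<Rightarrow> nat \<Rightarrow> ('v tree \<Rightarrow>\<^sub>0 'k) set" where
  "tree_null V n = vspan (tree_free V n)
    ({mono (C (Node (vadd V v v') l r)) - mono (C (Node v l r)) - mono (C (Node v' l r)) |
        C v v' l r. C \<in> tree_contexts \<and> v' \<in> carrier V \<and> C (Node v l r) \<in> trees V n} \<union>
     {mono (C (Node (vscale V c v) l r)) - Poly_Mapping.single (C (Node v l r)) c |
        C c v l r. C \<in> tree_contexts \<and> C (Node v l r) \<in> trees V n} \<union>
     {mono (C (Node (swap V v) l r)) - mono (C (Node v r l)) |
        C v l r. C \<in> tree_contexts \<and> C (Node v l r) \<in> trees V n})"

definition tree_class ::
    "('k::field, 'v) s2_module \<Rightarrow> nat \<Rightarrow> ('v tree \<Rightarrow>\<^sub>0 'k) \<Rightarrow> ('v tree \<Rightarrow>\<^sub>0 'k) set" where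
  "tree_class V n = coset (tree_free V n) (tree_null V n)"

definition free_operad :: "('k::field, 'v) s2_module \<Rightarrow> ('k, ('v tree \<Rightarrow>\<^sub>0 'k) set) operad" where
  "free_operad V =
     \<lparr> ar = (\<lambda>n. vquot (tree_free V n) (tree_null V n)),
       act = (\<lambda>n \<sigma>. qlift (tree_free V n) (tree_null V n) (push (relabel (inv \<sigma>)))),
       pcomp = (\<lambda>m n i. qlift2 (tree_free V (m + n - 1)) (tree_null V (m + n - 1))
                  (push2 (tree_comp n i))),
       unit = tree_class V 1 (mono (Leaf 1)) \<rparr>"

text \<open>The inclusion of \<open>V\<close> as the arity 2 part of the free operad.\<close>

definition free_gen :: "('k::field, 'v) s2_module \<Rightarrow> 'v \<Rightarrow> ('v tree \<Rightarrow>\<^sub>0 'k) set" where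
  "free_gen V v = tree_class V 2 (mono (Node v (Leaf 1) (Leaf 2)))"


section \<open>Binary quadratic operads and the Manin white product\<close>

text \<open>A presentation \<open>\<F>(V)/(R)\<close> with \<open>R \<subseteq> \<F>(V)(3)\<close>.\<close>

record (overloaded) ('k, 'v) quadratic =
  gens :: "('k, 'v) s2_module"
  rels :: "('v tree \<Rightarrow>\<^sub>0 'k) set set"

definition operad_of ::
    "('k::field, 'v) quadratic \<Rightarrow> ('k, ('v tree \<Rightarrow>\<^sub>0 'k) set set) operad" where
  "operad_of D = quot_operad (free_operad (gens D)) (gen_ideal (free_operad (gens D)) 3 (rels D))"

text \<open>The operation of \<open>operad_of D\<close> given by a generator.\<close>

definition gen_op :: "('k::field, 'v) quadratic \<Rightarrow> 'v \<Rightarrow> ('v tree \<Rightarrow>\<^sub>0 'k) set set" where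
  "gen_op D v = coset (ar (free_operad (gens D)) 2)
     (gen_ideal (free_operad (gens D)) 3 (rels D) 2) (free_gen (gens D) v)"

text \<open>
  The operad morphism \<open>\<F>(V \<otimes> W) \<rightarrow> \<F>(V) \<otimes>\<^sub>H \<F>(W)\<close> extending the identity of \<open>V \<otimes> W\<close>. It is
  determined on the carriers, as \<open>\<F>(V \<otimes> W)\<close> is generated by the elements \<open>v \<otimes> w\<close> of arity 2.
\<close>

definition white_map ::
    "('k::field, 'v) s2_module \<Rightarrow> ('k, 'w) s2_module \<Rightarrow> nat \<Rightarrow>
     (('v \<times> 'w \<Rightarrow>\<^sub>0 'k) set tree \<Rightarrow>\<^sub>0 'k) set \<Rightarrow>
     (('v tree \<Rightarrow>\<^sub>0 'k) set \<times> ('w tree \<Rightarrow>\<^sub>0 'k) set \<Rightarrow>\<^sub>0 'k) set" where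
  "white_map V W = (SOME \<Phi>.
     operad_hom (free_operad (s2_tensor V W)) (hadamard (free_operad V) (free_operad W)) \<Phi> \<and>
     (\<forall>v\<in>carrier V. \<forall>w\<in>carrier W.
        \<Phi> 2 (free_gen (s2_tensor V W) (pure_tensor V W v w)) =
          pure_tensor (ar (free_operad V) 2) (ar (free_operad W) 2) (free_gen V v) (free_gen W w)))"

definition white_product ::
    "('k::field, 'v) quadratic \<Rightarrow> ('k, 'w) quadratic \<Rightarrow>
     ('k, ('v \<times> 'w \<Rightarrow>\<^sub>0 'k) set) quadratic" where
  "white_product D E =
     (let V = gens D; W = gens E; FV = ar (free_operad V) 3; FW = ar (free_operad W) 3
      in \<lparr> gens = s2_tensor V W,
           rels = {x \<in> carrier (ar (free_operad (s2_tensor V W)) 3).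
             \<exists>y\<in>tensor_sub FV FW (rels D) (carrier FW).
             \<exists>z\<in>tensor_sub FV FW (carrier FV) (rels E).
               white_map V W 3 x = vadd (tensor FV FW) y z} \<rparr>)"


section \<open>Presentations of the operads Lie, Com, Ass, sLeib, sPerm and sDiAss\<close>

text \<open>
  The presentation with generators \<open>V\<close> whose relations form the \<open>S\<^sub>3\<close>-submodule of \<open>\<F>(V)(3)\<close>
  generated by the given multilinear identities in \<open>x\<^sub>1, x\<^sub>2, x\<^sub>3\<close>.
\<close>

definition presentation ::
    "('k::field, 'v) s2_module \<Rightarrow> ('v tree \<Rightarrow>\<^sub>0 'k) set \<Rightarrow> ('k, 'v) quadratic" where
  "presentation V S = \<lparr> gens = V,
     rels = vspan (ar (free_operad V) 3)
       {act (free_operad V) 3 \<sigma> (tree_class V 3 s) | \<sigma> s. \<sigma> permutes {1..3} \<and> s \<in> S} \<rparr>"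

definition trivial_module :: "('k::field, 'k) s2_module" where
  "trivial_module = \<lparr> carrier = UNIV, vzero = 0, vadd = (+), vscale = (*), swap = (\<lambda>x. x) \<rparr>"

definition sign_module :: "('k::field, 'k) s2_module" where
  "sign_module = \<lparr> carrier = UNIV, vzero = 0, vadd = (+), vscale = (*), swap = uminus \<rparr>"

text \<open>
  Multiplications \<open>g :: 'g\<close> without symmetry: the free \<open>S\<^sub>2\<close>-module on \<open>'g\<close>, where \<open>(g, False)\<close>
  is the multiplication \<open>g\<close> and \<open>(g, True)\<close> the opposite one.
\<close>

definition regular_module :: "('k::field, 'g \<times> bool \<Rightarrow>\<^sub>0 'k) s2_module" where
  "regular_module = vspace.extend (free_vspace UNIV)
     (s2_module.fields (push (\<lambda>(g, b). (g, \<not> b))))"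

definition mul :: "'g \<Rightarrow> 'g \<times> bool \<Rightarrow>\<^sub>0 'k::field" where
  "mul g = mono (g, False)"

definition mul_op :: "'g \<Rightarrow> 'g \<times> bool \<Rightarrow>\<^sub>0 'k::field" where
  "mul_op g = mono (g, True)"

text \<open>The monomials \<open>v (u (x\<^sub>i, x\<^sub>j), x\<^sub>k)\<close> and \<open>u (x\<^sub>i, v (x\<^sub>j, x\<^sub>k))\<close>.\<close>

definition lmono :: "'v \<Rightarrow> 'v \<Rightarrow> nat \<Rightarrow> nat \<Rightarrow> nat \<Rightarrow> 'v tree \<Rightarrow>\<^sub>0 'k::field" where
  "lmono u v i j k = mono (Node v (Node u (Leaf i) (Leaf j)) (Leaf k))"

definition rmono :: "'v \<Rightarrow> 'v \<Rightarrow> nat \<Rightarrow> nat \<Rightarrow> nat \<Rightarrow> 'v tree \<Rightarrow>\<^sub>0 'k::field" where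
  "rmono u v i j k = mono (Node u (Leaf i) (Node v (Leaf j) (Leaf k)))"

definition Lie :: "('k::field, 'k) quadratic" where
  "Lie = presentation sign_module {lmono 1 1 1 2 3 + lmono 1 1 2 3 1 + lmono 1 1 3 1 2}"

definition Com :: "('k::field, 'k) quadratic" where
  "Com = presentation trivial_module {lmono 1 1 1 2 3 - rmono 1 1 1 2 3}"

definition Ass :: "('k::field, unit \<times> bool \<Rightarrow>\<^sub>0 'k) quadratic" where
  "Ass = (let m = mul () in presentation regular_module {lmono m m 1 2 3 - rmono m m 1 2 3})"

definition sLeib :: "('k::field, unit \<times> bool \<Rightarrow>\<^sub>0 'k) quadratic" where
  "sLeib = (let m = mul () in presentation regular_module
     {rmono m m 1 2 3 - lmono m m 1 2 3 - rmono m m 2 1 3,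
      lmono m m 1 2 3 - rmono m m 1 2 3 - lmono m m 1 3 2})"

definition sPerm :: "('k::field, unit \<times> bool \<Rightarrow>\<^sub>0 'k) quadratic" where
  "sPerm = (let m = mul () in presentation regular_module
     {lmono m m 1 2 3 - rmono m m 1 2 3,
      lmono m m 1 2 3 - lmono m m 1 3 2,
      lmono m m 1 2 3 - lmono m m 2 1 3})"

datatype dimult = LeftTack | RightTack  \<comment> \<open>\<open>\<stileturn>\<close> and \<open>\<turnstile>\<close>\<close>

text \<open>Taking all four multiplications equal gives the two associativity laws.\<close>

definition sDiAss :: "('k::field, dimult \<times> bool \<Rightarrow>\<^sub>0 'k) quadratic" where
  "sDiAss = presentation regular_module
     {lmono (mul a) (mul b) 1 2 3 - rmono (mul c) (mul d) 1 2 3 | a b c d. True}"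

end

theory Submission
  imports Defs
begin

text \<open>
  The relations of each operad involved are the common kernel of a family of functionals on the
  arity 3 part of the free operad: coefficients of words in iterated (possibly twisted) products for
  \<open>Lie\<close>, \<open>Ass\<close>, \<open>sLeib\<close> and \<open>sDiAss\<close>, and the product of the augmentations of all vertex labels for \<open>Com\<close>
  and \<open>sPerm\<close>. In particular \<open>sPerm\<close> is cut out by a single functional \<open>\<epsilon>\<close>, so \<open>R \<otimes> F(W)(3) + F(V)(3) \<otimes> S\<close>
  is the common kernel of the functionals \<open>\<kappa> \<otimes> \<epsilon>\<close>, where \<open>\<kappa>\<close> runs over the functionals of the first
  factor. Pulled back along \<open>\<Phi>\<close> and the evident isomorphism of a regular module with \<open>V \<otimes> W\<close>, these are the
  functionals that cut out the relations of \<open>sLeib\<close>, \<open>sDiAss\<close> and \<open>sPerm\<close>. The morphism \<open>\<Phi>\<close> is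
  constructed by multilinear expansion of labels; homomorphisms agreeing on generators agree in
  arity 3, so the chosen morphism in the definition of the white product is the constructed one there.
\<close>

section \<open>Linear extension\<close>

abbreviation pscale :: "'k::field \<Rightarrow> ('x \<Rightarrow>\<^sub>0 'k) \<Rightarrow> 'x \<Rightarrow>\<^sub>0 'k" where
  "pscale c \<equiv> Poly_Mapping.map ((*) c)"

lemma lookup_pscale [simp]: "Poly_Mapping.lookup (pscale c p) x = c * Poly_Mapping.lookup p x"
  by (simp add: map.rep_eq when_def)

definition ev :: "('x \<Rightarrow> 'k::field) \<Rightarrow> ('x \<Rightarrow>\<^sub>0 'k) \<Rightarrow> 'k" where
  "ev h p = (\<Sum>x\<in>Poly_Mapping.keys p. Poly_Mapping.lookup p x * h x)"

definition lin :: "('x \<Rightarrow> 'y \<Rightarrow>\<^sub>0 'k::field) \<Rightarrow> ('x \<Rightarrow>\<^sub>0 'k) \<Rightarrow> 'y \<Rightarrow>\<^sub>0 'k" where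
  "lin g p = (\<Sum>x\<in>Poly_Mapping.keys p. pscale (Poly_Mapping.lookup p x) (g x))"

lemma ev_superset:
  "finite A \<Longrightarrow> Poly_Mapping.keys p \<subseteq> A \<Longrightarrow> ev h p = (\<Sum>x\<in>A. Poly_Mapping.lookup p x * h x)"
  unfolding ev_def by (rule sum.mono_neutral_left) (auto simp: in_keys_iff)

lemma ev_zero [simp]: "ev h 0 = 0"
  by (simp add: ev_def)

lemma ev_add: "ev h (p + q) = ev h p + ev h q"
proof -
  let ?A = "Poly_Mapping.keys p \<union> Poly_Mapping.keys q"
  have "Poly_Mapping.keys (p + q) \<subseteq> ?A"
    by (rule keys_add)
  then show ?thesis
    by (simp add: ev_superset[of ?A] lookup_add distrib_right sum.distrib)
qed

lemma keys_pscale: "Poly_Mapping.keys (pscale c p) \<subseteq> Poly_Mapping.keys p"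
  by (auto simp: in_keys_iff)

lemma ev_pscale: "ev h (pscale c p) = c * ev h p"
  using keys_pscale[of c p]
  by (simp add: ev_superset[of "Poly_Mapping.keys p"] sum_distrib_left mult.assoc)

lemma pscale_minus: "pscale (- 1) p = - p"
  by (rule poly_mapping_eqI) simp

lemma ev_uminus: "ev h (- p) = - ev h p"
  using ev_pscale[of h "- 1" p] by (simp add: pscale_minus)

lemma ev_diff: "ev h (p - q) = ev h p - ev h q"
  using ev_add[of h p "- q"] by (simp add: ev_uminus)

lemma ev_single [simp]: "ev h (Poly_Mapping.single x c) = c * h x"
  by (simp add: ev_def)

lemma ev_mono [simp]: "ev h (mono x) = h x"
  by (simp add: mono_def)

lemma ev_cong: "(\<And>x. x \<in> Poly_Mapping.keys p \<Longrightarrow> h x = g x) \<Longrightarrow> ev h p = ev g p"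
  by (simp add: ev_def)

lemma ev_fun_add: "ev (\<lambda>x. h x + g x) p = ev h p + ev g p"
  by (simp add: ev_def distrib_left sum.distrib)

lemma ev_fun_diff: "ev (\<lambda>x. h x - g x) p = ev h p - ev g p"
  by (simp add: ev_def right_diff_distrib sum_subtractf)

lemma ev_fun_scale: "ev (\<lambda>x. c * h x) p = c * ev h p"
  by (simp add: ev_def sum_distrib_left mult.left_commute)

lemma ev_fun_scale_right: "ev (\<lambda>x. h x * c) p = ev h p * c"
  using ev_fun_scale[of c h p] by (simp add: mult.commute)

lemma ev_sum: "ev h (\<Sum>i\<in>I. f i) = (\<Sum>i\<in>I. ev h (f i))"
  by (induction I rule: infinite_finite_induct) (simp_all add: ev_add)

lemma ev_commute: "ev (\<lambda>x. ev (\<lambda>y. h x y) q) p = ev (\<lambda>y. ev (\<lambda>x. h x y) p) q"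
  unfolding ev_def sum_distrib_left by (subst sum.swap) (simp add: mult.left_commute)

lemma lookup_lin: "Poly_Mapping.lookup (lin g p) y = ev (\<lambda>x. Poly_Mapping.lookup (g x) y) p"
  by (simp add: lin_def ev_def lookup_sum)

lemma ev_lin: "ev h (lin g p) = ev (\<lambda>x. ev h (g x)) p"
  by (simp add: lin_def ev_sum ev_pscale) (simp add: ev_def)

lemma lin_lin: "lin h (lin g p) = lin (\<lambda>x. lin h (g x)) p"
  by (rule poly_mapping_eqI) (simp add: lookup_lin ev_lin)

lemma lin_zero [simp]: "lin g 0 = 0"
  by (simp add: lin_def)

lemma lin_add: "lin g (p + q) = lin g p + lin g q"
  by (rule poly_mapping_eqI) (simp add: lookup_lin ev_add lookup_add)

lemma lin_diff: "lin g (p - q) = lin g p - lin g q"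
  by (rule poly_mapping_eqI) (simp add: lookup_lin ev_diff lookup_minus)

lemma lin_pscale: "lin g (pscale c p) = pscale c (lin g p)"
  by (rule poly_mapping_eqI) (simp add: lookup_lin ev_pscale)

lemma lin_fun_add: "lin (\<lambda>x. h x + g x) p = lin h p + lin g p"
  by (rule poly_mapping_eqI) (simp add: lookup_lin ev_fun_add lookup_add)

lemma lin_fun_diff: "lin (\<lambda>x. h x - g x) p = lin h p - lin g p"
  by (rule poly_mapping_eqI) (simp add: lookup_lin ev_fun_diff lookup_minus)

lemma lin_fun_pscale: "lin (\<lambda>x. pscale c (h x)) p = pscale c (lin h p)"
  by (rule poly_mapping_eqI) (simp add: lookup_lin ev_fun_scale)

lemma lin_single: "lin g (Poly_Mapping.single x c) = pscale c (g x)"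
  by (rule poly_mapping_eqI) (simp add: lookup_lin)

lemma lin_mono [simp]: "lin g (mono x) = g x"
  by (rule poly_mapping_eqI) (simp add: lookup_lin)

lemma lin_commute: "lin (\<lambda>x. lin (\<lambda>y. g x y) q) p = lin (\<lambda>y. lin (\<lambda>x. g x y) p) q"
  by (rule poly_mapping_eqI) (simp add: lookup_lin, rule ev_commute)

lemma lin_cong: "(\<And>x. x \<in> Poly_Mapping.keys p \<Longrightarrow> h x = g x) \<Longrightarrow> lin h p = lin g p"
  by (simp add: lin_def)

lemma keys_mono [simp]: "Poly_Mapping.keys (mono x :: _ \<Rightarrow>\<^sub>0 'k::field) = {x}"
  by (simp add: mono_def)

lemma pscale_mono [simp]: "pscale c (mono x) = Poly_Mapping.single x c"
  by (simp add: mono_def)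

lemma lin_mono_eq [simp]: "lin mono p = p"
proof (rule poly_mapping_eqI)
  fix x
  have "Poly_Mapping.lookup (lin mono p) x =
      (\<Sum>y\<in>Poly_Mapping.keys p. if y = x then Poly_Mapping.lookup p y else 0)"
    unfolding lookup_lin ev_def by (intro sum.cong) (auto simp: mono_def lookup_single when_def)
  then show "Poly_Mapping.lookup (lin mono p) x = Poly_Mapping.lookup p x"
    by (simp add: in_keys_iff)
qed

lemma push_eq_lin: "push f = lin (\<lambda>x. mono (f x))"
  by (rule ext) (simp add: push_def lin_def)

lemma push2_eq_lin: "push2 f p q = lin (\<lambda>x. lin (\<lambda>y. mono (f x y)) q) p"
  unfolding push2_def lin_def
  by (intro sum.cong refl poly_mapping_eqI)
    (auto simp: lookup_sum mono_def lookup_single sum_distrib_left when_def intro!: sum.cong)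

lemma push_mono [simp]: "push f (mono x) = mono (f x)"
  by (simp add: push_eq_lin)

lemma push_add: "push f (p + q) = push f p + push f q"
  by (simp add: push_eq_lin lin_add)

lemma push_diff: "push f (p - q) = push f p - push f q"
  by (simp add: push_eq_lin lin_diff)

lemma ev_push: "ev h (push f p) = ev (\<lambda>x. h (f x)) p"
  by (simp add: push_eq_lin ev_lin)

section \<open>Vector spaces with explicit carriers\<close>

definition vector_space_on :: "('k::field, 'a, 'm) vspace_scheme \<Rightarrow> bool" where
  "vector_space_on V \<longleftrightarrow> vzero V \<in> carrier V \<and>
     (\<forall>x\<in>carrier V. \<forall>y\<in>carrier V. vadd V x y \<in> carrier V \<and> vadd V x y = vadd V y x) \<and>
     (\<forall>x\<in>carrier V. \<forall>y\<in>carrier V. \<forall>z\<in>carrier V. vadd V (vadd V x y) z = vadd V x (vadd V y z)) \<and>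
     (\<forall>x\<in>carrier V. vadd V (vzero V) x = x \<and> vscale V 1 x = x \<and> vscale V 0 x = vzero V) \<and>
     (\<forall>c. \<forall>x\<in>carrier V. vscale V c x \<in> carrier V) \<and>
     (\<forall>c. \<forall>x\<in>carrier V. \<forall>y\<in>carrier V.
        vscale V c (vadd V x y) = vadd V (vscale V c x) (vscale V c y)) \<and>
     (\<forall>c d. \<forall>x\<in>carrier V. vscale V (c + d) x = vadd V (vscale V c x) (vscale V d x) \<and>
        vscale V (c * d) x = vscale V c (vscale V d x))"

locale vsp =
  fixes V :: "('k::field, 'a, 'm) vspace_scheme" (structure)
  assumes vs: "vector_space_on V"
begin

abbreviation "vminus x \<equiv> vscale V (- 1) x"

lemma zero_mem [simp, intro]: "vzero V \<in> carrier V"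
  and add_mem [simp, intro]: "x \<in> carrier V \<Longrightarrow> y \<in> carrier V \<Longrightarrow> vadd V x y \<in> carrier V"
  and scale_mem [simp, intro]: "x \<in> carrier V \<Longrightarrow> vscale V c x \<in> carrier V"
  and scale_one [simp]: "x \<in> carrier V \<Longrightarrow> vscale V 1 x = x"
  and scale_zero [simp]: "x \<in> carrier V \<Longrightarrow> vscale V 0 x = vzero V"
  and scale_add: "x \<in> carrier V \<Longrightarrow> y \<in> carrier V \<Longrightarrow>
      vscale V c (vadd V x y) = vadd V (vscale V c x) (vscale V c y)"
  and scale_add_left: "x \<in> carrier V \<Longrightarrow> vscale V (c + d) x = vadd V (vscale V c x) (vscale V d x)"
  and scale_scale: "x \<in> carrier V \<Longrightarrow> vscale V c (vscale V d x) = vscale V (c * d) x"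
  using vs unfolding vector_space_on_def by simp_all

lemma zero_add [simp]: "x \<in> carrier V \<Longrightarrow> vadd V (vzero V) x = x"
  using vs unfolding vector_space_on_def by metis

lemma add_commute: "x \<in> carrier V \<Longrightarrow> y \<in> carrier V \<Longrightarrow> vadd V x y = vadd V y x"
  using vs unfolding vector_space_on_def by metis

lemma add_assoc: "x \<in> carrier V \<Longrightarrow> y \<in> carrier V \<Longrightarrow> z \<in> carrier V \<Longrightarrow>
    vadd V (vadd V x y) z = vadd V x (vadd V y z)"
  using vs unfolding vector_space_on_def by metis

lemma add_zero [simp]: "x \<in> carrier V \<Longrightarrow> vadd V x (vzero V) = x"
  using add_commute[of x "vzero V"] by simp

lemma add_minus [simp]: "x \<in> carrier V \<Longrightarrow> vadd V x (vminus x) = vzero V"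
  using scale_add_left[of x 1 "- 1"] by simp

lemma minus_add [simp]: "x \<in> carrier V \<Longrightarrow> vadd V (vminus x) x = vzero V"
  using add_commute[of "vminus x" x] by simp

lemma add_left_commute:
  "x \<in> carrier V \<Longrightarrow> y \<in> carrier V \<Longrightarrow> z \<in> carrier V \<Longrightarrow>
    vadd V x (vadd V y z) = vadd V y (vadd V x z)"
  by (metis add_assoc add_commute)

lemma add_minus_cancel:
  assumes "x \<in> carrier V" "y \<in> carrier V"
  shows "vadd V x (vadd V (vminus x) y) = y" and "vadd V (vminus x) (vadd V x y) = y"
  using assms by (simp_all flip: add_assoc)

lemmas add_ac = add_assoc add_commute add_left_commute

context
  fixes N
  assumes N: "vsubspace V N"
begin

lemma sub_carrier: "x \<in> N \<Longrightarrow> x \<in> carrier V"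
  and sub_zero: "vzero V \<in> N"
  and sub_add: "x \<in> N \<Longrightarrow> y \<in> N \<Longrightarrow> vadd V x y \<in> N"
  and sub_scale: "x \<in> N \<Longrightarrow> vscale V c x \<in> N"
  using N unfolding vsubspace_def by auto

lemma coset_mem: "x \<in> carrier V \<Longrightarrow> x \<in> coset V N x"
  using sub_zero unfolding coset_def by (auto intro!: image_eqI[of _ _ "vzero V"])

lemma coset_memD:
  assumes "x \<in> carrier V" "y \<in> coset V N x"
  obtains n where "n \<in> N" "y = vadd V x n" "y \<in> carrier V"
  using assms sub_carrier unfolding coset_def by auto

lemma coset_add_sub:
  assumes x: "x \<in> carrier V" and n: "n \<in> N"
  shows "coset V N (vadd V x n) = coset V N x"
proof -
  note [simp] = sub_carrier sub_add sub_scale n x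
  show ?thesis
  proof (rule set_eqI, rule iffI)
    fix z assume "z \<in> coset V N (vadd V x n)"
    then obtain m where "m \<in> N" "z = vadd V (vadd V x n) m"
      unfolding coset_def by blast
    then have "vadd V n m \<in> N" "z = vadd V x (vadd V n m)"
      by (simp_all add: add_assoc)
    then show "z \<in> coset V N x"
      unfolding coset_def by blast
  next
    fix z assume "z \<in> coset V N x"
    then obtain m where "m \<in> N" "z = vadd V x m"
      unfolding coset_def by blast
    then have "vadd V (vminus n) m \<in> N" "z = vadd V (vadd V x n) (vadd V (vminus n) m)"
      by (simp_all add: add_assoc add_minus_cancel)
    then show "z \<in> coset V N (vadd V x n)"
      unfolding coset_def by blast
  qed
qed

lemma coset_eq_iff:
  assumes x: "x \<in> carrier V" and y: "y \<in> carrier V"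
  shows "coset V N x = coset V N y \<longleftrightarrow> vadd V x (vminus y) \<in> N"
proof
  assume "coset V N x = coset V N y"
  then have "x \<in> coset V N y"
    using coset_mem[OF x] by simp
  then obtain n where n: "n \<in> N" "x = vadd V y n"
    using coset_memD[OF y] by metis
  have "vadd V x (vminus y) = n"
    unfolding n(2) using y n(1)
    by (subst add_commute[of y n]) (simp_all add: sub_carrier add_assoc)
  then show "vadd V x (vminus y) \<in> N"
    using n by simp
next
  assume *: "vadd V x (vminus y) \<in> N"
  have "vadd V y (vadd V x (vminus y)) = x"
    using x y by (subst add_left_commute) simp_all
  then show "coset V N x = coset V N y"
    using coset_add_sub[OF y *] by simp
qed

end

end

lemma vsp_iff: "vsp V \<longleftrightarrow> vector_space_on V"
  by (simp add: vsp_def)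

lemma vlinearD:
  assumes "vlinear V W f"
  shows "x \<in> carrier V \<Longrightarrow> f x \<in> carrier W"
    and "x \<in> carrier V \<Longrightarrow> y \<in> carrier V \<Longrightarrow> f (vadd V x y) = vadd W (f x) (f y)"
    and "x \<in> carrier V \<Longrightarrow> f (vscale V c x) = vscale W c (f x)"
  using assms unfolding vlinear_def by auto

lemma vlinear_zero:
  assumes "vlinear V W f" "vector_space_on V" "vector_space_on W"
  shows "f (vzero V) = vzero W"
proof -
  interpret V: vsp V by (simp add: vsp_iff assms)
  interpret W: vsp W by (simp add: vsp_iff assms)
  have "f (vscale V 0 (vzero V)) = vscale W 0 (f (vzero V))"
    by (rule vlinearD[OF assms(1)]) simp
  then show ?thesis
    using vlinearD(1)[OF assms(1) V.zero_mem] by simp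
qed

definition vbilinear ::
    "('k, 'a, 'l) vspace_scheme \<Rightarrow> ('k, 'b, 'm) vspace_scheme \<Rightarrow> ('k, 'c, 'n) vspace_scheme \<Rightarrow>
     ('a \<Rightarrow> 'b \<Rightarrow> 'c) \<Rightarrow> bool" where
  "vbilinear U V W f \<longleftrightarrow>
     (\<forall>u\<in>carrier U. vlinear V W (f u)) \<and> (\<forall>v\<in>carrier V. vlinear U W (\<lambda>u. f u v))"

lemma vbilinearD:
  assumes "vbilinear U V W f"
  shows "u \<in> carrier U \<Longrightarrow> vlinear V W (f u)"
    and "v \<in> carrier V \<Longrightarrow> vlinear U W (\<lambda>u. f u v)"
  using assms unfolding vbilinear_def by auto

subsection \<open>Spans\<close>

lemma vsubspaceD:
  assumes "vsubspace V N"
  shows "N \<subseteq> carrier V" "vzero V \<in> N"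
    and "x \<in> N \<Longrightarrow> y \<in> N \<Longrightarrow> vadd V x y \<in> N" and "x \<in> N \<Longrightarrow> vscale V c x \<in> N"
  using assms unfolding vsubspace_def by auto

lemma vsubspace_carrier: "vector_space_on V \<Longrightarrow> vsubspace V (carrier V)"
  unfolding vsubspace_def vector_space_on_def by auto

lemma vspan_superset: "S \<subseteq> vspan V S"
  unfolding vspan_def by auto

lemma vspan_least: "vsubspace V N \<Longrightarrow> S \<subseteq> N \<Longrightarrow> vspan V S \<subseteq> N"
  unfolding vspan_def by auto

lemma vsubspace_vspan:
  assumes "vector_space_on V" "S \<subseteq> carrier V"
  shows "vsubspace V (vspan V S)"
proof -
  have "vspan V S \<subseteq> carrier V"
    using vspan_least[OF vsubspace_carrier] assms .
  then show ?thesis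
    unfolding vsubspace_def vspan_def by auto
qed

lemma vsubspace_vimage:
  assumes f: "vlinear V W f" and V: "vector_space_on V" and W: "vector_space_on W"
    and N: "vsubspace W N"
  shows "vsubspace V {x \<in> carrier V. f x \<in> N}"
  using vlinearD[OF f] vlinear_zero[OF f V W] vsubspaceD[OF N] V
  unfolding vsubspace_def vector_space_on_def by auto

lemma vspan_image_subset:
  assumes f: "vlinear V W f" and V: "vector_space_on V" and W: "vector_space_on W"
    and N: "vsubspace W N" and S: "S \<subseteq> carrier V" "f ` S \<subseteq> N"
  shows "f ` vspan V S \<subseteq> N"
  using vspan_least[OF vsubspace_vimage[OF f V W N], of S] S by auto

subsection \<open>Quotients\<close>

lemma qlift_eq:
  assumes "X \<noteq> {}" "\<And>x. x \<in> X \<Longrightarrow> coset V N (f x) = Z"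
  shows "qlift V N f X = Z"
  using assms unfolding qlift_def by auto

lemma qlift2_eq:
  assumes "X \<noteq> {}" "Y \<noteq> {}" "\<And>x y. x \<in> X \<Longrightarrow> y \<in> Y \<Longrightarrow> coset V N (f x y) = Z"
  shows "qlift2 V N f X Y = Z"
  using assms unfolding qlift2_def by auto

lemma qlift_coset:
  assumes f: "vlinear U V f" and U: "vector_space_on U" and V: "vector_space_on V"
    and M: "vsubspace U M" and N: "vsubspace V N" and MN: "f ` M \<subseteq> N" and x: "x \<in> carrier U"
  shows "qlift V N f (coset U M x) = coset V N (f x)"
proof (rule qlift_eq)
  interpret U: vsp U by (simp add: vsp_iff U)
  interpret V: vsp V by (simp add: vsp_iff V)
  show "coset U M x \<noteq> {}"
    using U.coset_mem[OF M x] by auto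
  fix x' assume "x' \<in> coset U M x"
  then obtain m where m: "m \<in> M" "x' = vadd U x m"
    using U.coset_memD[OF M x] by metis
  then have "f x' = vadd V (f x) (f m)"
    using x U.sub_carrier[OF M] vlinearD[OF f] by simp
  then show "coset V N (f x') = coset V N (f x)"
    using V.coset_add_sub[OF N] MN m vlinearD(1)[OF f x] by auto
qed

lemma qlift2_coset:
  assumes f: "vbilinear U U' V f"
    and U: "vector_space_on U" and U': "vector_space_on U'" and V: "vector_space_on V"
    and M: "vsubspace U M" and M': "vsubspace U' M'" and N: "vsubspace V N"
    and MN: "\<And>m u'. m \<in> M \<Longrightarrow> u' \<in> carrier U' \<Longrightarrow> f m u' \<in> N"
    and MN': "\<And>u m'. u \<in> carrier U \<Longrightarrow> m' \<in> M' \<Longrightarrow> f u m' \<in> N"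
    and x: "x \<in> carrier U" and y: "y \<in> carrier U'"
  shows "qlift2 V N f (coset U M x) (coset U' M' y) = coset V N (f x y)"
proof (rule qlift2_eq)
  interpret U: vsp U by (simp add: vsp_iff U)
  interpret U': vsp U' by (simp add: vsp_iff U')
  interpret V: vsp V by (simp add: vsp_iff V)
  show "coset U M x \<noteq> {}" "coset U' M' y \<noteq> {}"
    using U.coset_mem[OF M x] U'.coset_mem[OF M' y] by auto
  fix x' y' assume "x' \<in> coset U M x" "y' \<in> coset U' M' y"
  then obtain m m' where m: "m \<in> M" "x' = vadd U x m" "x' \<in> carrier U"
      and m': "m' \<in> M'" "y' = vadd U' y m'" "y' \<in> carrier U'"
    using U.coset_memD[OF M x] U'.coset_memD[OF M' y] by metis
  have mc: "m \<in> carrier U" "m' \<in> carrier U'"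
    using m m' U.sub_carrier[OF M] U'.sub_carrier[OF M'] by auto
  have "f x' y' = vadd V (f x y') (f m y')"
    using vlinearD(2)[OF vbilinearD(2)[OF f m'(3)] x mc(1)] m by simp
  moreover have "f x y' = vadd V (f x y) (f x m')"
    using vlinearD(2)[OF vbilinearD(1)[OF f x] y mc(2)] m' by simp
  moreover have "f x y \<in> carrier V" "f x y' \<in> carrier V"
    using vlinearD(1)[OF vbilinearD(1)[OF f x]] y m' by auto
  ultimately show "coset V N (f x' y') = coset V N (f x y)"
    using V.coset_add_sub[OF N] MN[OF m(1) m'(3)] MN'[OF x m'(1)] by simp
qed

lemma carrier_vquot [simp]: "carrier (vquot V N) = coset V N ` carrier V"
  and vzero_vquot [simp]: "vzero (vquot V N) = coset V N (vzero V)"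
  by (simp_all add: vquot_def)

context
  fixes V :: "('k::field, 'a, 'm) vspace_scheme" and N
  assumes V: "vector_space_on V" and N: "vsubspace V N"
begin

interpretation vsp V by (simp add: vsp_iff V)

lemma vadd_vquot:
  assumes x: "x \<in> carrier V" and y: "y \<in> carrier V"
  shows "vadd (vquot V N) (coset V N x) (coset V N y) = coset V N (vadd V x y)"
proof -
  have "coset V N (vadd V x' y') = coset V N (vadd V x y)"
    if x': "x' \<in> coset V N x" and y': "y' \<in> coset V N y" for x' y'
  proof -
    obtain m n where m: "m \<in> N" "x' = vadd V x m" and n: "n \<in> N" "y' = vadd V y n"
      using coset_memD[OF N x x'] coset_memD[OF N y y'] by metis
    have "m \<in> carrier V" "n \<in> carrier V"
      using m n sub_carrier[OF N] by auto
    then have "vadd V x' y' = vadd V (vadd V x y) (vadd V m n)"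
      using m n x y by (simp add: add_ac)
    then show ?thesis
      using coset_add_sub[OF N] sub_add[OF N] m n x y by simp
  qed
  moreover have "coset V N x \<noteq> {}" "coset V N y \<noteq> {}"
    using coset_mem[OF N x] coset_mem[OF N y] by blast+
  ultimately have "qlift2 V N (vadd V) (coset V N x) (coset V N y) = coset V N (vadd V x y)"
    by (intro qlift2_eq)
  then show ?thesis
    by (simp add: vquot_def)
qed

lemma vscale_vquot:
  assumes x: "x \<in> carrier V"
  shows "vscale (vquot V N) c (coset V N x) = coset V N (vscale V c x)"
proof -
  have "vlinear V V (vscale V c)"
    unfolding vlinear_def by (simp add: scale_add scale_scale mult.commute image_subset_iff)
  moreover have "vscale V c ` N \<subseteq> N"
    using sub_scale[OF N] by auto
  ultimately show ?thesis
    using V N x by (simp add: vquot_def qlift_coset)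
qed

lemma vector_space_on_vquot: "vector_space_on (vquot V N)"
  unfolding vector_space_on_def
  by (simp add: vadd_vquot vscale_vquot scale_add scale_add_left scale_scale add_assoc)
    (metis add_commute)

lemma vlinear_coset: "vlinear V (vquot V N) (coset V N)"
  unfolding vlinear_def by (auto simp: vadd_vquot vscale_vquot)

end

lemma vlinear_vquot:
  assumes f: "vlinear V W f" and V: "vector_space_on V" and N: "vsubspace V N"
    and g: "\<And>x. x \<in> carrier V \<Longrightarrow> g (coset V N x) = f x"
  shows "vlinear (vquot V N) W g"
  using V vlinearD[OF f]
  unfolding vlinear_def
  by (auto simp: g vadd_vquot[OF V N] vscale_vquot[OF V N] vector_space_on_def)

lemma vlinear_comp: "vlinear U V f \<Longrightarrow> vlinear V W g \<Longrightarrow> vlinear U W (\<lambda>x. g (f x))"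
  unfolding vlinear_def by (auto simp: image_subset_iff)

subsection \<open>Free vector spaces\<close>

lemma free_vspace_simps [simp]:
  "carrier (free_vspace X) = {p. Poly_Mapping.keys p \<subseteq> X}"
  "vzero (free_vspace X) = 0" "vadd (free_vspace X) = (+)" "vscale (free_vspace X) = pscale"
  by (simp_all add: free_vspace_def)

lemma keys_add_subset:
  fixes p q :: "'x \<Rightarrow>\<^sub>0 'k::field"
  shows "Poly_Mapping.keys p \<subseteq> X \<Longrightarrow> Poly_Mapping.keys q \<subseteq> X \<Longrightarrow> Poly_Mapping.keys (p + q) \<subseteq> X"
    and "Poly_Mapping.keys p \<subseteq> X \<Longrightarrow> Poly_Mapping.keys q \<subseteq> X \<Longrightarrow> Poly_Mapping.keys (p - q) \<subseteq> X"
    and "Poly_Mapping.keys p \<subseteq> X \<Longrightarrow> Poly_Mapping.keys (pscale c p) \<subseteq> X"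
    and "x \<in> X \<Longrightarrow> Poly_Mapping.keys (Poly_Mapping.single x c) \<subseteq> X"
  using keys_add[of p q] keys_diff[of p q] keys_pscale[of c p] by (auto split: if_splits)

lemma vector_space_free [simp]: "vector_space_on (free_vspace X)"
  unfolding vector_space_on_def
  by (simp add: keys_add_subset) (auto simp: lookup_add algebra_simps intro!: poly_mapping_eqI)

lemma coset_free_eq_iff:
  assumes N: "vsubspace (free_vspace X) N"
    and "Poly_Mapping.keys p \<subseteq> X" "Poly_Mapping.keys q \<subseteq> X"
  shows "coset (free_vspace X) N p = coset (free_vspace X) N q \<longleftrightarrow> p - q \<in> N"
proof -
  interpret vsp "free_vspace X" by (simp add: vsp_iff)
  show ?thesis
    using coset_eq_iff[OF N, of p q] assms by (simp add: pscale_minus)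
qed

lemma free_sub:
  assumes "vsubspace (free_vspace X) N"
  shows "p \<in> N \<Longrightarrow> Poly_Mapping.keys p \<subseteq> X" "0 \<in> N" "p \<in> N \<Longrightarrow> q \<in> N \<Longrightarrow> p + q \<in> N"
    and "p \<in> N \<Longrightarrow> pscale c p \<in> N"
    and "p \<in> N \<Longrightarrow> - p \<in> N" "p \<in> N \<Longrightarrow> q \<in> N \<Longrightarrow> p - q \<in> N"
proof -
  show 0: "p \<in> N \<Longrightarrow> Poly_Mapping.keys p \<subseteq> X" "0 \<in> N" "p \<in> N \<Longrightarrow> q \<in> N \<Longrightarrow> p + q \<in> N"
    and 1: "p \<in> N \<Longrightarrow> pscale c p \<in> N" for p q c
    using vsubspaceD[OF assms] by (simp_all add: subset_iff)
  show 2: "p \<in> N \<Longrightarrow> - p \<in> N" for p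
    using 1[of p "- 1"] by (simp add: pscale_minus)
  show "p \<in> N \<Longrightarrow> q \<in> N \<Longrightarrow> p - q \<in> N"
    using 0(3)[of p "- q"] 2[of q] by simp
qed

lemma free_sub_sum:
  assumes N: "vsubspace (free_vspace X) N" and f: "\<And>i. i \<in> I \<Longrightarrow> f i \<in> N"
  shows "(\<Sum>i\<in>I. f i) \<in> N"
  using f by (induction I rule: infinite_finite_induct) (simp_all add: free_sub[OF N])

lemma lin_mem:
  assumes N: "vsubspace (free_vspace X) N" and f: "\<And>x. x \<in> Poly_Mapping.keys p \<Longrightarrow> f x \<in> N"
  shows "lin f p \<in> N"
  unfolding lin_def by (intro free_sub_sum[OF N] free_sub(4)[OF N] f)

lemma vsubspace_free [simp]: "vsubspace (free_vspace X) {p. Poly_Mapping.keys p \<subseteq> X}"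
  using vsubspace_carrier[OF vector_space_free, of X] by (simp add: free_vspace_def)

lemma keys_lin: "(\<And>x. x \<in> Poly_Mapping.keys p \<Longrightarrow> Poly_Mapping.keys (f x) \<subseteq> X) \<Longrightarrow>
    Poly_Mapping.keys (lin f p) \<subseteq> X"
  using lin_mem[OF vsubspace_free, of p f X] by auto

lemma keys_push: "f ` Poly_Mapping.keys p \<subseteq> X \<Longrightarrow> Poly_Mapping.keys (push f p) \<subseteq> X"
  unfolding push_eq_lin by (intro keys_lin) auto

lemma vlinear_lin:
  "(\<And>x. x \<in> X \<Longrightarrow> Poly_Mapping.keys (f x) \<subseteq> Y) \<Longrightarrow> vlinear (free_vspace X) (free_vspace Y) (lin f)"
  unfolding vlinear_def by (simp add: lin_add lin_pscale image_subset_iff) (meson keys_lin subsetD)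

lemma vlinear_push: "f ` X \<subseteq> Y \<Longrightarrow> vlinear (free_vspace X) (free_vspace Y) (push f)"
  unfolding push_eq_lin by (rule vlinear_lin) auto

lemma vbilinear_push2:
  assumes f: "\<And>x y. x \<in> X \<Longrightarrow> y \<in> Y \<Longrightarrow> f x y \<in> Z"
  shows "vbilinear (free_vspace X) (free_vspace Y) (free_vspace Z) (push2 f)"
  unfolding vbilinear_def
proof (intro conjI ballI)
  fix p assume "p \<in> carrier (free_vspace X)"
  then have "vlinear (free_vspace Y) (free_vspace Z) (lin (\<lambda>y. lin (\<lambda>x. mono (f x y)) p))"
    using f by (intro vlinear_lin keys_lin) auto
  moreover have "push2 f p = lin (\<lambda>y. lin (\<lambda>x. mono (f x y)) p)"
    unfolding push2_eq_lin by (intro ext, rule lin_commute)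
  ultimately show "vlinear (free_vspace Y) (free_vspace Z) (push2 f p)"
    by simp
next
  fix q assume "q \<in> carrier (free_vspace Y)"
  then show "vlinear (free_vspace X) (free_vspace Z) (\<lambda>p. push2 f p q)"
    unfolding push2_eq_lin using f by (intro vlinear_lin keys_lin) auto
qed

lemma free_eq_sum_mono:
  assumes "vsubspace (free_vspace X) N" "\<And>x. x \<in> Poly_Mapping.keys p \<Longrightarrow> mono x \<in> N"
  shows "p \<in> N"
  using lin_mem[OF assms(1), of p mono] assms(2) by simp

section \<open>Ideals and quotients of operads\<close>

definition linear_operad :: "('k::field, 'a) operad \<Rightarrow> bool" where
  "linear_operad P \<longleftrightarrow> (\<forall>n. vector_space_on (ar P n)) \<and>
     (\<forall>n \<sigma>. \<sigma> permutes {1..n} \<longrightarrow> vlinear (ar P n) (ar P n) (act P n \<sigma>)) \<and>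
     (\<forall>m n i. 1 \<le> i \<and> i \<le> m \<longrightarrow>
        vbilinear (ar P m) (ar P n) (ar P (m + n - 1)) (pcomp P m n i)) \<and>
     unit P \<in> carrier (ar P 1)"

lemma linear_operadD:
  assumes "linear_operad P"
  shows "vector_space_on (ar P n)"
    and "\<sigma> permutes {1..n} \<Longrightarrow> vlinear (ar P n) (ar P n) (act P n \<sigma>)"
    and "1 \<le> i \<Longrightarrow> i \<le> m \<Longrightarrow> vbilinear (ar P m) (ar P n) (ar P (m + n - 1)) (pcomp P m n i)"
    and "unit P \<in> carrier (ar P 1)"
  using assms unfolding linear_operad_def by auto

lemma linear_operad_pcomp_mem:
  assumes "linear_operad P" "1 \<le> i" "i \<le> m" "p \<in> carrier (ar P m)" "q \<in> carrier (ar P n)"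
  shows "pcomp P m n i p q \<in> carrier (ar P (m + n - 1))"
  using vlinearD(1)[OF vbilinearD(1)[OF linear_operadD(3)[OF assms(1-3)] assms(4)] assms(5)] .

lemma operad_homD:
  assumes "operad_hom P Q \<phi>"
  shows "vlinear (ar P n) (ar Q n) (\<phi> n)"
    and "\<sigma> permutes {1..n} \<Longrightarrow> p \<in> carrier (ar P n) \<Longrightarrow>
      \<phi> n (act P n \<sigma> p) = act Q n \<sigma> (\<phi> n p)"
    and "1 \<le> i \<Longrightarrow> i \<le> m \<Longrightarrow> p \<in> carrier (ar P m) \<Longrightarrow> q \<in> carrier (ar P n) \<Longrightarrow>
      \<phi> (m + n - 1) (pcomp P m n i p q) = pcomp Q m n i (\<phi> m p) (\<phi> n q)"
    and "\<phi> 1 (unit P) = unit Q"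
  using assms unfolding operad_hom_def by auto

lemma operad_idealD:
  assumes "operad_ideal P I"
  shows "vsubspace (ar P n) (I n)"
    and "\<sigma> permutes {1..n} \<Longrightarrow> p \<in> I n \<Longrightarrow> act P n \<sigma> p \<in> I n"
    and "1 \<le> i \<Longrightarrow> i \<le> m \<Longrightarrow> p \<in> carrier (ar P m) \<Longrightarrow> q \<in> carrier (ar P n) \<Longrightarrow>
      p \<in> I m \<or> q \<in> I n \<Longrightarrow> pcomp P m n i p q \<in> I (m + n - 1)"
  using assms unfolding operad_ideal_def by auto

lemma operad_ideal_carrier:
  assumes "linear_operad P"
  shows "operad_ideal P (\<lambda>n. carrier (ar P n))"
  unfolding operad_ideal_def
  using vsubspace_carrier linear_operadD(1)[OF assms] linear_operad_pcomp_mem[OF assms]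
    vlinearD(1)[OF linear_operadD(2)[OF assms]] by blast

lemma mem_gen_ideal_iff:
  "x \<in> gen_ideal P k R n \<longleftrightarrow> (\<forall>I. operad_ideal P I \<longrightarrow> R \<subseteq> I k \<longrightarrow> x \<in> I n)"
  unfolding gen_ideal_def by blast

lemma operad_ideal_gen_ideal:
  assumes P: "linear_operad P" and R: "R \<subseteq> carrier (ar P k)"
  shows "operad_ideal P (gen_ideal P k R)"
proof -
  have "gen_ideal P k R n \<subseteq> carrier (ar P n)" for n
  proof
    fix x assume "x \<in> gen_ideal P k R n"
    then show "x \<in> carrier (ar P n)"
      using operad_ideal_carrier[OF P] R unfolding mem_gen_ideal_iff
      by (elim allE[of _ "\<lambda>n. carrier (ar P n)"]) simp
  qed
  moreover have "vzero (ar P n) \<in> gen_ideal P k R n" for n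
    unfolding mem_gen_ideal_iff by (intro allI impI vsubspaceD(2)[OF operad_idealD(1)])
  moreover have "vadd (ar P n) x y \<in> gen_ideal P k R n"
    if "x \<in> gen_ideal P k R n" "y \<in> gen_ideal P k R n" for n x y
    using that unfolding mem_gen_ideal_iff
    by (intro allI impI vsubspaceD(3)[OF operad_idealD(1)]) simp_all
  moreover have "vscale (ar P n) c x \<in> gen_ideal P k R n" if "x \<in> gen_ideal P k R n" for n c x
    using that unfolding mem_gen_ideal_iff
    by (intro allI impI vsubspaceD(4)[OF operad_idealD(1)]) simp_all
  moreover have "act P n \<sigma> x \<in> gen_ideal P k R n"
    if "\<sigma> permutes {1..n}" "x \<in> gen_ideal P k R n" for n \<sigma> x
    using that unfolding mem_gen_ideal_iff by (intro allI impI operad_idealD(2)) simp_all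
  moreover have "pcomp P m n i p q \<in> gen_ideal P k R (m + n - 1)"
    if "1 \<le> i" "i \<le> m" "p \<in> carrier (ar P m)" "q \<in> carrier (ar P n)"
      "p \<in> gen_ideal P k R m \<or> q \<in> gen_ideal P k R n" for m n i p q
    using that(5) operad_idealD(3)[OF _ that(1-4)] unfolding mem_gen_ideal_iff by blast
  ultimately show ?thesis
    unfolding operad_ideal_def vsubspace_def by blast
qed

lemma operad_ideal_vimage:
  assumes P: "linear_operad P" and Q: "linear_operad Q" and \<phi>: "operad_hom P Q \<phi>"
    and J: "operad_ideal Q J"
  shows "operad_ideal P (\<lambda>n. {x \<in> carrier (ar P n). \<phi> n x \<in> J n})"
  unfolding operad_ideal_def
proof (intro conjI allI impI ballI)
  fix n
  show "vsubspace (ar P n) {x \<in> carrier (ar P n). \<phi> n x \<in> J n}"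
    by (intro vsubspace_vimage[OF operad_homD(1)[OF \<phi>]] linear_operadD(1) P Q operad_idealD(1)[OF J])
next
  fix n \<sigma> p assume "\<sigma> permutes {1..n}" "p \<in> {x \<in> carrier (ar P n). \<phi> n x \<in> J n}"
  then show "act P n \<sigma> p \<in> {x \<in> carrier (ar P n). \<phi> n x \<in> J n}"
    using operad_homD(2)[OF \<phi>] operad_idealD(2)[OF J] vlinearD(1)[OF linear_operadD(2)[OF P]] by auto
next
  fix m n i p q
  assume i: "1 \<le> i \<and> i \<le> m" and p: "p \<in> carrier (ar P m)" and q: "q \<in> carrier (ar P n)"
    and pq: "p \<in> {x \<in> carrier (ar P m). \<phi> m x \<in> J m} \<or> q \<in> {x \<in> carrier (ar P n). \<phi> n x \<in> J n}"
  have "pcomp Q m n i (\<phi> m p) (\<phi> n q) \<in> J (m + n - 1)"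
    using i pq vlinearD(1)[OF operad_homD(1)[OF \<phi>]] p q by (intro operad_idealD(3)[OF J]) auto
  then show "pcomp P m n i p q \<in> {x \<in> carrier (ar P (m + n - 1)). \<phi> (m + n - 1) x \<in> J (m + n - 1)}"
    using i p q operad_homD(3)[OF \<phi>] linear_operad_pcomp_mem[OF P] by simp
qed

lemma gen_ideal_image_subset:
  assumes P: "linear_operad P" and Q: "linear_operad Q" and \<phi>: "operad_hom P Q \<phi>"
    and R: "R \<subseteq> carrier (ar P k)"
  shows "\<phi> n ` gen_ideal P k R n \<subseteq> gen_ideal Q k (\<phi> k ` R) n"
proof (clarsimp simp: mem_gen_ideal_iff)
  fix x J
  assume x: "\<forall>I. operad_ideal P I \<longrightarrow> R \<subseteq> I k \<longrightarrow> x \<in> I n" and J: "operad_ideal Q J" "\<phi> k ` R \<subseteq> J k"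
  have "R \<subseteq> {x \<in> carrier (ar P k). \<phi> k x \<in> J k}"
    using R J by auto
  then have "x \<in> {x \<in> carrier (ar P n). \<phi> n x \<in> J n}"
    using x[rule_format, OF operad_ideal_vimage[OF P Q \<phi> J(1)]] by simp
  then show "\<phi> n x \<in> J n"
    by simp
qed

lemma operad_iso_inv:
  assumes P: "linear_operad P" and \<phi>: "operad_iso P Q \<phi>"
  shows "operad_iso Q P (\<lambda>n. inv_into (carrier (ar P n)) (\<phi> n))"
proof -
  let ?\<psi> = "\<lambda>n. inv_into (carrier (ar P n)) (\<phi> n)"
  have hom: "operad_hom P Q \<phi>" and bij: "bij_betw (\<phi> n) (carrier (ar P n)) (carrier (ar Q n))" for n
    using \<phi> unfolding operad_iso_def by auto
  note h = operad_homD[OF hom]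
  have inv: "?\<psi> n (\<phi> n x) = x" if "x \<in> carrier (ar P n)" for n x
    using bij_betw_inv_into_left[OF bij that] .
  have ex: "\<exists>x\<in>carrier (ar P n). y = \<phi> n x" if "y \<in> carrier (ar Q n)" for n y
    using bij[of n] that unfolding bij_betw_def by blast
  have "vlinear (ar Q n) (ar P n) (?\<psi> n)" for n
    unfolding vlinear_def
  proof (intro conjI ballI allI)
    interpret vsp "ar P n"
      by (simp add: vsp_iff linear_operadD[OF P])
    show "?\<psi> n ` carrier (ar Q n) \<subseteq> carrier (ar P n)"
      by (auto dest!: ex simp: inv)
    fix x assume "x \<in> carrier (ar Q n)"
    then obtain x' where x': "x' \<in> carrier (ar P n)" "x = \<phi> n x'"
      using ex by blast
    show "?\<psi> n (vscale (ar Q n) c x) = vscale (ar P n) c (?\<psi> n x)" for c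
      unfolding x'(2) inv[OF x'(1)]
      using x' inv[of "vscale (ar P n) c x'" n] by (simp add: vlinearD[OF h(1)])
    fix y assume "y \<in> carrier (ar Q n)"
    then obtain y' where y': "y' \<in> carrier (ar P n)" "y = \<phi> n y'"
      using ex by blast
    show "?\<psi> n (vadd (ar Q n) x y) = vadd (ar P n) (?\<psi> n x) (?\<psi> n y)"
      unfolding x'(2) y'(2) inv[OF x'(1)] inv[OF y'(1)]
      using x' y' inv[of "vadd (ar P n) x' y'" n] by (simp add: vlinearD[OF h(1)])
  qed
  moreover have "?\<psi> n (act Q n \<sigma> q) = act P n \<sigma> (?\<psi> n q)"
    if \<sigma>: "\<sigma> permutes {1..n}" and q: "q \<in> carrier (ar Q n)" for n \<sigma> q
  proof -
    obtain q' where q': "q' \<in> carrier (ar P n)" "q = \<phi> n q'"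
      using ex q by blast
    show ?thesis
      unfolding q'(2) inv[OF q'(1)] h(2)[OF \<sigma> q'(1), symmetric]
      by (rule inv[OF vlinearD(1)[OF linear_operadD(2)[OF P \<sigma>] q'(1)]])
  qed
  moreover have "?\<psi> (m + n - 1) (pcomp Q m n i p q) = pcomp P m n i (?\<psi> m p) (?\<psi> n q)"
    if i: "1 \<le> i" "i \<le> m" and p: "p \<in> carrier (ar Q m)" and q: "q \<in> carrier (ar Q n)" for m n i p q
  proof -
    obtain p' q' where p': "p' \<in> carrier (ar P m)" "p = \<phi> m p'"
        and q': "q' \<in> carrier (ar P n)" "q = \<phi> n q'"
      using ex[OF p] ex[OF q] by blast
    show ?thesis
      unfolding p'(2) q'(2) inv[OF p'(1)] inv[OF q'(1)] h(3)[OF i p'(1) q'(1), symmetric]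
      by (rule inv[OF linear_operad_pcomp_mem[OF P i p'(1) q'(1)]])
  qed
  moreover have "?\<psi> 1 (unit Q) = unit P"
    using inv[OF linear_operadD(4)[OF P]] h(4) by simp
  ultimately show ?thesis
    unfolding operad_iso_def operad_hom_def using bij_betw_inv_into[OF bij] by simp
qed

lemma gen_ideal_image:
  assumes P: "linear_operad P" and Q: "linear_operad Q" and \<phi>: "operad_iso P Q \<phi>"
    and R: "R \<subseteq> carrier (ar P k)"
  shows "\<phi> n ` gen_ideal P k R n = gen_ideal Q k (\<phi> k ` R) n"
proof
  let ?\<psi> = "\<lambda>n. inv_into (carrier (ar P n)) (\<phi> n)"
  have hom: "operad_hom P Q \<phi>" and bij: "bij_betw (\<phi> n) (carrier (ar P n)) (carrier (ar Q n))" for n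
    using \<phi> unfolding operad_iso_def by auto
  show "\<phi> n ` gen_ideal P k R n \<subseteq> gen_ideal Q k (\<phi> k ` R) n"
    by (rule gen_ideal_image_subset[OF P Q hom R])
  have \<psi>: "operad_hom Q P ?\<psi>"
    using operad_iso_inv[OF P \<phi>] unfolding operad_iso_def by blast
  have R': "\<phi> k ` R \<subseteq> carrier (ar Q k)"
    using R bij unfolding bij_betw_def by blast
  have "?\<psi> k ` \<phi> k ` R = R"
    using R bij[of k] unfolding bij_betw_def by (meson inv_into_image_cancel)
  then have *: "?\<psi> n ` gen_ideal Q k (\<phi> k ` R) n \<subseteq> gen_ideal P k R n"
    using gen_ideal_image_subset[OF Q P \<psi> R', of n] by simp
  have "gen_ideal Q k (\<phi> k ` R) n \<subseteq> carrier (ar Q n)"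
    using vsubspaceD(1)[OF operad_idealD(1)[OF operad_ideal_gen_ideal[OF Q R']]] .
  then show "gen_ideal Q k (\<phi> k ` R) n \<subseteq> \<phi> n ` gen_ideal P k R n"
    using * bij_betw_inv_into_right[OF bij[of n]] by (force simp: image_subset_iff subset_iff image_iff)
qed

context
  fixes P :: "('k::field, 'a) operad" and I
  assumes P: "linear_operad P" and I: "operad_ideal P I"
begin

lemma act_quot_operad:
  assumes "\<sigma> permutes {1..n}" "p \<in> carrier (ar P n)"
  shows "act (quot_operad P I) n \<sigma> (coset (ar P n) (I n) p) = coset (ar P n) (I n) (act P n \<sigma> p)"
  using assms operad_idealD(2)[OF I]
  by (simp add: quot_operad_def)
    (intro qlift_coset linear_operadD[OF P] operad_idealD(1)[OF I], auto)

lemma pcomp_quot_operad: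
  assumes "1 \<le> i" "i \<le> m" "p \<in> carrier (ar P m)" "q \<in> carrier (ar P n)"
  shows "pcomp (quot_operad P I) m n i (coset (ar P m) (I m) p) (coset (ar P n) (I n) q) =
    coset (ar P (m + n - 1)) (I (m + n - 1)) (pcomp P m n i p q)"
proof -
  have "x \<in> carrier (ar P k)" if "x \<in> I k" for x k
    using that vsubspaceD(1)[OF operad_idealD(1)[OF I]] by blast
  then have "qlift2 (ar P (m + n - 1)) (I (m + n - 1)) (pcomp P m n i)
      (coset (ar P m) (I m) p) (coset (ar P n) (I n) q) =
    coset (ar P (m + n - 1)) (I (m + n - 1)) (pcomp P m n i p q)"
    using assms
    by (intro qlift2_coset[OF linear_operadD(3)[OF P assms(1,2)]] linear_operadD(1)[OF P]
        operad_idealD(1)[OF I] operad_idealD(3)[OF I assms(1,2)]) blast+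
  then show ?thesis
    by (simp only: quot_operad_def operad.select_convs)
qed

end

lemma operad_iso_quot:
  assumes P: "linear_operad P" and Q: "linear_operad Q" and \<phi>: "operad_iso P Q \<phi>"
    and I: "operad_ideal P I" and J: "operad_ideal Q J" and IJ: "\<And>n. \<phi> n ` I n = J n"
  defines "\<psi> \<equiv> \<lambda>n. qlift (ar Q n) (J n) (\<phi> n)"
  shows "operad_iso (quot_operad P I) (quot_operad Q J) \<psi>"
    and "x \<in> carrier (ar P n) \<Longrightarrow> \<psi> n (coset (ar P n) (I n) x) = coset (ar Q n) (J n) (\<phi> n x)"
proof -
  have hom: "operad_hom P Q \<phi>" and bij: "bij_betw (\<phi> n) (carrier (ar P n)) (carrier (ar Q n))" for n
    using \<phi> unfolding operad_iso_def by auto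
  note h = operad_homD[OF hom]
  show *: "\<psi> n (coset (ar P n) (I n) x) = coset (ar Q n) (J n) (\<phi> n x)"
    if "x \<in> carrier (ar P n)" for n x
    unfolding \<psi>_def
    by (intro qlift_coset[OF h(1)] linear_operadD(1) P Q operad_idealD(1) I J that) (simp add: IJ)
  note PQ = linear_operadD[OF P] linear_operadD[OF Q]
    and IJ' = operad_idealD(1)[OF I] operad_idealD(1)[OF J]
  have ar: "ar (quot_operad P I) n = vquot (ar P n) (I n)" "ar (quot_operad Q J) n = vquot (ar Q n) (J n)"
    for n by (simp_all add: quot_operad_def)
  have cQ: "\<phi> n x \<in> carrier (ar Q n)" if "x \<in> carrier (ar P n)" for n x
    using vlinearD(1)[OF h(1) that] .
  have "vlinear (vquot (ar P n) (I n)) (vquot (ar Q n) (J n)) (\<psi> n)" for n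
    by (rule vlinear_vquot[OF vlinear_comp[OF h(1) vlinear_coset] PQ(1) IJ'(1) *, OF PQ(5) IJ'(2)])
  moreover have "\<psi> n (act (quot_operad P I) n \<sigma> p) = act (quot_operad Q J) n \<sigma> (\<psi> n p)"
    if "\<sigma> permutes {1..n}" "p \<in> carrier (ar (quot_operad P I) n)" for n \<sigma> p
    using that vlinearD(1)[OF PQ(2)]
    by (auto simp: ar act_quot_operad[OF P I] act_quot_operad[OF Q J] * cQ h(2))
  moreover have "\<psi> (m + n - 1) (pcomp (quot_operad P I) m n i p q) =
      pcomp (quot_operad Q J) m n i (\<psi> m p) (\<psi> n q)"
    if i: "1 \<le> i" "i \<le> m" and pq: "p \<in> carrier (ar (quot_operad P I) m)"
      "q \<in> carrier (ar (quot_operad P I) n)" for m n i p q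
  proof -
    obtain p' q' where p': "p' \<in> carrier (ar P m)" "p = coset (ar P m) (I m) p'"
        and q': "q' \<in> carrier (ar P n)" "q = coset (ar P n) (I n) q'"
      using pq by (auto simp: ar)
    show ?thesis
      unfolding p'(2) q'(2) pcomp_quot_operad[OF P I i p'(1) q'(1)]
        *[OF p'(1)] *[OF q'(1)] *[OF linear_operad_pcomp_mem[OF P i p'(1) q'(1)]]
        pcomp_quot_operad[OF Q J i cQ[OF p'(1)] cQ[OF q'(1)]] h(3)[OF i p'(1) q'(1)] ..
  qed
  moreover have "\<psi> 1 (unit (quot_operad P I)) = unit (quot_operad Q J)"
    using *[OF PQ(4)] h(4) by (simp add: quot_operad_def)
  moreover have "bij_betw (\<psi> n) (carrier (vquot (ar P n) (I n))) (carrier (vquot (ar Q n) (J n)))" for n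
    unfolding bij_betw_def
  proof
    interpret vP: vsp "ar P n" by (simp add: vsp_iff PQ)
    interpret vQ: vsp "ar Q n" by (simp add: vsp_iff PQ)
    show "inj_on (\<psi> n) (carrier (vquot (ar P n) (I n)))"
    proof (rule inj_onI, clarsimp simp: *)
      fix x y assume xy: "x \<in> carrier (ar P n)" "y \<in> carrier (ar P n)"
        and "coset (ar Q n) (J n) (\<phi> n x) = coset (ar Q n) (J n) (\<phi> n y)"
      then have "vadd (ar Q n) (\<phi> n x) (vQ.vminus (\<phi> n y)) \<in> J n"
        using vQ.coset_eq_iff[OF IJ'(2)] cQ by simp
      then have "\<phi> n (vadd (ar P n) x (vP.vminus y)) \<in> \<phi> n ` I n"
        using xy by (simp add: vlinearD[OF h(1)] IJ)
      then have "vadd (ar P n) x (vP.vminus y) \<in> I n"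
        using bij[of n] xy vsubspaceD(1)[OF IJ'(1), of n] unfolding bij_betw_def
        by (metis (no_types, lifting) inj_on_image_mem_iff vP.add_mem vP.scale_mem)
      then show "coset (ar P n) (I n) x = coset (ar P n) (I n) y"
        using vP.coset_eq_iff[OF IJ'(1)] xy by simp
    qed
    have "\<psi> n ` coset (ar P n) (I n) ` carrier (ar P n) = coset (ar Q n) (J n) ` \<phi> n ` carrier (ar P n)"
      unfolding image_image by (rule image_cong) (simp_all add: *)
    then show "\<psi> n ` carrier (vquot (ar P n) (I n)) = carrier (vquot (ar Q n) (J n))"
      using bij[of n] unfolding bij_betw_def by simp
  qed
  ultimately show "operad_iso (quot_operad P I) (quot_operad Q J) \<psi>"
    unfolding operad_iso_def operad_hom_def by (simp add: ar)
qed

section \<open>The free operad\<close>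

declare One_nat_def [simp del]

subsection \<open>Trees and contexts\<close>

lemma leaves_graft: "leaves (graft s t) = concat (map (\<lambda>k. leaves (s k)) (leaves t))"
  by (induction t) auto

lemma labels_graft: "labels (graft s t) = labels t \<union> (\<Union>k\<in>set (leaves t). labels (s k))"
  by (induction t) auto

lemma graft_cong: "(\<And>k. k \<in> set (leaves t) \<Longrightarrow> s k = s' k) \<Longrightarrow> graft s t = graft s' t"
  by (induction t) auto

lemma leaves_relabel [simp]: "leaves (relabel f t) = map f (leaves t)"
  by (induction t) (auto simp: relabel_def)

lemma labels_relabel [simp]: "labels (relabel f t) = labels t"
  by (induction t) (auto simp: relabel_def)

lemma relabel_simps [simp]:
  "relabel f (Leaf k) = Leaf (f k)" "relabel f (Node v l r) = Node v (relabel f l) (relabel f r)"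
  by (simp_all add: relabel_def)

lemma leaves_map_tree [simp]: "leaves (map_tree f t) = leaves t"
  by (induction t) auto

lemma labels_map_tree [simp]: "labels (map_tree f t) = f ` labels t"
  by (induction t) auto

lemma map_tree_graft: "map_tree f (graft s t) = graft (\<lambda>k. map_tree f (s k)) (map_tree f t)"
  by (induction t) auto

lemma map_tree_relabel: "map_tree f (relabel g t) = relabel g (map_tree f t)"
  by (simp add: relabel_def map_tree_graft)

lemma map_tree_tree_comp: "map_tree f (tree_comp n i t s) = tree_comp n i (map_tree f t) (map_tree f s)"
  unfolding tree_comp_def map_tree_graft by (rule arg_cong2[of _ _ _ _ graft]) (auto simp: map_tree_relabel)

lemma map_tree_inverse:
  "(\<And>v. v \<in> labels t \<Longrightarrow> g (f v) = v) \<Longrightarrow> map_tree g (map_tree f t) = t"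
  by (induction t) auto

lemma context_leaves:
  "C \<in> tree_contexts \<Longrightarrow> \<exists>xs ys. \<forall>t. leaves (C t) = xs @ leaves t @ ys"
proof (induction rule: tree_contexts.induct)
  case (2 C v r)
  then obtain xs ys where "\<forall>t. leaves (C t) = xs @ leaves t @ ys" by blast
  then show ?case
    by (intro exI[of _ xs] exI[of _ "ys @ leaves r"]) simp
next
  case (3 C v l)
  then obtain xs ys where "\<forall>t. leaves (C t) = xs @ leaves t @ ys" by blast
  then show ?case
    by (intro exI[of _ "leaves l @ xs"] exI[of _ ys]) simp
qed (auto intro: exI[of _ "[]"])

lemma context_labels:
  "C \<in> tree_contexts \<Longrightarrow> \<exists>A. \<forall>t. labels (C t) = A \<union> labels t"
proof (induction rule: tree_contexts.induct)
  case (2 C v r)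
  then obtain A where "\<forall>t. labels (C t) = A \<union> labels t" by blast
  then show ?case
    by (intro exI[of _ "insert v (A \<union> labels r)"]) auto
next
  case (3 C v l)
  then obtain A where "\<forall>t. labels (C t) = A \<union> labels t" by blast
  then show ?case
    by (intro exI[of _ "insert v (A \<union> labels l)"]) auto
qed auto

lemma context_graft:
  "C \<in> tree_contexts \<Longrightarrow> \<exists>C'\<in>tree_contexts. \<forall>t. graft s (C t) = C' (graft s t)"
proof (induction rule: tree_contexts.induct)
  case 1
  show ?case by (auto intro!: bexI[of _ "\<lambda>t. t"] tree_contexts.intros)
next
  case (2 C v r)
  then obtain C' where "C' \<in> tree_contexts" "\<forall>t. graft s (C t) = C' (graft s t)" by blast
  then show ?case
    by (intro bexI[of _ "\<lambda>t. Node v (C' t) (graft s r)"] tree_contexts.intros) auto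
next
  case (3 C v l)
  then obtain C' where "C' \<in> tree_contexts" "\<forall>t. graft s (C t) = C' (graft s t)" by blast
  then show ?case
    by (intro bexI[of _ "\<lambda>t. Node v (graft s l) (C' t)"] tree_contexts.intros) auto
qed

lemma context_graft_Node:
  assumes C: "C \<in> tree_contexts"
  shows "\<exists>C'\<in>tree_contexts. \<exists>g. \<forall>v l r. graft s (C (Node v l r)) = C' (Node v (g l) (g r))"
proof -
  obtain C' where "C' \<in> tree_contexts" "\<And>t. graft s (C t) = C' (graft s t)"
    using context_graft[OF C, of s] by blast
  then show ?thesis
    by (intro bexI[of _ C'] exI[of _ "graft s"]) simp_all
qed

lemma context_map_tree:
  "C \<in> tree_contexts \<Longrightarrow> \<exists>C'\<in>tree_contexts. \<forall>t. map_tree f (C t) = C' (map_tree f t)"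
proof (induction rule: tree_contexts.induct)
  case 1
  show ?case by (auto intro!: bexI[of _ "\<lambda>t. t"] tree_contexts.intros)
next
  case (2 C v r)
  then obtain C' where "C' \<in> tree_contexts" "\<forall>t. map_tree f (C t) = C' (map_tree f t)" by blast
  then show ?case
    by (intro bexI[of _ "\<lambda>t. Node (f v) (C' t) (map_tree f r)"] tree_contexts.intros) auto
next
  case (3 C v l)
  then obtain C' where "C' \<in> tree_contexts" "\<forall>t. map_tree f (C t) = C' (map_tree f t)" by blast
  then show ?case
    by (intro bexI[of _ "\<lambda>t. Node (f v) (map_tree f l) (C' t)"] tree_contexts.intros) auto
qed

lemma graft_leaf_context:
  "distinct (leaves t) \<Longrightarrow> i \<in> set (leaves t) \<Longrightarrow>
    \<exists>C\<in>tree_contexts. \<forall>y. graft (s(i := y)) t = C y"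
proof (induction t)
  case (Leaf k)
  then show ?case by (auto intro!: bexI[of _ "\<lambda>t. t"] tree_contexts.intros)
next
  case (Node v l r)
  have *: "graft (s(i := y)) t = graft s t" if "i \<notin> set (leaves t)" for y t
    using that by (intro graft_cong) auto
  show ?case
  proof (cases "i \<in> set (leaves l)")
    case True
    then obtain C where "C \<in> tree_contexts" "\<forall>y. graft (s(i := y)) l = C y"
      using Node.IH(1) Node.prems(1) by (auto simp del: fun_upd_apply)
    moreover have "i \<notin> set (leaves r)"
      using True Node.prems by auto
    ultimately show ?thesis
      by (intro bexI[of _ "\<lambda>t. Node v (C t) (graft s r)"] tree_contexts.intros) (simp_all add: * del: fun_upd_apply)
  next
    case False
    then obtain C where "C \<in> tree_contexts" "\<forall>y. graft (s(i := y)) r = C y"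
      using Node.IH(2) Node.prems by (auto simp del: fun_upd_apply)
    then show ?thesis using False
      by (intro bexI[of _ "\<lambda>t. Node v (graft s l) (C t)"] tree_contexts.intros) (simp_all add: * del: fun_upd_apply)
  qed
qed

lemma context_trees:
  assumes C: "C \<in> tree_contexts" and t: "C t \<in> trees V n"
    and "labels t' \<subseteq> carrier V" "set (leaves t') = set (leaves t)"
    and "distinct (leaves t) \<Longrightarrow> distinct (leaves t')"
  shows "C t' \<in> trees V n"
proof -
  obtain xs ys where "\<forall>t. leaves (C t) = xs @ leaves t @ ys"
    using context_leaves[OF C] by blast
  moreover obtain A where "\<forall>t. labels (C t) = A \<union> labels t"
    using context_labels[OF C] by blast
  ultimately show ?thesis
    using assms unfolding trees_def by auto
qed

lemma context_treesD:
  assumes C: "C \<in> tree_contexts" and t: "C t \<in> trees V n"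
  shows "labels t \<subseteq> carrier V" "distinct (leaves t)"
proof -
  obtain xs ys where "\<forall>t. leaves (C t) = xs @ leaves t @ ys"
    using context_leaves[OF C] by blast
  moreover obtain A where "\<forall>t. labels (C t) = A \<union> labels t"
    using context_labels[OF C] by blast
  ultimately show "labels t \<subseteq> carrier V" "distinct (leaves t)"
    using assms unfolding trees_def by auto
qed

lemma context_trees_label:
  assumes "C \<in> tree_contexts" "C (Node v l r) \<in> trees V n" "v' \<in> carrier V"
  shows "C (Node v' l r) \<in> trees V n" "C (Node v' r l) \<in> trees V n"
  using context_treesD[OF assms(1,2)] assms(3)
  by (auto intro!: context_trees[OF assms(1,2)])

lemma context_trees_labelD:
  "C \<in> tree_contexts \<Longrightarrow> C (Node v l r) \<in> trees V n \<Longrightarrow> v \<in> carrier V"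
  using context_treesD(1) by fastforce

lemma relabel_trees: "\<sigma> permutes {1..n} \<Longrightarrow> t \<in> trees V n \<Longrightarrow> relabel \<sigma> t \<in> trees V n"
  unfolding trees_def by (auto simp: distinct_map permutes_image permutes_inj_on)

lemma distinct_concat_map:
  "distinct xs \<Longrightarrow> (\<And>x. x \<in> set xs \<Longrightarrow> distinct (g x)) \<Longrightarrow>
    (\<And>x y. x \<in> set xs \<Longrightarrow> y \<in> set xs \<Longrightarrow> x \<noteq> y \<Longrightarrow> set (g x) \<inter> set (g y) = {}) \<Longrightarrow>
    distinct (concat (map g xs))"
proof (induction xs)
  case (Cons x xs)
  have "set (g x) \<inter> set (g y) = {}" if "y \<in> set xs" for y
    using Cons.prems(1) that by (intro Cons.prems(3)) auto
  moreover have "distinct (concat (map g xs))"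
    using Cons by simp
  ultimately show ?case
    using Cons.prems(2) by auto
qed simp

lemma leaves_nonempty: "leaves t \<noteq> []"
  by (induction t) auto

lemma trees_zero: "t \<in> trees V 0 \<Longrightarrow> False"
  using leaves_nonempty[of t] by (auto simp: trees_def)

lemma tree_comp_trees:
  assumes i: "1 \<le> i" "i \<le> m" and t: "t \<in> trees V m" and s: "s \<in> trees V n"
  shows "tree_comp n i t s \<in> trees V (m + n - 1)"
proof -
  have n: "1 \<le> n"
    using trees_zero s by (cases n) auto
  define g where "g k = (if k < i then [k] else if k = i then map (\<lambda>j. j + i - 1) (leaves s)
    else [k + n - 1])" for k
  have leaves: "leaves (tree_comp n i t s) = concat (map g (leaves t))"
    unfolding tree_comp_def leaves_graft by (rule arg_cong[of _ _ concat]) (auto simp: g_def)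
  have set_s: "set (leaves s) = {1..n}" "distinct (leaves s)"
    using s by (auto simp: trees_def)
  have set_g: "set (g k) = (if k < i then {k} else if k = i then {i..i + n - 1} else {k + n - 1})" for k
  proof -
    have "(\<lambda>j. j + i - 1) ` {1..n} = {i..i + n - 1}"
    proof (intro set_eqI iffI)
      fix x assume "x \<in> {i..i + n - 1}"
      then show "x \<in> (\<lambda>j. j + i - 1) ` {1..n}"
        using i n by (intro image_eqI[of _ _ "x + 1 - i"]) auto
    qed (use i n in auto)
    then show ?thesis
      using set_s by (auto simp: g_def)
  qed
  have "distinct (concat (map g (leaves t)))"
  proof (rule distinct_concat_map)
    show "distinct (g k)" for k
      using set_s i by (auto simp: g_def distinct_map inj_on_def)
    show "set (g x) \<inter> set (g y) = {}" if "x \<noteq> y" for x y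
      using that n i unfolding set_g by auto
  qed (use t in \<open>simp add: trees_def\<close>)
  moreover have "(\<Union>k\<in>{1..m}. set (g k)) = {1..m + n - 1}"
  proof (intro set_eqI iffI)
    fix x assume x: "x \<in> {1..m + n - 1}"
    consider "x < i" | "i \<le> x" "x \<le> i + n - 1" | "i + n - 1 < x"
      by linarith
    then show "x \<in> (\<Union>k\<in>{1..m}. set (g k))"
    proof cases
      case 1
      then show ?thesis using x i by (intro UN_I[of x]) (auto simp: set_g)
    next
      case 2
      then show ?thesis using x i by (intro UN_I[of i]) (auto simp: set_g)
    next
      case 3
      then show ?thesis using x i n by (intro UN_I[of "x + 1 - n"]) (auto simp: set_g)
    qed
  qed (use i n in \<open>auto simp: set_g split: if_splits\<close>)
  moreover have "labels (tree_comp n i t s) \<subseteq> carrier V"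
    using s t unfolding tree_comp_def labels_graft trees_def by (auto split: if_splits)
  ultimately show ?thesis
    using t unfolding trees_def by (simp add: leaves)
qed

subsection \<open>Tree classes\<close>

definition s2_closed :: "('k, 'v) s2_module \<Rightarrow> bool" where
  "s2_closed V \<longleftrightarrow> (\<forall>v\<in>carrier V. \<forall>v'\<in>carrier V. vadd V v v' \<in> carrier V) \<and>
     (\<forall>c. \<forall>v\<in>carrier V. vscale V c v \<in> carrier V) \<and> (\<forall>v\<in>carrier V. swap V v \<in> carrier V)"

lemma s2_closedD:
  assumes "s2_closed V" "v \<in> carrier V"
  shows "v' \<in> carrier V \<Longrightarrow> vadd V v v' \<in> carrier V" "vscale V c v \<in> carrier V" "swap V v \<in> carrier V"
  using assms unfolding s2_closed_def by auto

lemma vector_space_tree_free [simp]: "vector_space_on (tree_free V n)"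
  by (simp add: tree_free_def)

lemma tree_free_simps [simp]:
  "carrier (tree_free V n) = {p. Poly_Mapping.keys p \<subseteq> trees V n}"
  "vzero (tree_free V n) = 0" "vadd (tree_free V n) = (+)" "vscale (tree_free V n) = pscale"
  by (simp_all add: tree_free_def)

locale s2_mod =
  fixes V :: "('k::field, 'v) s2_module"
  assumes closed: "s2_closed V"
begin

lemma tree_rel_trees:
  assumes C: "C \<in> tree_contexts" and t: "C (Node v l r) \<in> trees V n"
  shows "v \<in> carrier V" "v' \<in> carrier V \<Longrightarrow> C (Node (vadd V v v') l r) \<in> trees V n"
    and "C (Node (vscale V c v) l r) \<in> trees V n" "C (Node (swap V v) l r) \<in> trees V n"
    and "C (Node v r l) \<in> trees V n" "v' \<in> carrier V \<Longrightarrow> C (Node v' l r) \<in> trees V n"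
proof -
  show v: "v \<in> carrier V"
    by (rule context_trees_labelD[OF C t])
  show "v' \<in> carrier V \<Longrightarrow> C (Node (vadd V v v') l r) \<in> trees V n"
    "C (Node (vscale V c v) l r) \<in> trees V n" "C (Node (swap V v) l r) \<in> trees V n"
    "C (Node v r l) \<in> trees V n" "v' \<in> carrier V \<Longrightarrow> C (Node v' l r) \<in> trees V n"
    by (intro context_trees_label[OF C t] s2_closedD[OF closed] v, assumption?)+
qed

lemma tree_rel_keys:
  "{mono (C (Node (vadd V v v') l r)) - mono (C (Node v l r)) - mono (C (Node v' l r)) |
        C v v' l r. C \<in> tree_contexts \<and> v' \<in> carrier V \<and> C (Node v l r) \<in> trees V n} \<union>
     {mono (C (Node (vscale V c v) l r)) - Poly_Mapping.single (C (Node v l r)) c |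
        C c v l r. C \<in> tree_contexts \<and> C (Node v l r) \<in> trees V n} \<union>
     {mono (C (Node (swap V v) l r)) - mono (C (Node v r l)) |
        C v l r. C \<in> tree_contexts \<and> C (Node v l r) \<in> trees V n} \<subseteq> carrier (tree_free V n)"
proof (intro Un_least subsetI; clarify)
  fix C v v' l r
  assume *: "C \<in> tree_contexts" "v' \<in> carrier V" "C (Node v l r) \<in> trees V n"
  then show "mono (C (Node (vadd V v v') l r)) - mono (C (Node v l r)) - mono (C (Node v' l r))
      \<in> carrier (tree_free V n)"
    using tree_rel_trees[OF *(1,3)] by (simp add: keys_add_subset)
next
  fix C c v l r
  assume *: "C \<in> tree_contexts" "C (Node v l r) \<in> trees V n"
  then show "mono (C (Node (vscale V c v) l r)) - Poly_Mapping.single (C (Node v l r)) c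
      \<in> carrier (tree_free V n)"
    using tree_rel_trees[OF *] by (simp add: keys_add_subset del: keys_single)
next
  fix C v l r
  assume *: "C \<in> tree_contexts" "C (Node v l r) \<in> trees V n"
  then show "mono (C (Node (swap V v) l r)) - mono (C (Node v r l)) \<in> carrier (tree_free V n)"
    using tree_rel_trees[OF *] by (simp add: keys_add_subset)
qed

lemma vsubspace_tree_null [simp]: "vsubspace (tree_free V n) (tree_null V n)"
  unfolding tree_null_def
  by (rule vsubspace_vspan[OF vector_space_tree_free tree_rel_keys])

lemma vsubspace_tree_null_free [simp]: "vsubspace (free_vspace (trees V n)) (tree_null V n)"
  using vsubspace_tree_null[of n] by (simp add: tree_free_def)

lemma tree_null_add:
  "C \<in> tree_contexts \<Longrightarrow> v' \<in> carrier V \<Longrightarrow> C (Node v l r) \<in> trees V n \<Longrightarrow>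
    mono (C (Node (vadd V v v') l r)) - mono (C (Node v l r)) - mono (C (Node v' l r)) \<in> tree_null V n"
  unfolding tree_null_def by (rule subsetD[OF vspan_superset]) blast

lemma tree_null_scale:
  "C \<in> tree_contexts \<Longrightarrow> C (Node v l r) \<in> trees V n \<Longrightarrow>
    mono (C (Node (vscale V c v) l r)) - Poly_Mapping.single (C (Node v l r)) c \<in> tree_null V n"
  unfolding tree_null_def by (rule subsetD[OF vspan_superset]) blast

lemma tree_null_swap:
  "C \<in> tree_contexts \<Longrightarrow> C (Node v l r) \<in> trees V n \<Longrightarrow>
    mono (C (Node (swap V v) l r)) - mono (C (Node v r l)) \<in> tree_null V n"
  unfolding tree_null_def by (rule subsetD[OF vspan_superset]) blast

lemma tree_null_lin:
  assumes N: "vsubspace (free_vspace X) N"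
    and keys: "\<And>t. t \<in> trees V n \<Longrightarrow> Poly_Mapping.keys (h t) \<subseteq> X"
    and add: "\<And>C v v' l r. C \<in> tree_contexts \<Longrightarrow> v \<in> carrier V \<Longrightarrow> v' \<in> carrier V \<Longrightarrow>
      C (Node v l r) \<in> trees V n \<Longrightarrow>
      h (C (Node (vadd V v v') l r)) - h (C (Node v l r)) - h (C (Node v' l r)) \<in> N"
    and scale: "\<And>C c v l r. C \<in> tree_contexts \<Longrightarrow> v \<in> carrier V \<Longrightarrow> C (Node v l r) \<in> trees V n \<Longrightarrow>
      h (C (Node (vscale V c v) l r)) - pscale c (h (C (Node v l r))) \<in> N"
    and swap: "\<And>C v l r. C \<in> tree_contexts \<Longrightarrow> v \<in> carrier V \<Longrightarrow> C (Node v l r) \<in> trees V n \<Longrightarrow>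
      h (C (Node (swap V v) l r)) - h (C (Node v r l)) \<in> N"
    and p: "p \<in> tree_null V n"
  shows "lin h p \<in> N"
proof -
  have "vlinear (tree_free V n) (free_vspace X) (lin h)"
    unfolding tree_free_def by (rule vlinear_lin) (rule keys)
  then have "lin h ` tree_null V n \<subseteq> N"
    unfolding tree_null_def
    apply (rule vspan_image_subset[OF _ vector_space_tree_free vector_space_free N tree_rel_keys])
    using add scale swap tree_rel_trees(1)
    by (intro image_subsetI) (elim UnE CollectE exE conjE; simp add: lin_diff lin_single)
  then show ?thesis
    using p by auto
qed

lemma push_tree_null:
  assumes W: "s2_mod W"
    and keys: "\<And>t. t \<in> trees V n \<Longrightarrow> h t \<in> trees W n'"
    and f: "\<And>v v'. v \<in> carrier V \<Longrightarrow> v' \<in> carrier V \<Longrightarrow> f (vadd V v v') = vadd W (f v) (f v')"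
      "\<And>c v. v \<in> carrier V \<Longrightarrow> f (vscale V c v) = vscale W c (f v)"
      "\<And>v. v \<in> carrier V \<Longrightarrow> f (swap V v) = swap W (f v)"
      "\<And>v. v \<in> carrier V \<Longrightarrow> f v \<in> carrier W"
    and h: "\<And>C. C \<in> tree_contexts \<Longrightarrow> (\<exists>v l r. C (Node v l r) \<in> trees V n) \<Longrightarrow>
      \<exists>C'\<in>tree_contexts. \<exists>g. \<forall>v l r. h (C (Node v l r)) = C' (Node (f v) (g l) (g r))"
    and p: "p \<in> tree_null V n"
  shows "push h p \<in> tree_null W n'"
proof -
  interpret W: s2_mod W by (rule W)
  have *: "\<exists>C'\<in>tree_contexts. \<exists>g. (\<forall>v l r. h (C (Node v l r)) = C' (Node (f v) (g l) (g r))) \<and>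
      C' (Node (f v) (g l) (g r)) \<in> trees W n'"
    if "C \<in> tree_contexts" "C (Node v l r) \<in> trees V n" for C v l r
    using h[OF that(1)] that keys by metis
  show ?thesis
    unfolding push_eq_lin
  proof (rule tree_null_lin[OF W.vsubspace_tree_null_free _ _ _ _ p])
    fix C v v' l r assume "C \<in> tree_contexts" "C (Node v l r) \<in> trees V n"
      and v: "v \<in> carrier V" "v' \<in> carrier V"
    then obtain C' g where "C' \<in> tree_contexts" "C' (Node (f v) (g l) (g r)) \<in> trees W n'"
      and "\<forall>v l r. h (C (Node v l r)) = C' (Node (f v) (g l) (g r))"
      using * by blast
    then show "mono (h (C (Node (vadd V v v') l r))) - mono (h (C (Node v l r))) -
        mono (h (C (Node v' l r))) \<in> tree_null W n'"
      using W.tree_null_add f v by simp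
  next
    fix C c v l r assume "C \<in> tree_contexts" "C (Node v l r) \<in> trees V n" and v: "v \<in> carrier V"
    then obtain C' g where "C' \<in> tree_contexts" "C' (Node (f v) (g l) (g r)) \<in> trees W n'"
      and "\<forall>v l r. h (C (Node v l r)) = C' (Node (f v) (g l) (g r))"
      using * by blast
    then show "mono (h (C (Node (vscale V c v) l r))) - pscale c (mono (h (C (Node v l r)))) \<in>
        tree_null W n'"
      and "mono (h (C (Node (swap V v) l r))) - mono (h (C (Node v r l))) \<in> tree_null W n'"
      using W.tree_null_scale W.tree_null_swap f v by simp_all
  qed (use keys in auto)
qed

lemma push_relabel_null:
  assumes \<sigma>: "\<sigma> permutes {1..n}" and p: "p \<in> tree_null V n"
  shows "push (relabel \<sigma>) p \<in> tree_null V n"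
proof (rule push_tree_null[where f = "\<lambda>v. v", OF s2_mod_axioms relabel_trees[OF \<sigma>] _ _ _ _ _ p])
  fix C :: "'v tree \<Rightarrow> 'v tree" assume "C \<in> tree_contexts"
  then show "\<exists>C'\<in>tree_contexts. \<exists>g. \<forall>v l r. relabel \<sigma> (C (Node v l r)) = C' (Node v (g l) (g r))"
    unfolding relabel_def by (rule context_graft_Node)
qed simp_all

lemma push_tree_comp_null_left:
  assumes i: "1 \<le> i" "i \<le> m" and s: "s \<in> trees V n" and p: "p \<in> tree_null V m"
  shows "push (\<lambda>t. tree_comp n i t s) p \<in> tree_null V (m + n - 1)"
proof (rule push_tree_null[where f = "\<lambda>v. v", OF s2_mod_axioms tree_comp_trees[OF i _ s] _ _ _ _ _ p])
  fix C :: "'v tree \<Rightarrow> 'v tree" assume C: "C \<in> tree_contexts"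
  show "\<exists>C'\<in>tree_contexts. \<exists>g. \<forall>v l r. tree_comp n i (C (Node v l r)) s = C' (Node v (g l) (g r))"
    unfolding tree_comp_def by (rule context_graft_Node[OF C])
qed simp_all

lemma push_tree_comp_null_right:
  assumes i: "1 \<le> i" "i \<le> m" and t: "t \<in> trees V m" and p: "p \<in> tree_null V n"
  shows "push (tree_comp n i t) p \<in> tree_null V (m + n - 1)"
proof (rule push_tree_null[where f = "\<lambda>v. v", OF s2_mod_axioms tree_comp_trees[OF i t] _ _ _ _ _ p])
  fix C :: "'v tree \<Rightarrow> 'v tree" assume C: "C \<in> tree_contexts"
  let ?s = "\<lambda>k. if k < i then Leaf k else Leaf (k + n - 1)"
  have "distinct (leaves t)" "i \<in> set (leaves t)"
    using t i by (auto simp: trees_def)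
  then obtain D where D: "D \<in> tree_contexts" "\<forall>y. graft (?s(i := y)) t = D y"
    using graft_leaf_context by blast
  have *: "tree_comp n i t s = D (relabel (\<lambda>j. j + i - 1) s)" for s
    unfolding tree_comp_def D(2)[rule_format, symmetric] by (rule graft_cong) auto
  obtain C' g where C': "C' \<in> tree_contexts"
      "\<And>v l r. relabel (\<lambda>j. j + i - 1) (C (Node v l r)) = C' (Node v (g l) (g r))"
    using context_graft_Node[OF C, of "\<lambda>j. Leaf (j + i - 1)"] unfolding relabel_def by blast
  have comp: "(\<lambda>t. D (C t)) \<in> tree_contexts" if "C \<in> tree_contexts" for C :: "'v tree \<Rightarrow> 'v tree"
    using D(1) by (induction rule: tree_contexts.induct) (auto intro: tree_contexts.intros that)
  show "\<exists>C'\<in>tree_contexts. \<exists>g. \<forall>v l r. tree_comp n i t (C (Node v l r)) = C' (Node v (g l) (g r))"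
    unfolding * C'(2) using comp[OF C'(1)] by (intro bexI[of _ "\<lambda>t. D (C' t)"] exI[of _ g]) simp_all
qed simp_all

lemma ar_free_operad: "ar (free_operad V) n = vquot (tree_free V n) (tree_null V n)"
  by (simp add: free_operad_def)

lemma carrier_ar_free: "carrier (ar (free_operad V) n) = tree_class V n ` {p. Poly_Mapping.keys p \<subseteq> trees V n}"
  by (simp add: ar_free_operad tree_class_def)

lemma vector_space_ar_free [simp]: "vector_space_on (ar (free_operad V) n)"
  unfolding ar_free_operad by (rule vector_space_on_vquot) simp_all

lemma vlinear_tree_class: "vlinear (tree_free V n) (ar (free_operad V) n) (tree_class V n)"
  unfolding ar_free_operad tree_class_def[abs_def] by (rule vlinear_coset) simp_all

lemma tree_class_mem [simp]:
  "Poly_Mapping.keys p \<subseteq> trees V n \<Longrightarrow> tree_class V n p \<in> carrier (ar (free_operad V) n)"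
  by (simp add: carrier_ar_free)

lemma tree_class_eq_iff:
  "Poly_Mapping.keys p \<subseteq> trees V n \<Longrightarrow> Poly_Mapping.keys q \<subseteq> trees V n \<Longrightarrow>
    tree_class V n p = tree_class V n q \<longleftrightarrow> p - q \<in> tree_null V n"
  unfolding tree_class_def tree_free_def by (rule coset_free_eq_iff) simp_all

lemma mem_tree_class:
  "Poly_Mapping.keys p \<subseteq> trees V n \<Longrightarrow> q \<in> tree_class V n p \<Longrightarrow>
    Poly_Mapping.keys q \<subseteq> trees V n \<and> q - p \<in> tree_null V n"
  using free_sub(1)[OF vsubspace_tree_null_free]
  by (auto simp: tree_class_def coset_def dest!: subsetD[OF keys_add])

lemma tree_class_nonempty: "Poly_Mapping.keys p \<subseteq> trees V n \<Longrightarrow> p \<in> tree_class V n p"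
  using free_sub(2)[OF vsubspace_tree_null_free] by (force simp: tree_class_def coset_def)

lemma tree_class_add:
  "Poly_Mapping.keys p \<subseteq> trees V n \<Longrightarrow> Poly_Mapping.keys q \<subseteq> trees V n \<Longrightarrow>
    vadd (ar (free_operad V) n) (tree_class V n p) (tree_class V n q) = tree_class V n (p + q)"
  and tree_class_scale:
  "Poly_Mapping.keys p \<subseteq> trees V n \<Longrightarrow>
    vscale (ar (free_operad V) n) c (tree_class V n p) = tree_class V n (pscale c p)"
  using vlinearD(2,3)[OF vlinear_tree_class] by simp_all

lemma act_free_operad:
  assumes \<sigma>: "\<sigma> permutes {1..n}" and p: "Poly_Mapping.keys p \<subseteq> trees V n"
  shows "act (free_operad V) n \<sigma> (tree_class V n p) = tree_class V n (push (relabel (inv \<sigma>)) p)"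
proof -
  have "qlift (tree_free V n) (tree_null V n) (push (relabel (inv \<sigma>)))
      (coset (tree_free V n) (tree_null V n) p) =
    coset (tree_free V n) (tree_null V n) (push (relabel (inv \<sigma>)) p)"
  proof (rule qlift_coset)
    show "vlinear (tree_free V n) (tree_free V n) (push (relabel (inv \<sigma>)))"
      unfolding tree_free_def using relabel_trees[OF permutes_inv[OF \<sigma>]] by (intro vlinear_push) auto
  qed (use p push_relabel_null[OF permutes_inv[OF \<sigma>]] in auto)
  then show ?thesis
    by (simp add: free_operad_def tree_class_def)
qed

lemma pcomp_free_operad:
  assumes i: "1 \<le> i" "i \<le> m"
    and p: "Poly_Mapping.keys p \<subseteq> trees V m" and q: "Poly_Mapping.keys q \<subseteq> trees V n"
  shows "pcomp (free_operad V) m n i (tree_class V m p) (tree_class V n q) =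
    tree_class V (m + n - 1) (push2 (tree_comp n i) p q)"
proof -
  have "qlift2 (tree_free V (m + n - 1)) (tree_null V (m + n - 1)) (push2 (tree_comp n i))
      (coset (tree_free V m) (tree_null V m) p) (coset (tree_free V n) (tree_null V n) q) =
    coset (tree_free V (m + n - 1)) (tree_null V (m + n - 1)) (push2 (tree_comp n i) p q)"
  proof (rule qlift2_coset)
    show "vbilinear (tree_free V m) (tree_free V n) (tree_free V (m + n - 1)) (push2 (tree_comp n i))"
      unfolding tree_free_def by (intro vbilinear_push2 tree_comp_trees i)
    fix p' q'
    show "push2 (tree_comp n i) p' q' \<in> tree_null V (m + n - 1)"
      if "p' \<in> tree_null V m" "q' \<in> carrier (tree_free V n)"
    proof -
      have "lin (\<lambda>y. lin (\<lambda>x. mono (tree_comp n i x y)) p') q' \<in> tree_null V (m + n - 1)"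
        using push_tree_comp_null_left[OF i _ that(1)] that(2) unfolding push_eq_lin
        by (intro lin_mem[OF vsubspace_tree_null_free, of q']) auto
      then show ?thesis
        unfolding push2_eq_lin by (subst lin_commute)
    qed
    show "push2 (tree_comp n i) p' q' \<in> tree_null V (m + n - 1)"
      if "p' \<in> carrier (tree_free V m)" "q' \<in> tree_null V n"
      unfolding push2_eq_lin
      using push_tree_comp_null_right[OF i _ that(2)] that(1) unfolding push_eq_lin
      by (intro lin_mem[OF vsubspace_tree_null_free, of p']) auto
  qed (use p q in simp_all)
  then show ?thesis
    by (simp add: free_operad_def tree_class_def)
qed

lemma keys_push2_tree_comp:
  assumes "1 \<le> i" "i \<le> m" "Poly_Mapping.keys p \<subseteq> trees V m" "Poly_Mapping.keys q \<subseteq> trees V n"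
  shows "Poly_Mapping.keys (push2 (tree_comp n i) p q) \<subseteq> trees V (m + n - 1)"
  unfolding push2_eq_lin using assms by (intro keys_lin) (simp add: subset_iff tree_comp_trees)

lemma linear_operad_free: "linear_operad (free_operad V)"
  unfolding linear_operad_def
proof (intro conjI allI impI)
  show "vector_space_on (ar (free_operad V) n)" for n
    by simp
  show "vlinear (ar (free_operad V) n) (ar (free_operad V) n) (act (free_operad V) n \<sigma>)"
    if \<sigma>: "\<sigma> permutes {1..n}" for n \<sigma>
  proof -
    have "vlinear (tree_free V n) (ar (free_operad V) n) (\<lambda>p. tree_class V n (push (relabel (inv \<sigma>)) p))"
      using relabel_trees[OF permutes_inv[OF \<sigma>]]
      by (intro vlinear_comp[OF _ vlinear_tree_class]) (auto simp: tree_free_def intro!: vlinear_push)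
    then show ?thesis
      unfolding ar_free_operad[of n]
      by (rule vlinear_vquot)
        (use act_free_operad[OF \<sigma>] in \<open>simp_all add: tree_class_def\<close>)
  qed
  show "vbilinear (ar (free_operad V) m) (ar (free_operad V) n) (ar (free_operad V) (m + n - 1))
      (pcomp (free_operad V) m n i)" if i: "1 \<le> i \<and> i \<le> m" for m n i
    unfolding vbilinear_def
  proof (intro conjI ballI)
    have bil: "vbilinear (tree_free V m) (tree_free V n) (tree_free V (m + n - 1)) (push2 (tree_comp n i))"
      unfolding tree_free_def using i by (intro vbilinear_push2 tree_comp_trees) auto
    fix x assume "x \<in> carrier (ar (free_operad V) m)"
    then obtain p where p: "Poly_Mapping.keys p \<subseteq> trees V m" "x = tree_class V m p"
      by (auto simp: carrier_ar_free)
    have "vlinear (tree_free V n) (ar (free_operad V) (m + n - 1))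
        (\<lambda>q. tree_class V (m + n - 1) (push2 (tree_comp n i) p q))"
      using p by (intro vlinear_comp[OF vbilinearD(1)[OF bil] vlinear_tree_class]) simp
    then show "vlinear (ar (free_operad V) n) (ar (free_operad V) (m + n - 1))
        (pcomp (free_operad V) m n i x)"
      unfolding ar_free_operad[of n]
      by (rule vlinear_vquot)
        (use pcomp_free_operad p i in \<open>simp_all add: tree_class_def\<close>)
  next
    have bil: "vbilinear (tree_free V m) (tree_free V n) (tree_free V (m + n - 1)) (push2 (tree_comp n i))"
      unfolding tree_free_def using i by (intro vbilinear_push2 tree_comp_trees) auto
    fix x assume "x \<in> carrier (ar (free_operad V) n)"
    then obtain q where q: "Poly_Mapping.keys q \<subseteq> trees V n" "x = tree_class V n q"
      by (auto simp: carrier_ar_free)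
    have "vlinear (tree_free V m) (ar (free_operad V) (m + n - 1))
        (\<lambda>p. tree_class V (m + n - 1) (push2 (tree_comp n i) p q))"
      using q by (intro vlinear_comp[OF vbilinearD(2)[OF bil] vlinear_tree_class]) simp
    then show "vlinear (ar (free_operad V) m) (ar (free_operad V) (m + n - 1))
        (\<lambda>y. pcomp (free_operad V) m n i y x)"
      unfolding ar_free_operad[of m]
      by (rule vlinear_vquot)
        (use pcomp_free_operad q i in \<open>simp_all add: tree_class_def\<close>)
  qed
  show "unit (free_operad V) \<in> carrier (ar (free_operad V) 1)"
    by (simp add: free_operad_def tree_class_def) (auto simp: trees_def)
qed

end

subsection \<open>Functoriality\<close>

lemma push_push: "push f (push g p) = push (\<lambda>x. f (g x)) p"
  by (simp add: push_eq_lin lin_lin)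

lemma push_push2: "push f (push2 g p q) = push2 (\<lambda>x y. f (g x y)) p q"
  by (simp add: push_eq_lin push2_eq_lin lin_lin)

lemma push2_push: "push2 f (push g p) (push h q) = push2 (\<lambda>x y. f (g x) (h y)) p q"
  by (simp add: push_eq_lin push2_eq_lin lin_lin)

lemma push_cong: "(\<And>x. x \<in> Poly_Mapping.keys p \<Longrightarrow> f x = g x) \<Longrightarrow> push f p = push g p"
  unfolding push_eq_lin by (rule lin_cong) simp

lemma push_ident [simp]: "push (\<lambda>x. x) p = p"
  by (simp add: push_eq_lin)

definition s2_hom :: "('k, 'v) s2_module \<Rightarrow> ('k, 'w) s2_module \<Rightarrow> ('v \<Rightarrow> 'w) \<Rightarrow> bool" where
  "s2_hom V W f \<longleftrightarrow> vlinear V W f \<and> (\<forall>v\<in>carrier V. f (swap V v) = swap W (f v))"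

lemma s2_homD:
  assumes "s2_hom V W f"
  shows "vlinear V W f" "v \<in> carrier V \<Longrightarrow> f (swap V v) = swap W (f v)"
  using assms unfolding s2_hom_def by auto

definition free_map ::
    "('k::field, 'w) s2_module \<Rightarrow> ('v \<Rightarrow> 'w) \<Rightarrow> nat \<Rightarrow> ('v tree \<Rightarrow>\<^sub>0 'k) set \<Rightarrow> ('w tree \<Rightarrow>\<^sub>0 'k) set" where
  "free_map W f n = qlift (tree_free W n) (tree_null W n) (push (map_tree f))"

lemma map_tree_trees: "f ` carrier V \<subseteq> carrier W \<Longrightarrow> t \<in> trees V n \<Longrightarrow> map_tree f t \<in> trees W n"
  unfolding trees_def by auto

context
  fixes V :: "('k::field, 'v) s2_module" and W :: "('k, 'w) s2_module" and f
  assumes V: "s2_mod V" and W: "s2_mod W" and f: "s2_hom V W f"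
begin

interpretation V: s2_mod V by (rule V)
interpretation W: s2_mod W by (rule W)

lemma map_tree_hom_trees: "t \<in> trees V n \<Longrightarrow> map_tree f t \<in> trees W n"
  using s2_homD(1)[OF f] unfolding vlinear_def by (intro map_tree_trees) auto

lemma free_map_class:
  assumes p: "Poly_Mapping.keys p \<subseteq> trees V n"
  shows "free_map W f n (tree_class V n p) = tree_class W n (push (map_tree f) p)"
  unfolding free_map_def tree_class_def
proof (rule qlift_coset)
  show "vlinear (tree_free V n) (tree_free W n) (push (map_tree f))"
    unfolding tree_free_def using map_tree_hom_trees by (intro vlinear_push) auto
  show "push (map_tree f) ` tree_null V n \<subseteq> tree_null W n"
  proof (rule image_subsetI, rule V.push_tree_null[where f = f, OF W map_tree_hom_trees])
    fix C :: "'v tree \<Rightarrow> 'v tree" assume "C \<in> tree_contexts"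
    then obtain C' where "C' \<in> tree_contexts" "\<And>t. map_tree f (C t) = C' (map_tree f t)"
      using context_map_tree[of C f] by blast
    then show "\<exists>C'\<in>tree_contexts. \<exists>g. \<forall>v l r. map_tree f (C (Node v l r)) = C' (Node (f v) (g l) (g r))"
      by (intro bexI[of _ C'] exI[of _ "map_tree f"]) simp_all
  qed (simp_all add: vlinearD[OF s2_homD(1)[OF f]] s2_homD(2)[OF f])
qed (use p in simp_all)

lemma operad_hom_free_map: "operad_hom (free_operad V) (free_operad W) (free_map W f)"
  unfolding operad_hom_def
proof (intro conjI allI impI ballI)
  have keys: "Poly_Mapping.keys (push (map_tree f) p) \<subseteq> trees W n"
    if "Poly_Mapping.keys p \<subseteq> trees V n" for p n
    using that map_tree_hom_trees by (intro keys_push) auto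
  note [simp] = free_map_class keys V.carrier_ar_free
  show "vlinear (ar (free_operad V) n) (ar (free_operad W) n) (free_map W f n)" for n
  proof -
    have "vlinear (tree_free V n) (ar (free_operad W) n) (\<lambda>p. tree_class W n (push (map_tree f) p))"
      using map_tree_hom_trees
      by (intro vlinear_comp[OF _ W.vlinear_tree_class]) (auto simp: tree_free_def intro!: vlinear_push)
    then show ?thesis
      unfolding V.ar_free_operad by (rule vlinear_vquot) (simp_all flip: tree_class_def)
  qed
  show "free_map W f n (act (free_operad V) n \<sigma> x) = act (free_operad W) n \<sigma> (free_map W f n x)"
    if \<sigma>: "\<sigma> permutes {1..n}" and x: "x \<in> carrier (ar (free_operad V) n)" for n \<sigma> x
  proof -
    obtain p where p: "Poly_Mapping.keys p \<subseteq> trees V n" "x = tree_class V n p"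
      using x by auto
    moreover have "Poly_Mapping.keys (push (relabel (inv \<sigma>)) p) \<subseteq> trees V n"
      using p relabel_trees[OF permutes_inv[OF \<sigma>]] by (intro keys_push) auto
    ultimately show ?thesis
      by (simp add: V.act_free_operad[OF \<sigma>] W.act_free_operad[OF \<sigma>] push_push map_tree_relabel)
  qed
  show "free_map W f (m + n - 1) (pcomp (free_operad V) m n i x y) =
      pcomp (free_operad W) m n i (free_map W f m x) (free_map W f n y)"
    if i: "1 \<le> i \<and> i \<le> m" and x: "x \<in> carrier (ar (free_operad V) m)"
      and y: "y \<in> carrier (ar (free_operad V) n)" for m n i x y
  proof -
    obtain p q where p: "Poly_Mapping.keys p \<subseteq> trees V m" "x = tree_class V m p"
        and q: "Poly_Mapping.keys q \<subseteq> trees V n" "y = tree_class V n q"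
      using x y by auto
    then show ?thesis
      using i V.keys_push2_tree_comp[of i m p q n]
      by (simp add: V.pcomp_free_operad W.pcomp_free_operad push_push2 push2_push map_tree_tree_comp)
  qed
  have "Leaf 1 \<in> trees V 1" by (auto simp: trees_def)
  then show "free_map W f 1 (unit (free_operad V)) = unit (free_operad W)"
    by (simp add: free_operad_def)
qed

lemma free_map_free_gen: "v \<in> carrier V \<Longrightarrow> free_map W f 2 (free_gen V v) = free_gen W (f v)"
  unfolding free_gen_def by (subst free_map_class) (auto simp: trees_def)

end

lemma free_map_inverse:
  assumes V: "s2_mod V" and W: "s2_mod W" and f: "s2_hom V W f" and g: "s2_hom W V g"
    and gf: "\<And>v. v \<in> carrier V \<Longrightarrow> g (f v) = v" and x: "x \<in> carrier (ar (free_operad V) n)"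
  shows "free_map V g n (free_map W f n x) = x"
proof -
  obtain p where p: "Poly_Mapping.keys p \<subseteq> trees V n" "x = tree_class V n p"
    using x by (auto simp: s2_mod.carrier_ar_free[OF V])
  have "push (\<lambda>t. map_tree g (map_tree f t)) p = push (\<lambda>t. t) p"
    using p(1) gf by (intro push_cong map_tree_inverse) (auto simp: trees_def)
  moreover have "Poly_Mapping.keys (push (map_tree f) p) \<subseteq> trees W n"
    using p map_tree_hom_trees[OF V W f] by (intro keys_push) auto
  ultimately show ?thesis
    unfolding p(2) by (simp add: free_map_class[OF V W f] free_map_class[OF W V g] p push_push)
qed

lemma operad_iso_free_map:
  assumes V: "s2_mod V" and W: "s2_mod W" and f: "s2_hom V W f" and g: "s2_hom W V g"
    and gf: "\<And>v. v \<in> carrier V \<Longrightarrow> g (f v) = v" and fg: "\<And>w. w \<in> carrier W \<Longrightarrow> f (g w) = w"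
  shows "operad_iso (free_operad V) (free_operad W) (free_map W f)"
  unfolding operad_iso_def
proof (intro conjI allI operad_hom_free_map V W f)
  have hom: "vlinear (ar (free_operad V) n) (ar (free_operad W) n) (free_map W f n)"
    "vlinear (ar (free_operad W) n) (ar (free_operad V) n) (free_map V g n)" for n
    using operad_homD(1)[OF operad_hom_free_map[OF V W f]] operad_homD(1)[OF operad_hom_free_map[OF W V g]]
    by auto
  show "bij_betw (free_map W f n) (carrier (ar (free_operad V) n)) (carrier (ar (free_operad W) n))" for n
    using vlinearD(1)[OF hom(1)[of n]] vlinearD(1)[OF hom(2)[of n]]
      free_map_inverse[OF V W f g gf] free_map_inverse[OF W V g f fg]
    by (intro bij_betwI[where g = "free_map V g n"]) auto
qed

section \<open>Tensor products\<close>

definition vclosed :: "('k, 'a, 'm) vspace_scheme \<Rightarrow> bool" where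
  "vclosed V \<longleftrightarrow> (\<forall>x\<in>carrier V. \<forall>y\<in>carrier V. vadd V x y \<in> carrier V) \<and>
     (\<forall>c. \<forall>x\<in>carrier V. vscale V c x \<in> carrier V)"

lemma vclosed_vector_space: "vector_space_on V \<Longrightarrow> vclosed V"
  unfolding vclosed_def vector_space_on_def by auto

definition tensor_class ::
    "('k::field, 'a, 'm) vspace_scheme \<Rightarrow> ('k, 'b, 'n) vspace_scheme \<Rightarrow>
     ('a \<times> 'b \<Rightarrow>\<^sub>0 'k) \<Rightarrow> ('a \<times> 'b \<Rightarrow>\<^sub>0 'k) set" where
  "tensor_class V W = coset (tensor_free V W) (tensor_null V W)"

lemma pure_tensor_eq: "pure_tensor V W v w = tensor_class V W (mono (v, w))"
  by (simp add: pure_tensor_def tensor_class_def)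

lemma tensor_free_simps [simp]:
  "vector_space_on (tensor_free V W)"
  "carrier (tensor_free V W) = {p. Poly_Mapping.keys p \<subseteq> carrier V \<times> carrier W}"
  "vzero (tensor_free V W) = 0" "vadd (tensor_free V W) = (+)" "vscale (tensor_free V W) = pscale"
  by (simp_all add: tensor_free_def)

lemma carrier_tensor:
  "carrier (tensor V W) = tensor_class V W ` {p. Poly_Mapping.keys p \<subseteq> carrier V \<times> carrier W}"
  by (simp add: tensor_def tensor_class_def)

locale tensor_pair =
  fixes V :: "('k::field, 'a, 'm) vspace_scheme" and W :: "('k, 'b, 'n) vspace_scheme"
  assumes vclosed: "vclosed V" "vclosed W"
begin

lemma closed_simps [simp]:
  "v \<in> carrier V \<Longrightarrow> v' \<in> carrier V \<Longrightarrow> vadd V v v' \<in> carrier V"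
  "v \<in> carrier V \<Longrightarrow> vscale V c v \<in> carrier V"
  "w \<in> carrier W \<Longrightarrow> w' \<in> carrier W \<Longrightarrow> vadd W w w' \<in> carrier W"
  "w \<in> carrier W \<Longrightarrow> vscale W c w \<in> carrier W"
  using vclosed unfolding vclosed_def by auto

lemma tensor_rel_keys:
  "{mono (vadd V v v', w) - mono (v, w) - mono (v', w) | v v' w.
        v \<in> carrier V \<and> v' \<in> carrier V \<and> w \<in> carrier W} \<union>
     {mono (v, vadd W w w') - mono (v, w) - mono (v, w') | v w w'.
        v \<in> carrier V \<and> w \<in> carrier W \<and> w' \<in> carrier W} \<union>
     {mono (vscale V c v, w) - Poly_Mapping.single (v, w) c | c v w.
        v \<in> carrier V \<and> w \<in> carrier W} \<union>
     {mono (v, vscale W c w) - Poly_Mapping.single (v, w) c | c v w.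
        v \<in> carrier V \<and> w \<in> carrier W} \<subseteq> carrier (tensor_free V W)"
  by (intro Un_least subsetI; clarify; simp add: keys_add_subset del: keys_single)

lemma vsubspace_tensor_null [simp]: "vsubspace (tensor_free V W) (tensor_null V W)"
  unfolding tensor_null_def by (rule vsubspace_vspan[OF _ tensor_rel_keys]) simp

lemma vsubspace_tensor_null_free [simp]:
  "vsubspace (free_vspace (carrier V \<times> carrier W)) (tensor_null V W)"
  using vsubspace_tensor_null by (simp add: tensor_free_def)

lemma tensor_null_intros:
  "v \<in> carrier V \<Longrightarrow> v' \<in> carrier V \<Longrightarrow> w \<in> carrier W \<Longrightarrow>
    mono (vadd V v v', w) - mono (v, w) - mono (v', w) \<in> tensor_null V W"
  "v \<in> carrier V \<Longrightarrow> w \<in> carrier W \<Longrightarrow> w' \<in> carrier W \<Longrightarrow>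
    mono (v, vadd W w w') - mono (v, w) - mono (v, w') \<in> tensor_null V W"
  "v \<in> carrier V \<Longrightarrow> w \<in> carrier W \<Longrightarrow>
    mono (vscale V c v, w) - Poly_Mapping.single (v, w) c \<in> tensor_null V W"
  "v \<in> carrier V \<Longrightarrow> w \<in> carrier W \<Longrightarrow>
    mono (v, vscale W c w) - Poly_Mapping.single (v, w) c \<in> tensor_null V W"
  unfolding tensor_null_def by (rule subsetD[OF vspan_superset], blast)+

lemma tensor_null_lin:
  assumes N: "vsubspace (free_vspace X) N"
    and keys: "\<And>v w. v \<in> carrier V \<Longrightarrow> w \<in> carrier W \<Longrightarrow> Poly_Mapping.keys (h (v, w)) \<subseteq> X"
    and h: "\<And>v v' w. v \<in> carrier V \<Longrightarrow> v' \<in> carrier V \<Longrightarrow> w \<in> carrier W \<Longrightarrow>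
        h (vadd V v v', w) - h (v, w) - h (v', w) \<in> N"
      "\<And>v w w'. v \<in> carrier V \<Longrightarrow> w \<in> carrier W \<Longrightarrow> w' \<in> carrier W \<Longrightarrow>
        h (v, vadd W w w') - h (v, w) - h (v, w') \<in> N"
      "\<And>c v w. v \<in> carrier V \<Longrightarrow> w \<in> carrier W \<Longrightarrow> h (vscale V c v, w) - pscale c (h (v, w)) \<in> N"
      "\<And>c v w. v \<in> carrier V \<Longrightarrow> w \<in> carrier W \<Longrightarrow> h (v, vscale W c w) - pscale c (h (v, w)) \<in> N"
    and p: "p \<in> tensor_null V W"
  shows "lin h p \<in> N"
proof -
  have "vlinear (tensor_free V W) (free_vspace X) (lin h)"
    unfolding tensor_free_def using keys by (intro vlinear_lin) auto
  then have "lin h ` tensor_null V W \<subseteq> N"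
    unfolding tensor_null_def
    apply (rule vspan_image_subset[OF _ tensor_free_simps(1) vector_space_free N tensor_rel_keys])
    using h by (intro image_subsetI) (elim UnE CollectE exE conjE; simp add: lin_diff lin_single)
  then show ?thesis
    using p by auto
qed

lemma tensor_null_ev:
  assumes h: "\<And>v v' w. v \<in> carrier V \<Longrightarrow> v' \<in> carrier V \<Longrightarrow> w \<in> carrier W \<Longrightarrow>
        h (vadd V v v', w) = h (v, w) + h (v', w)"
      "\<And>v w w'. v \<in> carrier V \<Longrightarrow> w \<in> carrier W \<Longrightarrow> w' \<in> carrier W \<Longrightarrow>
        h (v, vadd W w w') = h (v, w) + h (v, w')"
      "\<And>c v w. v \<in> carrier V \<Longrightarrow> w \<in> carrier W \<Longrightarrow> h (vscale V c v, w) = c * h (v, w)"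
      "\<And>c v w. v \<in> carrier V \<Longrightarrow> w \<in> carrier W \<Longrightarrow> h (v, vscale W c w) = c * h (v, w)"
    and p: "p \<in> tensor_null V W"
  shows "ev h p = 0"
proof -
  let ?h = "\<lambda>x. Poly_Mapping.single () (h x)"
  have "lin ?h p \<in> {0}"
    using p
    by (rule tensor_null_lin[where X = UNIV, rotated 6])
      (auto simp: vsubspace_def h single_add intro!: poly_mapping_eqI)
  then have "Poly_Mapping.lookup (lin ?h p) () = 0"
    by simp
  then show ?thesis
    by (simp add: lookup_lin)
qed

lemma tensor_class_eq_iff:
  "Poly_Mapping.keys p \<subseteq> carrier V \<times> carrier W \<Longrightarrow> Poly_Mapping.keys q \<subseteq> carrier V \<times> carrier W \<Longrightarrow>
    tensor_class V W p = tensor_class V W q \<longleftrightarrow> p - q \<in> tensor_null V W"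
  unfolding tensor_class_def tensor_free_def by (rule coset_free_eq_iff) simp_all

lemma vector_space_tensor [simp]: "vector_space_on (tensor V W)"
  unfolding tensor_def by (rule vector_space_on_vquot) simp_all

lemma vlinear_tensor_class: "vlinear (tensor_free V W) (tensor V W) (tensor_class V W)"
  unfolding tensor_def tensor_class_def[abs_def] by (rule vlinear_coset) simp_all

lemma tensor_class_mem [simp]:
  "Poly_Mapping.keys p \<subseteq> carrier V \<times> carrier W \<Longrightarrow> tensor_class V W p \<in> carrier (tensor V W)"
  by (simp add: carrier_tensor)

lemma tensor_class_add:
  "Poly_Mapping.keys p \<subseteq> carrier V \<times> carrier W \<Longrightarrow> Poly_Mapping.keys q \<subseteq> carrier V \<times> carrier W \<Longrightarrow>
    vadd (tensor V W) (tensor_class V W p) (tensor_class V W q) = tensor_class V W (p + q)"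
  and tensor_class_scale:
  "Poly_Mapping.keys p \<subseteq> carrier V \<times> carrier W \<Longrightarrow>
    vscale (tensor V W) c (tensor_class V W p) = tensor_class V W (pscale c p)"
  using vlinearD(2,3)[OF vlinear_tensor_class] by simp_all

lemma mem_tensor_class:
  "Poly_Mapping.keys p \<subseteq> carrier V \<times> carrier W \<Longrightarrow> q \<in> tensor_class V W p \<Longrightarrow>
    Poly_Mapping.keys q \<subseteq> carrier V \<times> carrier W \<and> q - p \<in> tensor_null V W"
  using free_sub(1)[OF vsubspace_tensor_null_free]
  by (auto simp: tensor_class_def coset_def dest!: subsetD[OF keys_add])

lemma tensor_class_nonempty:
  "Poly_Mapping.keys p \<subseteq> carrier V \<times> carrier W \<Longrightarrow> p \<in> tensor_class V W p"
  using free_sub(2)[OF vsubspace_tensor_null_free] by (force simp: tensor_class_def coset_def)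

lemma push_tensor_null:
  assumes "tensor_pair V' W'" and f: "vlinear V V' f" and g: "vlinear W W' g"
    and p: "p \<in> tensor_null V W"
  shows "push (\<lambda>(v, w). (f v, g w)) p \<in> tensor_null V' W'"
proof -
  interpret W: tensor_pair V' W' by fact
  show ?thesis
    unfolding push_eq_lin
    by (rule tensor_null_lin[OF W.vsubspace_tensor_null_free _ _ _ _ _ p])
      (simp_all add: vlinearD[OF f] vlinearD[OF g] W.tensor_null_intros)
qed

end

definition rep :: "'a set \<Rightarrow> 'a" where
  "rep X = (SOME x. x \<in> X)"

lemma rep_mem: "x \<in> X \<Longrightarrow> rep X \<in> X"
  unfolding rep_def by (rule someI)

text \<open>The value \<open>0\<close> outside the tensor product makes every label of a tree expandable.\<close>

definition tensor_rep ::
    "('k::field, 'a, 'm) vspace_scheme \<Rightarrow> ('k, 'b, 'n) vspace_scheme \<Rightarrow>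
     ('a \<times> 'b \<Rightarrow>\<^sub>0 'k) set \<Rightarrow> 'a \<times> 'b \<Rightarrow>\<^sub>0 'k" where
  "tensor_rep V W x = (if x \<in> carrier (tensor V W) then rep x else 0)"

context tensor_pair
begin

lemma keys_tensor_rep: "Poly_Mapping.keys (tensor_rep V W x) \<subseteq> carrier V \<times> carrier W"
  using mem_tensor_class[OF _ rep_mem[OF tensor_class_nonempty]]
  by (auto simp: tensor_rep_def carrier_tensor)

lemma tensor_rep_class:
  assumes p: "Poly_Mapping.keys p \<subseteq> carrier V \<times> carrier W"
  shows "tensor_rep V W (tensor_class V W p) - p \<in> tensor_null V W"
  using mem_tensor_class[OF p rep_mem[OF tensor_class_nonempty[OF p]]] p
  by (simp add: tensor_rep_def)

lemma tensor_class_rep: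
  assumes "x \<in> carrier (tensor V W)"
  shows "tensor_class V W (tensor_rep V W x) = x"
proof -
  obtain p where p: "Poly_Mapping.keys p \<subseteq> carrier V \<times> carrier W" "x = tensor_class V W p"
    using assms by (auto simp: carrier_tensor)
  then show ?thesis
    using tensor_class_eq_iff[OF keys_tensor_rep p(1)] tensor_rep_class by blast
qed

lemma tensor_rep_add:
  assumes "x \<in> carrier (tensor V W)" "y \<in> carrier (tensor V W)"
  shows "tensor_rep V W (vadd (tensor V W) x y) - tensor_rep V W x - tensor_rep V W y \<in> tensor_null V W"
proof -
  note keys = keys_add_subset(1)[OF keys_tensor_rep[of x] keys_tensor_rep[of y]]
  have "vadd (tensor V W) x y = tensor_class V W (tensor_rep V W x + tensor_rep V W y)"
    using tensor_class_add[OF keys_tensor_rep[of x] keys_tensor_rep[of y]] assms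
    by (simp add: tensor_class_rep)
  then show ?thesis
    using tensor_rep_class[OF keys] by (simp add: diff_diff_eq)
qed

lemma tensor_rep_scale:
  assumes "x \<in> carrier (tensor V W)"
  shows "tensor_rep V W (vscale (tensor V W) c x) - pscale c (tensor_rep V W x) \<in> tensor_null V W"
proof -
  have "vscale (tensor V W) c x = tensor_class V W (pscale c (tensor_rep V W x))"
    using tensor_class_scale[OF keys_tensor_rep[of x]] assms by (simp add: tensor_class_rep)
  then show ?thesis
    using tensor_rep_class[OF keys_add_subset(3)[OF keys_tensor_rep]] by simp
qed

end

definition s2_linear :: "('k::field, 'v) s2_module \<Rightarrow> bool" where
  "s2_linear V \<longleftrightarrow> vclosed V \<and> vlinear V V (swap V)"

lemma s2_mod_linear: "s2_linear V \<Longrightarrow> s2_mod V"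
  unfolding s2_mod_def s2_closed_def s2_linear_def vclosed_def vlinear_def by auto

lemma s2_tensor_simps [simp]:
  "carrier (s2_tensor V W) = carrier (tensor V W)" "vzero (s2_tensor V W) = vzero (tensor V W)"
  "vadd (s2_tensor V W) = vadd (tensor V W)" "vscale (s2_tensor V W) = vscale (tensor V W)"
  by (simp_all add: s2_tensor_def vspace.defs s2_module.defs)

locale s2_pair =
  fixes V :: "('k::field, 'v) s2_module" and W :: "('k, 'w) s2_module"
  assumes s2_linear: "s2_linear V" "s2_linear W"
begin

sublocale tensor_pair V W
  using s2_linear by unfold_locales (auto simp: s2_linear_def)

sublocale V: s2_mod V by (rule s2_mod_linear[OF s2_linear(1)])
sublocale W: s2_mod W by (rule s2_mod_linear[OF s2_linear(2)])

lemma swap_mem [simp]: "v \<in> carrier V \<Longrightarrow> swap V v \<in> carrier V" "w \<in> carrier W \<Longrightarrow> swap W w \<in> carrier W"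
  using V.closed W.closed by (auto simp: s2_closed_def)

lemma swap_s2_tensor:
  assumes p: "Poly_Mapping.keys p \<subseteq> carrier V \<times> carrier W"
  shows "swap (s2_tensor V W) (tensor_class V W p) = tensor_class V W (push (\<lambda>(v, w). (swap V v, swap W w)) p)"
proof -
  have "qlift (tensor_free V W) (tensor_null V W) (push (\<lambda>(v, w). (swap V v, swap W w)))
      (coset (tensor_free V W) (tensor_null V W) p) =
    coset (tensor_free V W) (tensor_null V W) (push (\<lambda>(v, w). (swap V v, swap W w)) p)"
  proof (rule qlift_coset)
    show "vlinear (tensor_free V W) (tensor_free V W) (push (\<lambda>(v, w). (swap V v, swap W w)))"
      unfolding tensor_free_def by (intro vlinear_push) auto
    show "push (\<lambda>(v, w). (swap V v, swap W w)) ` tensor_null V W \<subseteq> tensor_null V W"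
      using s2_linear unfolding s2_linear_def
      by (intro image_subsetI push_tensor_null tensor_pair_axioms) auto
  qed (use p in simp_all)
  then show ?thesis
    by (simp add: s2_tensor_def vspace.defs s2_module.defs tensor_class_def)
qed

lemma keys_push_swap:
  "Poly_Mapping.keys p \<subseteq> carrier V \<times> carrier W \<Longrightarrow>
    Poly_Mapping.keys (push (\<lambda>(v, w). (swap V v, swap W w)) p) \<subseteq> carrier V \<times> carrier W"
  by (intro keys_push) auto

lemma tensor_rep_swap:
  assumes "x \<in> carrier (tensor V W)"
  shows "tensor_rep V W (swap (s2_tensor V W) x) - push (\<lambda>(v, w). (swap V v, swap W w)) (tensor_rep V W x)
    \<in> tensor_null V W"
proof -
  have "swap (s2_tensor V W) x =
      tensor_class V W (push (\<lambda>(v, w). (swap V v, swap W w)) (tensor_rep V W x))"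
    using swap_s2_tensor[OF keys_tensor_rep[of x]] assms by (simp add: tensor_class_rep)
  then show ?thesis
    using tensor_rep_class[OF keys_push_swap[OF keys_tensor_rep]] by simp
qed

sublocale VW: s2_mod "s2_tensor V W"
proof
  interpret T: vsp "tensor V W" by (simp add: vsp_iff)
  have "swap (s2_tensor V W) x \<in> carrier (tensor V W)" if "x \<in> carrier (tensor V W)" for x
    using that tensor_class_mem[OF keys_push_swap] by (auto simp: carrier_tensor[of V W] swap_s2_tensor)
  then show "s2_closed (s2_tensor V W)"
    by (simp add: s2_closed_def)
qed

end

section \<open>The morphism from the free operad on a tensor product\<close>

text \<open>Multilinear expansion of a tree whose labels \<open>x\<close> are represented by formal sums \<open>\<rho> x\<close>.\<close>

primrec expand :: "('a \<Rightarrow> 'v \<times> 'w \<Rightarrow>\<^sub>0 'k::field) \<Rightarrow> 'a tree \<Rightarrow> 'v tree \<times> 'w tree \<Rightarrow>\<^sub>0 'k" where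
  "expand \<rho> (Leaf k) = mono (Leaf k, Leaf k)"
| "expand \<rho> (Node x l r) = lin (\<lambda>a. lin (\<lambda>y. lin (\<lambda>z.
     mono (Node (fst a) (fst y) (fst z), Node (snd a) (snd y) (snd z))) (expand \<rho> r)) (expand \<rho> l)) (\<rho> x)"

lemma expand_relabel:
  "expand \<rho> (relabel f t) = lin (\<lambda>y. mono (relabel f (fst y), relabel f (snd y))) (expand \<rho> t)"
  by (induction t) (simp_all add: lin_lin)

lemma keys_expand:
  assumes \<rho>: "\<And>x. Poly_Mapping.keys (\<rho> x) \<subseteq> A \<times> B"
  shows "Poly_Mapping.keys (expand \<rho> t) \<subseteq> {y. leaves (fst y) = leaves t \<and> leaves (snd y) = leaves t \<and>
    labels (fst y) \<subseteq> A \<and> labels (snd y) \<subseteq> B}"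
proof (induction t)
  case (Node x l r)
  show ?case
    unfolding expand.simps
  proof (intro keys_lin)
    fix a y z assume "a \<in> Poly_Mapping.keys (\<rho> x)" "y \<in> Poly_Mapping.keys (expand \<rho> l)"
      "z \<in> Poly_Mapping.keys (expand \<rho> r)"
    then have "a \<in> A \<times> B"
      "leaves (fst y) = leaves l \<and> leaves (snd y) = leaves l \<and> labels (fst y) \<subseteq> A \<and> labels (snd y) \<subseteq> B"
      "leaves (fst z) = leaves r \<and> leaves (snd z) = leaves r \<and> labels (fst z) \<subseteq> A \<and> labels (snd z) \<subseteq> B"
      using Node \<rho>[of x] by blast+
    then show "Poly_Mapping.keys (mono (Node (fst a) (fst y) (fst z), Node (snd a) (snd y) (snd z)))
      \<subseteq> {y. leaves (fst y) = leaves (Node x l r) \<and> leaves (snd y) = leaves (Node x l r) \<and>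
        labels (fst y) \<subseteq> A \<and> labels (snd y) \<subseteq> B}"
      by auto
  qed
qed simp

definition graft_leaf :: "nat \<Rightarrow> (nat \<Rightarrow> nat) \<Rightarrow> 'v tree \<Rightarrow> 'v tree \<Rightarrow> 'v tree" where
  "graft_leaf i c s = graft (\<lambda>k. if k = i then s else Leaf (c k))"

lemma graft_leaf_Node: "graft_leaf i c s (Node v l r) = Node v (graft_leaf i c s l) (graft_leaf i c s r)"
  by (simp add: graft_leaf_def)

lemma graft_leaf_relabel: "i \<notin> set (leaves t) \<Longrightarrow> graft_leaf i c s t = relabel c t"
  unfolding graft_leaf_def relabel_def by (intro graft_cong) auto

lemma expand_graft_leaf:
  assumes \<rho>: "\<And>x. Poly_Mapping.keys (\<rho> x) \<subseteq> A \<times> B"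
  shows "distinct (leaves t) \<Longrightarrow> i \<in> set (leaves t) \<Longrightarrow> expand \<rho> (graft_leaf i c s t) =
    lin (\<lambda>y. lin (\<lambda>z. mono (graft_leaf i c (fst z) (fst y), graft_leaf i c (snd z) (snd y))) (expand \<rho> s)) (expand \<rho> t)"
proof (induction t)
  case (Leaf k)
  then show ?case by (simp add: graft_leaf_def)
next
  case (Node x l r)
  have leaf: "leaves (fst y) = leaves t" "leaves (snd y) = leaves t"
    if "y \<in> Poly_Mapping.keys (expand \<rho> t)" for y t
    using subsetD[OF keys_expand[OF \<rho>] that] by simp_all
  show ?case
  proof (cases "i \<in> set (leaves l)")
    case True
    then have r: "i \<notin> set (leaves r)"
      using Node.prems by auto
    have IH: "expand \<rho> (graft_leaf i c s l) =
        lin (\<lambda>y. lin (\<lambda>z. mono (graft_leaf i c (fst z) (fst y), graft_leaf i c (snd z) (snd y))) (expand \<rho> s)) (expand \<rho> l)"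
      using Node True by simp
    have "expand \<rho> (graft_leaf i c s (Node x l r)) =
      lin (\<lambda>a. lin (\<lambda>y. lin (\<lambda>u. lin (\<lambda>z. mono
        (Node (fst a) (graft_leaf i c (fst u) (fst y)) (relabel c (fst z)),
         Node (snd a) (graft_leaf i c (snd u) (snd y)) (relabel c (snd z)))) (expand \<rho> r)) (expand \<rho> s))
        (expand \<rho> l)) (\<rho> x)"
      by (simp add: graft_leaf_Node graft_leaf_relabel[OF r] IH expand_relabel lin_lin)
    also have "\<dots> = lin (\<lambda>a. lin (\<lambda>y. lin (\<lambda>z. lin (\<lambda>u. mono
        (Node (fst a) (graft_leaf i c (fst u) (fst y)) (relabel c (fst z)),
         Node (snd a) (graft_leaf i c (snd u) (snd y)) (relabel c (snd z)))) (expand \<rho> s)) (expand \<rho> r))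
        (expand \<rho> l)) (\<rho> x)"
      by (intro lin_cong, rule lin_commute)
    also have "\<dots> = lin (\<lambda>a. lin (\<lambda>y. lin (\<lambda>z. lin (\<lambda>u. mono
        (Node (fst a) (graft_leaf i c (fst u) (fst y)) (graft_leaf i c (fst u) (fst z)),
         Node (snd a) (graft_leaf i c (snd u) (snd y)) (graft_leaf i c (snd u) (snd z)))) (expand \<rho> s)) (expand \<rho> r))
        (expand \<rho> l)) (\<rho> x)"
      by (intro lin_cong) (simp add: graft_leaf_relabel r leaf)
    finally show ?thesis
      by (simp add: lin_lin graft_leaf_Node)
  next
    case False
    then have IH: "expand \<rho> (graft_leaf i c s r) =
        lin (\<lambda>y. lin (\<lambda>z. mono (graft_leaf i c (fst z) (fst y), graft_leaf i c (snd z) (snd y))) (expand \<rho> s)) (expand \<rho> r)"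
      using Node by simp
    have "expand \<rho> (graft_leaf i c s (Node x l r)) =
      lin (\<lambda>a. lin (\<lambda>y. lin (\<lambda>z. lin (\<lambda>u. mono
        (Node (fst a) (relabel c (fst y)) (graft_leaf i c (fst u) (fst z)),
         Node (snd a) (relabel c (snd y)) (graft_leaf i c (snd u) (snd z)))) (expand \<rho> s)) (expand \<rho> r))
        (expand \<rho> l)) (\<rho> x)"
      by (simp add: graft_leaf_Node graft_leaf_relabel[OF False] IH expand_relabel lin_lin)
    also have "\<dots> = lin (\<lambda>a. lin (\<lambda>y. lin (\<lambda>z. lin (\<lambda>u. mono
        (Node (fst a) (graft_leaf i c (fst u) (fst y)) (graft_leaf i c (fst u) (fst z)),
         Node (snd a) (graft_leaf i c (snd u) (snd y)) (graft_leaf i c (snd u) (snd z)))) (expand \<rho> s)) (expand \<rho> r))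
        (expand \<rho> l)) (\<rho> x)"
      by (intro lin_cong) (simp add: graft_leaf_relabel False leaf)
    finally show ?thesis
      by (simp add: lin_lin graft_leaf_Node)
  qed
qed

lemma expand_tree_comp:
  assumes \<rho>: "\<And>x. Poly_Mapping.keys (\<rho> x) \<subseteq> A \<times> B"
    and t: "distinct (leaves t)" "i \<in> set (leaves t)"
  shows "expand \<rho> (tree_comp n i t s) = lin (\<lambda>y. lin (\<lambda>z.
    mono (tree_comp n i (fst y) (fst z), tree_comp n i (snd y) (snd z))) (expand \<rho> s)) (expand \<rho> t)"
proof -
  define c where "c k = (if k < i then k else k + n - 1)" for k
  have *: "tree_comp n i t s = graft_leaf i c (relabel (\<lambda>j. j + i - 1) s) t" for t s :: "'z tree"
    unfolding tree_comp_def graft_leaf_def by (rule graft_cong) (auto simp: c_def)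
  show ?thesis
    using t by (simp add: * expand_graft_leaf[where \<rho> = \<rho>, OF \<rho>] expand_relabel lin_lin)
qed

definition context_pair :: "'v set \<Rightarrow> 'w set \<Rightarrow> ('a tree \<Rightarrow> 'a tree) \<Rightarrow>
    (('v tree \<Rightarrow> 'v tree) \<times> ('w tree \<Rightarrow> 'w tree)) set" where
  "context_pair A B C = {D. fst D \<in> tree_contexts \<and> snd D \<in> tree_contexts \<and>
     (\<forall>t u. leaves u = leaves t \<longrightarrow> leaves (fst D u) = leaves (C t)) \<and>
     (\<forall>t u. leaves u = leaves t \<longrightarrow> leaves (snd D u) = leaves (C t)) \<and>
     (\<forall>u. labels (fst D u) \<subseteq> A \<union> labels u) \<and> (\<forall>u. labels (snd D u) \<subseteq> B \<union> labels u)}"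

lemma expand_context:
  assumes \<rho>: "\<And>x. Poly_Mapping.keys (\<rho> x) \<subseteq> A \<times> B" and C: "C \<in> tree_contexts"
  shows "\<exists>K. Poly_Mapping.keys K \<subseteq> context_pair A B C \<and>
    (\<forall>t. expand \<rho> (C t) = lin (\<lambda>D. lin (\<lambda>y. mono (fst D (fst y), snd D (snd y))) (expand \<rho> t)) K)"
  using C
proof (induction rule: tree_contexts.induct)
  case 1
  show ?case
    by (intro exI[of _ "mono (\<lambda>t. t, \<lambda>t. t)"]) (simp add: context_pair_def tree_contexts.intros)
next
  case (2 C x r)
  then obtain K where D: "Poly_Mapping.keys K \<subseteq> context_pair A B C" and "\<forall>t. expand \<rho> (C t) =
      lin (\<lambda>D. lin (\<lambda>y. mono (fst D (fst y), snd D (snd y))) (expand \<rho> t)) K"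
    by blast
  note K = this(2)[rule_format]
  let ?K = "lin (\<lambda>a. lin (\<lambda>D. lin (\<lambda>z. mono (\<lambda>u. Node (fst a) (fst D u) (fst z),
    \<lambda>u. Node (snd a) (snd D u) (snd z))) (expand \<rho> r)) K) (\<rho> x)"
  have "expand \<rho> (Node x (C t) r) =
      lin (\<lambda>D. lin (\<lambda>y. mono (fst D (fst y), snd D (snd y))) (expand \<rho> t)) ?K" for t
    unfolding expand.simps K by (simp add: lin_lin) (intro lin_cong, rule lin_commute)
  moreover have "Poly_Mapping.keys ?K \<subseteq> context_pair A B (\<lambda>t. Node x (C t) r)"
  proof (intro keys_lin)
    fix a D z assume "a \<in> Poly_Mapping.keys (\<rho> x)" "D \<in> Poly_Mapping.keys K"
      "z \<in> Poly_Mapping.keys (expand \<rho> r)"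
    then have "a \<in> A \<times> B" "D \<in> context_pair A B C" "leaves (fst z) = leaves r \<and> leaves (snd z) = leaves r \<and>
        labels (fst z) \<subseteq> A \<and> labels (snd z) \<subseteq> B"
      using \<rho> D keys_expand[where \<rho> = \<rho>, OF \<rho>] by blast+
    then show "Poly_Mapping.keys (mono (\<lambda>u. Node (fst a) (fst D u) (fst z),
        \<lambda>u. Node (snd a) (snd D u) (snd z))) \<subseteq> context_pair A B (\<lambda>t. Node x (C t) r)"
      by (auto simp: context_pair_def intro: tree_contexts.intros)
  qed
  ultimately show ?case
    by (intro exI[of _ ?K] conjI allI)
next
  case (3 C x l)
  then obtain K where D: "Poly_Mapping.keys K \<subseteq> context_pair A B C" and "\<forall>t. expand \<rho> (C t) =
      lin (\<lambda>D. lin (\<lambda>y. mono (fst D (fst y), snd D (snd y))) (expand \<rho> t)) K"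
    by blast
  note K = this(2)[rule_format]
  let ?K = "lin (\<lambda>a. lin (\<lambda>z. lin (\<lambda>D. mono (\<lambda>u. Node (fst a) (fst z) (fst D u),
    \<lambda>u. Node (snd a) (snd z) (snd D u))) K) (expand \<rho> l)) (\<rho> x)"
  have "expand \<rho> (Node x l (C t)) =
      lin (\<lambda>D. lin (\<lambda>y. mono (fst D (fst y), snd D (snd y))) (expand \<rho> t)) ?K" for t
    unfolding expand.simps K by (simp add: lin_lin)
  moreover have "Poly_Mapping.keys ?K \<subseteq> context_pair A B (\<lambda>t. Node x l (C t))"
  proof (intro keys_lin)
    fix a D z assume "a \<in> Poly_Mapping.keys (\<rho> x)" "D \<in> Poly_Mapping.keys K"
      "z \<in> Poly_Mapping.keys (expand \<rho> l)"
    then have "a \<in> A \<times> B" "D \<in> context_pair A B C" "leaves (fst z) = leaves l \<and> leaves (snd z) = leaves l \<and>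
        labels (fst z) \<subseteq> A \<and> labels (snd z) \<subseteq> B"
      using \<rho> D keys_expand[where \<rho> = \<rho>, OF \<rho>] by blast+
    then show "Poly_Mapping.keys (mono (\<lambda>u. Node (fst a) (fst z) (fst D u),
        \<lambda>u. Node (snd a) (snd z) (snd D u))) \<subseteq> context_pair A B (\<lambda>t. Node x l (C t))"
      by (auto simp: context_pair_def intro: tree_contexts.intros)
  qed
  ultimately show ?case
    by (intro exI[of _ ?K] conjI allI)
qed

context s2_mod
begin

lemma tree_class_label:
  assumes "C \<in> tree_contexts" "C (Node v l r) \<in> trees V n"
  shows "v' \<in> carrier V \<Longrightarrow> tree_class V n (mono (C (Node (vadd V v v') l r))) =
      vadd (ar (free_operad V) n) (tree_class V n (mono (C (Node v l r)))) (tree_class V n (mono (C (Node v' l r))))"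
    and "tree_class V n (mono (C (Node (vscale V c v) l r))) =
      vscale (ar (free_operad V) n) c (tree_class V n (mono (C (Node v l r))))"
    and "tree_class V n (mono (C (Node (swap V v) l r))) = tree_class V n (mono (C (Node v r l)))"
  using tree_rel_trees[OF assms] tree_null_add[OF assms(1) _ assms(2)] tree_null_scale[OF assms]
    tree_null_swap[OF assms] assms(2)
  by (simp_all add: tree_class_add tree_class_scale tree_class_eq_iff keys_add_subset diff_diff_eq del: keys_single)

end

lemma ar_hadamard [simp]: "ar (hadamard P Q) n = tensor (ar P n) (ar Q n)"
  by (simp add: hadamard_def)

lemma tensor_pair_operads: "linear_operad P \<Longrightarrow> linear_operad Q \<Longrightarrow> tensor_pair (ar P n) (ar Q n)"
  by (simp add: tensor_pair_def vclosed_vector_space linear_operadD)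

context
  fixes P :: "('k::field, 'a) operad" and Q :: "('k, 'b) operad"
  assumes P: "linear_operad P" and Q: "linear_operad Q"
begin

interpretation tensor_pair "ar P n" "ar Q n" for n
  by (rule tensor_pair_operads[OF P Q])

lemma act_hadamard:
  assumes \<sigma>: "\<sigma> permutes {1..n}" and p: "Poly_Mapping.keys p \<subseteq> carrier (ar P n) \<times> carrier (ar Q n)"
  shows "act (hadamard P Q) n \<sigma> (tensor_class (ar P n) (ar Q n) p) =
    tensor_class (ar P n) (ar Q n) (push (\<lambda>(x, y). (act P n \<sigma> x, act Q n \<sigma> y)) p)"
proof -
  note lin = linear_operadD(2)[OF P \<sigma>] linear_operadD(2)[OF Q \<sigma>]
  have "qlift (tensor_free (ar P n) (ar Q n)) (tensor_null (ar P n) (ar Q n))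
      (push (\<lambda>(x, y). (act P n \<sigma> x, act Q n \<sigma> y)))
      (coset (tensor_free (ar P n) (ar Q n)) (tensor_null (ar P n) (ar Q n)) p) =
    coset (tensor_free (ar P n) (ar Q n)) (tensor_null (ar P n) (ar Q n))
      (push (\<lambda>(x, y). (act P n \<sigma> x, act Q n \<sigma> y)) p)"
  proof (rule qlift_coset)
    show "vlinear (tensor_free (ar P n) (ar Q n)) (tensor_free (ar P n) (ar Q n))
        (push (\<lambda>(x, y). (act P n \<sigma> x, act Q n \<sigma> y)))"
      unfolding tensor_free_def using vlinearD(1)[OF lin(1)] vlinearD(1)[OF lin(2)]
      by (intro vlinear_push) auto
    show "push (\<lambda>(x, y). (act P n \<sigma> x, act Q n \<sigma> y)) ` tensor_null (ar P n) (ar Q n)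
        \<subseteq> tensor_null (ar P n) (ar Q n)"
      by (rule image_subsetI)
        (rule tensor_pair.push_tensor_null[OF tensor_pair_axioms tensor_pair_axioms lin(1) lin(2)])
  qed (use p in simp_all)
  then show ?thesis
    by (simp add: hadamard_def tensor_class_def)
qed

lemma pcomp_hadamard:
  assumes i: "1 \<le> i" "i \<le> m"
    and p: "Poly_Mapping.keys p \<subseteq> carrier (ar P m) \<times> carrier (ar Q m)"
    and q: "Poly_Mapping.keys q \<subseteq> carrier (ar P n) \<times> carrier (ar Q n)"
  shows "pcomp (hadamard P Q) m n i (tensor_class (ar P m) (ar Q m) p) (tensor_class (ar P n) (ar Q n) q) =
    tensor_class (ar P (m + n - 1)) (ar Q (m + n - 1))
      (push2 (\<lambda>(p, q) (p', q'). (pcomp P m n i p p', pcomp Q m n i q q')) p q)"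
proof -
  let ?k = "m + n - 1" and ?h = "\<lambda>(p, q) (p', q'). (pcomp P m n i p p', pcomp Q m n i q q')"
  note bil = linear_operadD(3)[OF P i, of n] linear_operadD(3)[OF Q i, of n]
  have "qlift2 (tensor_free (ar P ?k) (ar Q ?k)) (tensor_null (ar P ?k) (ar Q ?k)) (push2 ?h)
      (coset (tensor_free (ar P m) (ar Q m)) (tensor_null (ar P m) (ar Q m)) p)
      (coset (tensor_free (ar P n) (ar Q n)) (tensor_null (ar P n) (ar Q n)) q) =
    coset (tensor_free (ar P ?k) (ar Q ?k)) (tensor_null (ar P ?k) (ar Q ?k)) (push2 ?h p q)"
  proof (rule qlift2_coset)
    show "vbilinear (tensor_free (ar P m) (ar Q m)) (tensor_free (ar P n) (ar Q n))
        (tensor_free (ar P ?k) (ar Q ?k)) (push2 ?h)"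
      unfolding tensor_free_def
      using linear_operad_pcomp_mem[OF P i] linear_operad_pcomp_mem[OF Q i] by (intro vbilinear_push2) auto
    fix p' q'
    show "push2 ?h p' q' \<in> tensor_null (ar P ?k) (ar Q ?k)"
      if p': "p' \<in> tensor_null (ar P m) (ar Q m)" and q': "q' \<in> carrier (tensor_free (ar P n) (ar Q n))"
    proof -
      have "push (\<lambda>(x, y). (pcomp P m n i x (fst z), pcomp Q m n i y (snd z))) p'
          \<in> tensor_null (ar P ?k) (ar Q ?k)" if z: "z \<in> Poly_Mapping.keys q'" for z
      proof -
        have "fst z \<in> carrier (ar P n)" "snd z \<in> carrier (ar Q n)"
          using q' z by auto
        from tensor_pair.push_tensor_null[OF tensor_pair_axioms tensor_pair_axioms
            vbilinearD(2)[OF bil(1) this(1)] vbilinearD(2)[OF bil(2) this(2)] p']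
        show ?thesis .
      qed
      then have "lin (\<lambda>z. lin (\<lambda>x. mono (?h x z)) p') q' \<in> tensor_null (ar P ?k) (ar Q ?k)"
        by (intro lin_mem[OF vsubspace_tensor_null_free, of q']) (simp add: push_eq_lin case_prod_beta)
      then show ?thesis
        unfolding push2_eq_lin by (subst lin_commute)
    qed
    show "push2 ?h p' q' \<in> tensor_null (ar P ?k) (ar Q ?k)"
      if p': "p' \<in> carrier (tensor_free (ar P m) (ar Q m))" and q': "q' \<in> tensor_null (ar P n) (ar Q n)"
    proof -
      have "push (\<lambda>(x, y). (pcomp P m n i (fst z) x, pcomp Q m n i (snd z) y)) q'
          \<in> tensor_null (ar P ?k) (ar Q ?k)" if z: "z \<in> Poly_Mapping.keys p'" for z
      proof -
        have "fst z \<in> carrier (ar P m)" "snd z \<in> carrier (ar Q m)"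
          using p' z by auto
        from tensor_pair.push_tensor_null[OF tensor_pair_axioms tensor_pair_axioms
            vbilinearD(1)[OF bil(1) this(1)] vbilinearD(1)[OF bil(2) this(2)] q']
        show ?thesis .
      qed
      then show ?thesis
        unfolding push2_eq_lin
        by (intro lin_mem[OF vsubspace_tensor_null_free, of p']) (simp add: push_eq_lin case_prod_beta)
    qed
  qed (use p q in simp_all)
  then show ?thesis
    by (simp add: hadamard_def tensor_class_def)
qed

end

context s2_pair
begin

abbreviation "FV \<equiv> free_operad V"
abbreviation "FW \<equiv> free_operad W"

sublocale F: tensor_pair "ar FV n" "ar FW n" for n
  by (rule tensor_pair_operads[OF V.linear_operad_free W.linear_operad_free])

definition pair_class :: "nat \<Rightarrow> 'v tree \<times> 'w tree \<Rightarrow> ('v tree \<Rightarrow>\<^sub>0 'k) set \<times> ('w tree \<Rightarrow>\<^sub>0 'k) set" where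
  "pair_class n y = (tree_class V n (mono (fst y)), tree_class W n (mono (snd y)))"

definition expand_class where
  "expand_class n t = lin (\<lambda>y. mono (pair_class n y)) (expand (tensor_rep V W) t)"

lemma expand_trees:
  assumes "t \<in> trees (s2_tensor V W) n" "y \<in> Poly_Mapping.keys (expand (tensor_rep V W) t)"
  shows "fst y \<in> trees V n" "snd y \<in> trees W n"
  using subsetD[OF keys_expand[OF keys_tensor_rep] assms(2)] assms(1) by (auto simp: trees_def)

lemma pair_class_mem [simp]:
  "fst y \<in> trees V n \<Longrightarrow> snd y \<in> trees W n \<Longrightarrow>
    pair_class n y \<in> carrier (ar FV n) \<times> carrier (ar FW n)"
  by (simp add: pair_class_def)

lemma keys_expand_class:
  assumes "t \<in> trees (s2_tensor V W) n"
  shows "Poly_Mapping.keys (expand_class n t) \<subseteq> carrier (ar FV n) \<times> carrier (ar FW n)"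
  unfolding expand_class_def
  using expand_trees[OF assms] by (intro keys_lin) simp

lemma context_pair_trees:
  assumes "D \<in> context_pair (carrier V) (carrier W) C" "C t \<in> trees (s2_tensor V W) n"
  shows "leaves u = leaves t \<Longrightarrow> labels u \<subseteq> carrier V \<Longrightarrow> fst D u \<in> trees V n"
    and "leaves u' = leaves t \<Longrightarrow> labels u' \<subseteq> carrier W \<Longrightarrow> snd D u' \<in> trees W n"
proof -
  have D: "leaves u = leaves t \<Longrightarrow> leaves (fst D u) = leaves (C t)"
    "leaves u' = leaves t \<Longrightarrow> leaves (snd D u') = leaves (C t)"
    "labels (fst D u) \<subseteq> carrier V \<union> labels u" "labels (snd D u') \<subseteq> carrier W \<union> labels u'"
    using assms(1) unfolding context_pair_def by blast+
  then show "leaves u = leaves t \<Longrightarrow> labels u \<subseteq> carrier V \<Longrightarrow> fst D u \<in> trees V n"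
    "leaves u' = leaves t \<Longrightarrow> labels u' \<subseteq> carrier W \<Longrightarrow> snd D u' \<in> trees W n"
    using assms(2) by (auto simp: trees_def)
qed

definition plug where
  "plug n K l r = lin (\<lambda>a. lin (\<lambda>D. lin (\<lambda>y. lin (\<lambda>z. mono (pair_class n
     (fst D (Node (fst a) (fst y) (fst z)), snd D (Node (snd a) (snd y) (snd z)))))
     (expand (tensor_rep V W) r)) (expand (tensor_rep V W) l)) K)"

lemma plug_null:
  assumes C: "C \<in> tree_contexts" and t: "C (Node x l r) \<in> trees (s2_tensor V W) n"
    and K: "Poly_Mapping.keys K \<subseteq> context_pair (carrier V) (carrier W) C"
    and \<xi>: "\<xi> \<in> tensor_null V W"
  shows "plug n K l r \<xi> \<in> tensor_null (ar FV n) (ar FW n)"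
proof -
  let ?E = "expand (tensor_rep V W)"
  let ?F = "\<lambda>a. lin (\<lambda>D. lin (\<lambda>y. lin (\<lambda>z. mono (pair_class n
    (fst D (Node (fst a) (fst y) (fst z)), snd D (Node (snd a) (snd y) (snd z))))) (?E r)) (?E l)) K"
  have D: "fst D \<in> tree_contexts" "snd D \<in> tree_contexts"
      "v \<in> carrier V \<Longrightarrow> fst D (Node v (fst y) (fst z)) \<in> trees V n"
      "w \<in> carrier W \<Longrightarrow> snd D (Node w (snd y) (snd z)) \<in> trees W n"
    if "D \<in> Poly_Mapping.keys K" "y \<in> Poly_Mapping.keys (?E l)" "z \<in> Poly_Mapping.keys (?E r)" for D y z v w
  proof -
    have D: "D \<in> context_pair (carrier V) (carrier W) C"
      using that K by blast
    note yz = subsetD[OF keys_expand[OF keys_tensor_rep] that(2)] subsetD[OF keys_expand[OF keys_tensor_rep] that(3)]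
    show "v \<in> carrier V \<Longrightarrow> fst D (Node v (fst y) (fst z)) \<in> trees V n"
      "w \<in> carrier W \<Longrightarrow> snd D (Node w (snd y) (snd z)) \<in> trees W n"
      using yz by (intro context_pair_trees[OF D t]; simp)+
    show "fst D \<in> tree_contexts" "snd D \<in> tree_contexts"
      using D unfolding context_pair_def by auto
  qed
  note V_label = V.tree_class_label[OF D(1) D(3)] and W_label = W.tree_class_label[OF D(2) D(4)]
  note lm = lin_mem[OF F.vsubspace_tensor_null_free]
  show ?thesis
    unfolding plug_def
  proof (rule tensor_null_lin[OF F.vsubspace_tensor_null_free _ _ _ _ _ \<xi>])
    fix v w assume vw: "v \<in> carrier V" "w \<in> carrier W"
    show "Poly_Mapping.keys (?F (v, w)) \<subseteq> carrier (ar FV n) \<times> carrier (ar FW n)"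
      using vw D by (intro keys_lin) simp
    fix c
    show "?F (vscale V c v, w) - pscale c (?F (v, w)) \<in> tensor_null (ar FV n) (ar FW n)"
      unfolding lin_fun_diff[symmetric] lin_fun_pscale[symmetric]
      using vw D by (intro lm) (simp add: pair_class_def V_label F.tensor_null_intros)
    show "?F (v, vscale W c w) - pscale c (?F (v, w)) \<in> tensor_null (ar FV n) (ar FW n)"
      unfolding lin_fun_diff[symmetric] lin_fun_pscale[symmetric]
      using vw D by (intro lm) (simp add: pair_class_def W_label F.tensor_null_intros)
  next
    fix v v' w assume vw: "v \<in> carrier V" "v' \<in> carrier V" "w \<in> carrier W"
    show "?F (vadd V v v', w) - ?F (v, w) - ?F (v', w) \<in> tensor_null (ar FV n) (ar FW n)"
      unfolding lin_fun_diff[symmetric]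
      using vw D by (intro lm) (simp add: pair_class_def V_label F.tensor_null_intros)
  next
    fix v w w' assume vw: "v \<in> carrier V" "w \<in> carrier W" "w' \<in> carrier W"
    show "?F (v, vadd W w w') - ?F (v, w) - ?F (v, w') \<in> tensor_null (ar FV n) (ar FW n)"
      unfolding lin_fun_diff[symmetric]
      using vw D by (intro lm) (simp add: pair_class_def W_label F.tensor_null_intros)
  qed
qed

lemma expand_class_plug:
  assumes C: "C \<in> tree_contexts"
  obtains K where "Poly_Mapping.keys K \<subseteq> context_pair (carrier V) (carrier W) C"
    and "\<And>x l r. expand_class n (C (Node x l r)) = plug n K l r (tensor_rep V W x)"
proof -
  obtain K where "Poly_Mapping.keys K \<subseteq> context_pair (carrier V) (carrier W) C"
    and K: "\<forall>t. expand (tensor_rep V W) (C t) =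
      lin (\<lambda>D. lin (\<lambda>y. mono (fst D (fst y), snd D (snd y))) (expand (tensor_rep V W) t)) K"
    using expand_context[where \<rho> = "tensor_rep V W", OF keys_tensor_rep C] by blast
  moreover have "expand_class n (C (Node x l r)) = plug n K l r (tensor_rep V W x)" for x l r
    unfolding expand_class_def plug_def K[rule_format] by (simp add: lin_lin) (rule lin_commute)
  ultimately show thesis
    using that by blast
qed

lemma plug_swap:
  assumes C: "C \<in> tree_contexts" and t: "C (Node x l r) \<in> trees (s2_tensor V W) n"
    and K: "Poly_Mapping.keys K \<subseteq> context_pair (carrier V) (carrier W) C"
    and \<xi>: "Poly_Mapping.keys \<xi> \<subseteq> carrier V \<times> carrier W"
  shows "plug n K l r (push (\<lambda>(v, w). (swap V v, swap W w)) \<xi>) = plug n K r l \<xi>"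
proof -
  let ?E = "expand (tensor_rep V W)"
  have eq: "pair_class n (fst D (Node (swap V (fst a)) (fst y) (fst z)), snd D (Node (swap W (snd a)) (snd y) (snd z))) =
      pair_class n (fst D (Node (fst a) (fst z) (fst y)), snd D (Node (snd a) (snd z) (snd y)))"
    if "a \<in> Poly_Mapping.keys \<xi>" "D \<in> Poly_Mapping.keys K" "y \<in> Poly_Mapping.keys (?E l)"
      "z \<in> Poly_Mapping.keys (?E r)" for a D y z
  proof -
    have D: "D \<in> context_pair (carrier V) (carrier W) C" and a: "fst a \<in> carrier V" "snd a \<in> carrier W"
      using that K \<xi> by auto
    note yz = subsetD[OF keys_expand[OF keys_tensor_rep] that(3)] subsetD[OF keys_expand[OF keys_tensor_rep] that(4)]
    have "fst D (Node (fst a) (fst y) (fst z)) \<in> trees V n"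
      "snd D (Node (snd a) (snd y) (snd z)) \<in> trees W n"
      using yz a by (intro context_pair_trees[OF D t]; simp)+
    moreover have "fst D \<in> tree_contexts" "snd D \<in> tree_contexts"
      using D unfolding context_pair_def by auto
    ultimately show ?thesis
      by (simp add: pair_class_def V.tree_class_label(3) W.tree_class_label(3))
  qed
  have "plug n K l r (push (\<lambda>(v, w). (swap V v, swap W w)) \<xi>) =
    lin (\<lambda>a. lin (\<lambda>D. lin (\<lambda>y. lin (\<lambda>z. mono (pair_class n
     (fst D (Node (fst a) (fst z) (fst y)), snd D (Node (snd a) (snd z) (snd y))))) (?E r)) (?E l)) K) \<xi>"
    unfolding plug_def push_eq_lin lin_lin lin_mono case_prod_beta fst_conv snd_conv
    by (intro lin_cong arg_cong[of _ _ mono] eq)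
  also have "\<dots> = plug n K r l \<xi>"
    unfolding plug_def by (intro lin_cong, rule lin_commute)
  finally show ?thesis .
qed

lemma expand_class_null:
  assumes p: "p \<in> tree_null (s2_tensor V W) n"
  shows "lin (expand_class n) p \<in> tensor_null (ar FV n) (ar FW n)"
proof (rule VW.tree_null_lin[OF F.vsubspace_tensor_null_free keys_expand_class _ _ _ p])
  fix C x x' l r
  assume C: "C \<in> tree_contexts" and t: "C (Node x l r) \<in> trees (s2_tensor V W) n"
    and x: "x \<in> carrier (s2_tensor V W)" "x' \<in> carrier (s2_tensor V W)"
  obtain K where K: "Poly_Mapping.keys K \<subseteq> context_pair (carrier V) (carrier W) C"
    and plug: "\<And>x l r. expand_class n (C (Node x l r)) = plug n K l r (tensor_rep V W x)"
    by (rule expand_class_plug[OF C, of n]) blast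
  have "plug n K l r (tensor_rep V W (vadd (tensor V W) x x') - tensor_rep V W x - tensor_rep V W x')
      \<in> tensor_null (ar FV n) (ar FW n)"
    using x by (intro plug_null[OF C t K] tensor_rep_add) simp_all
  then show "expand_class n (C (Node (vadd (s2_tensor V W) x x') l r)) - expand_class n (C (Node x l r)) -
      expand_class n (C (Node x' l r)) \<in> tensor_null (ar FV n) (ar FW n)"
    unfolding plug by (simp add: plug_def lin_diff)
next
  fix C c x l r
  assume C: "C \<in> tree_contexts" and t: "C (Node x l r) \<in> trees (s2_tensor V W) n"
    and x: "x \<in> carrier (s2_tensor V W)"
  obtain K where K: "Poly_Mapping.keys K \<subseteq> context_pair (carrier V) (carrier W) C"
    and plug: "\<And>x l r. expand_class n (C (Node x l r)) = plug n K l r (tensor_rep V W x)"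
    by (rule expand_class_plug[OF C, of n]) blast
  have "plug n K l r (tensor_rep V W (vscale (tensor V W) c x) - pscale c (tensor_rep V W x))
      \<in> tensor_null (ar FV n) (ar FW n)"
    using x by (intro plug_null[OF C t K] tensor_rep_scale) simp_all
  then show "expand_class n (C (Node (vscale (s2_tensor V W) c x) l r)) -
      pscale c (expand_class n (C (Node x l r))) \<in> tensor_null (ar FV n) (ar FW n)"
    unfolding plug by (simp add: plug_def lin_diff lin_pscale)
  have "plug n K l r (tensor_rep V W (swap (s2_tensor V W) x) -
      push (\<lambda>(v, w). (swap V v, swap W w)) (tensor_rep V W x)) \<in> tensor_null (ar FV n) (ar FW n)"
    using x by (intro plug_null[OF C t K] tensor_rep_swap) simp_all
  moreover have "plug n K l r (p - q) = plug n K l r p - plug n K l r q" for p q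
    by (simp add: plug_def lin_diff)
  ultimately show "expand_class n (C (Node (swap (s2_tensor V W) x) l r)) -
      expand_class n (C (Node x r l)) \<in> tensor_null (ar FV n) (ar FW n)"
    unfolding plug by (simp add: plug_swap[OF C t K keys_tensor_rep])
qed

end

lemma vlinear_free_eq:
  assumes f: "vlinear (free_vspace X) W f" and g: "vlinear (free_vspace X) W g"
    and W: "vector_space_on W" and eq: "\<And>x. x \<in> X \<Longrightarrow> f (mono x) = g (mono x)"
    and p: "Poly_Mapping.keys p \<subseteq> X"
  shows "f p = g p"
proof -
  have "vsubspace (free_vspace X) {p. Poly_Mapping.keys p \<subseteq> X \<and> f p = g p}"
    using vlinear_zero[OF f vector_space_free W] vlinear_zero[OF g vector_space_free W]
      vlinearD(2,3)[OF f] vlinearD(2,3)[OF g]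
    unfolding vsubspace_def by (simp add: keys_add_subset Collect_mono)
  then have "p \<in> {p. Poly_Mapping.keys p \<subseteq> X \<and> f p = g p}"
    by (rule free_eq_sum_mono) (use p eq in auto)
  then show ?thesis
    by simp
qed

context s2_pair
begin

definition white where
  "white n = qlift (tensor_free (ar FV n) (ar FW n)) (tensor_null (ar FV n) (ar FW n)) (lin (expand_class n))"

lemma keys_lin_expand_class:
  "Poly_Mapping.keys p \<subseteq> trees (s2_tensor V W) n \<Longrightarrow>
    Poly_Mapping.keys (lin (expand_class n) p) \<subseteq> carrier (ar FV n) \<times> carrier (ar FW n)"
  by (intro keys_lin keys_expand_class) auto

lemma vlinear_expand_class:
  "vlinear (tree_free (s2_tensor V W) n) (tensor_free (ar FV n) (ar FW n)) (lin (expand_class n))"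
  unfolding tree_free_def tensor_free_def by (intro vlinear_lin keys_expand_class)

lemma white_class:
  assumes "Poly_Mapping.keys p \<subseteq> trees (s2_tensor V W) n"
  shows "white n (tree_class (s2_tensor V W) n p) = tensor_class (ar FV n) (ar FW n) (lin (expand_class n) p)"
  unfolding white_def tree_class_def tensor_class_def
  using assms by (intro qlift_coset vlinear_expand_class image_subsetI expand_class_null) simp_all

lemma vlinear_white: "vlinear (ar (free_operad (s2_tensor V W)) n) (tensor (ar FV n) (ar FW n)) (white n)"
proof -
  have "vlinear (tree_free (s2_tensor V W) n) (tensor (ar FV n) (ar FW n))
      (\<lambda>p. tensor_class (ar FV n) (ar FW n) (lin (expand_class n) p))"
    by (rule vlinear_comp[OF vlinear_expand_class F.vlinear_tensor_class])
  then show ?thesis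
    unfolding VW.ar_free_operad
    by (rule vlinear_vquot) (simp_all add: white_class flip: tree_class_def)
qed

lemma expand_class_relabel:
  assumes \<sigma>: "\<sigma> permutes {1..n}" and t: "t \<in> trees (s2_tensor V W) n"
  shows "expand_class n (relabel (inv \<sigma>) t) = push (\<lambda>(x, y). (act FV n \<sigma> x, act FW n \<sigma> y)) (expand_class n t)"
  unfolding expand_class_def expand_relabel push_eq_lin lin_lin lin_mono
  using expand_trees[OF t]
  by (intro lin_cong) (simp add: pair_class_def V.act_free_operad[OF \<sigma>] W.act_free_operad[OF \<sigma>])

lemma expand_class_tree_comp:
  assumes i: "1 \<le> i" "i \<le> m" and t: "t \<in> trees (s2_tensor V W) m" and s: "s \<in> trees (s2_tensor V W) n"
  shows "expand_class (m + n - 1) (tree_comp n i t s) =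
    push2 (\<lambda>(p, q) (p', q'). (pcomp FV m n i p p', pcomp FW m n i q q')) (expand_class m t) (expand_class n s)"
proof -
  have "distinct (leaves t)" "i \<in> set (leaves t)"
    using t i by (auto simp: trees_def)
  note E = expand_tree_comp[where \<rho> = "tensor_rep V W", OF keys_tensor_rep this]
  show ?thesis
    unfolding expand_class_def E push2_eq_lin lin_lin lin_mono
    using expand_trees[OF t] expand_trees[OF s]
    by (intro lin_cong)
      (simp add: pair_class_def V.pcomp_free_operad[OF i] W.pcomp_free_operad[OF i] push2_eq_lin)
qed

lemma operad_hom_white: "operad_hom (free_operad (s2_tensor V W)) (hadamard FV FW) white"
  unfolding operad_hom_def
proof (intro conjI allI impI ballI)
  let ?T = "s2_tensor V W"
  note PQ = V.linear_operad_free W.linear_operad_free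
  show "vlinear (ar (free_operad ?T) n) (ar (hadamard FV FW) n) (white n)" for n
    using vlinear_white by simp
  show "white n (act (free_operad ?T) n \<sigma> x) = act (hadamard FV FW) n \<sigma> (white n x)"
    if \<sigma>: "\<sigma> permutes {1..n}" and x: "x \<in> carrier (ar (free_operad ?T) n)" for n \<sigma> x
  proof -
    obtain p where p: "Poly_Mapping.keys p \<subseteq> trees ?T n" "x = tree_class ?T n p"
      using x by (auto simp: VW.carrier_ar_free)
    have keys: "Poly_Mapping.keys (push (relabel (inv \<sigma>)) p) \<subseteq> trees ?T n"
      using p relabel_trees[OF permutes_inv[OF \<sigma>]] by (intro keys_push) auto
    have "lin (expand_class n) (push (relabel (inv \<sigma>)) p) = lin (\<lambda>t. expand_class n (relabel (inv \<sigma>) t)) p"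
      by (simp add: push_eq_lin lin_lin)
    also have "\<dots> = lin (\<lambda>t. push (\<lambda>(x, y). (act FV n \<sigma> x, act FW n \<sigma> y)) (expand_class n t)) p"
      using p by (intro lin_cong expand_class_relabel[OF \<sigma>]) auto
    also have "\<dots> = push (\<lambda>(x, y). (act FV n \<sigma> x, act FW n \<sigma> y)) (lin (expand_class n) p)"
      by (simp add: push_eq_lin lin_lin)
    finally show ?thesis
      unfolding p(2) VW.act_free_operad[OF \<sigma> p(1)] white_class[OF p(1)] white_class[OF keys]
        act_hadamard[OF PQ \<sigma> keys_lin_expand_class[OF p(1)]] by simp
  qed
  show "white (m + n - 1) (pcomp (free_operad ?T) m n i x y) =
      pcomp (hadamard FV FW) m n i (white m x) (white n y)"
    if i': "1 \<le> i \<and> i \<le> m" and x: "x \<in> carrier (ar (free_operad ?T) m)"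
      and y: "y \<in> carrier (ar (free_operad ?T) n)" for m n i x y
  proof -
    let ?h = "\<lambda>(p, q) (p', q'). (pcomp FV m n i p p', pcomp FW m n i q q')"
    have i: "1 \<le> i" "i \<le> m" using i' by auto
    obtain p q where p: "Poly_Mapping.keys p \<subseteq> trees ?T m" "x = tree_class ?T m p"
        and q: "Poly_Mapping.keys q \<subseteq> trees ?T n" "y = tree_class ?T n q"
      using x y by (auto simp: VW.carrier_ar_free)
    have "lin (expand_class (m + n - 1)) (push2 (tree_comp n i) p q) =
        lin (\<lambda>t. lin (\<lambda>s. expand_class (m + n - 1) (tree_comp n i t s)) q) p"
      by (simp add: push2_eq_lin lin_lin)
    also have "\<dots> = lin (\<lambda>t. lin (\<lambda>s. push2 ?h (expand_class m t) (expand_class n s)) q) p"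
      using p q by (intro lin_cong expand_class_tree_comp[OF i]) auto
    also have "\<dots> = lin (\<lambda>t. lin (\<lambda>a. lin (\<lambda>s. lin (\<lambda>b. mono (?h a b)) (expand_class n s)) q) (expand_class m t)) p"
      unfolding push2_eq_lin by (intro lin_cong, rule lin_commute)
    also have "\<dots> = push2 ?h (lin (expand_class m) p) (lin (expand_class n) q)"
      by (simp add: push2_eq_lin lin_lin)
    finally show ?thesis
      unfolding p(2) q(2) VW.pcomp_free_operad[OF i p(1) q(1)] white_class[OF p(1)] white_class[OF q(1)]
        white_class[OF VW.keys_push2_tree_comp[OF i p(1) q(1)]]
        pcomp_hadamard[OF PQ i keys_lin_expand_class[OF p(1)] keys_lin_expand_class[OF q(1)]] by simp
  qed
  show "white 1 (unit (free_operad ?T)) = unit (hadamard FV FW)"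
    using white_class[of "mono (Leaf 1)" 1]
    by (simp add: free_operad_def hadamard_def pure_tensor_eq expand_class_def pair_class_def)
      (simp add: trees_def)
qed

lemma white_free_gen:
  assumes vw: "v \<in> carrier V" "w \<in> carrier W"
  shows "white 2 (free_gen (s2_tensor V W) (pure_tensor V W v w)) =
    pure_tensor (ar FV 2) (ar FW 2) (free_gen V v) (free_gen W w)"
proof -
  let ?x = "pure_tensor V W v w" and ?K = "mono (\<lambda>t. t, \<lambda>t. t) :: _ \<Rightarrow>\<^sub>0 'k"
  have x: "?x \<in> carrier (tensor V W)"
    using vw by (simp add: pure_tensor_eq)
  then have t: "Node ?x (Leaf 1) (Leaf 2) \<in> trees (s2_tensor V W) 2"
    by (auto simp: trees_def)
  have "plug 2 ?K (Leaf 1) (Leaf 2) (tensor_rep V W ?x - mono (v, w)) \<in> tensor_null (ar FV 2) (ar FW 2)"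
    using vw t unfolding pure_tensor_eq
    by (intro plug_null[of "\<lambda>t. t"] tensor_rep_class tree_contexts.intros)
      (auto simp: context_pair_def tree_contexts.intros)
  then have "expand_class 2 (Node ?x (Leaf 1) (Leaf 2)) -
      mono (free_gen V v, free_gen W w) \<in> tensor_null (ar FV 2) (ar FW 2)"
    by (simp add: plug_def expand_class_def lin_diff lin_lin pair_class_def free_gen_def)
  moreover have "Poly_Mapping.keys (mono (free_gen V v, free_gen W w) :: _ \<Rightarrow>\<^sub>0 'k)
      \<subseteq> carrier (ar FV 2) \<times> carrier (ar FW 2)"
    using vw by (auto simp: free_gen_def trees_def intro!: V.tree_class_mem W.tree_class_mem)
  ultimately show ?thesis
    using t keys_expand_class[OF t]
    by (simp add: free_gen_def[of "s2_tensor V W"] white_class pure_tensor_eq[of "ar FV 2"] F.tensor_class_eq_iff)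
qed

end

subsection \<open>Uniqueness in arity 3\<close>

lemma trees_3_cases:
  assumes "t \<in> trees V 3"
  obtains (left) u v i j k where "t = Node v (Node u (Leaf i) (Leaf j)) (Leaf k)"
      "u \<in> carrier V" "v \<in> carrier V" "distinct [i, j, k]" "{i, j, k} = {1..3}"
    | (right) u v i j k where "t = Node u (Leaf i) (Node v (Leaf j) (Leaf k))"
      "u \<in> carrier V" "v \<in> carrier V" "distinct [i, j, k]" "{i, j, k} = {1..3}"
proof -
  have len: "length (leaves t) = 3"
    using assms distinct_card[of "leaves t"] by (simp add: trees_def)
  have 1: "\<exists>k. s = Leaf k" if "length (leaves s) = 1" for s :: "'a tree"
  proof (cases s)
    case (Node v l r)
    then show ?thesis
      using that leaves_nonempty[of l] leaves_nonempty[of r] by (cases "leaves l"; cases "leaves r"; simp)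
  qed simp
  have 2: "\<exists>v i j. s = Node v (Leaf i) (Leaf j)" if "length (leaves s) = 2" for s :: "'a tree"
  proof (cases s)
    case (Node v l r)
    then have "length (leaves l) = 1" "length (leaves r) = 1"
      using that leaves_nonempty[of l] leaves_nonempty[of r]
      by (cases "leaves l"; cases "leaves r"; simp)+
    then show ?thesis using Node 1 by blast
  qed (use that in simp)
  show thesis
  proof (cases t)
    case (Leaf k)
    then show thesis using len by simp
  next
    case (Node v l r)
    then have "length (leaves l) + length (leaves r) = 3" "length (leaves l) \<noteq> 0" "length (leaves r) \<noteq> 0"
      using len leaves_nonempty[of l] leaves_nonempty[of r] by simp_all
    then consider "length (leaves l) = 2" "length (leaves r) = 1" | "length (leaves l) = 1" "length (leaves r) = 2"
      by linarith
    then show thesis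
    proof cases
      case 1
      then obtain u i j k where "t = Node v (Node u (Leaf i) (Leaf j)) (Leaf k)"
        using 2 \<open>\<And>s. length (leaves s) = 1 \<Longrightarrow> \<exists>k. s = Leaf k\<close> Node by metis
      then show thesis
        using assms by (intro left[of v u i j k]) (auto simp: trees_def)
    next
      case 2
      then obtain u i j k where "t = Node v (Leaf i) (Node u (Leaf j) (Leaf k))"
        using 1 \<open>\<And>s. length (leaves s) = 2 \<Longrightarrow> \<exists>v i j. s = Node v (Leaf i) (Leaf j)\<close> Node by metis
      then show thesis
        using assms by (intro right[of v i u j k]) (auto simp: trees_def)
    qed
  qed
qed

lemma atLeastAtMost_1_3: "{1..3::nat} = {1, 2, 3}"
  by auto

lemma permutation_3:
  assumes "distinct [i, j, k]" "{i, j, k} = {1..3::nat}"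
  obtains \<sigma> where "\<sigma> permutes {1..3}" "\<sigma> 1 = i" "\<sigma> 2 = j" "\<sigma> 3 = k"
proof
  let ?\<sigma> = "\<lambda>x. if x = 1 then i else if x = 2 then j else if x = 3 then k else x"
  show "?\<sigma> permutes {1..3}"
  proof (rule bij_imp_permutes)
    show "bij_betw ?\<sigma> {1..3} {1..3}"
      unfolding assms(2)[symmetric] bij_betw_def
      using assms unfolding atLeastAtMost_1_3 by (auto simp: inj_on_def)
  qed (auto simp: atLeastAtMost_1_3)
qed auto

context s2_mod
begin

lemma tree_class_3:
  assumes \<sigma>: "\<sigma> permutes {1..3}" and uv: "u \<in> carrier V" "v \<in> carrier V"
  shows "tree_class V 3 (mono (Node v (Node u (Leaf (\<sigma> 1)) (Leaf (\<sigma> 2))) (Leaf (\<sigma> 3)))) =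
      act (free_operad V) 3 (inv \<sigma>) (pcomp (free_operad V) 2 2 1 (free_gen V v) (free_gen V u))"
    and "tree_class V 3 (mono (Node u (Leaf (\<sigma> 1)) (Node v (Leaf (\<sigma> 2)) (Leaf (\<sigma> 3))))) =
      act (free_operad V) 3 (inv \<sigma>) (pcomp (free_operad V) 2 2 2 (free_gen V u) (free_gen V v))"
proof -
  have t2: "Node v (Leaf 1) (Leaf 2) \<in> trees V 2" if "v \<in> carrier V" for v
    using that by (auto simp: trees_def)
  have t3: "Node v (Node u (Leaf 1) (Leaf 2)) (Leaf 3) \<in> trees V 3"
    "Node u (Leaf 1) (Node v (Leaf 2) (Leaf 3)) \<in> trees V 3"
    using uv by (auto simp: trees_def)
  have c: "tree_comp 2 1 (Node v (Leaf 1) (Leaf 2)) (Node u (Leaf 1) (Leaf 2)) = Node v (Node u (Leaf 1) (Leaf 2)) (Leaf 3)"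
    "tree_comp 2 2 (Node u (Leaf 1) (Leaf 2)) (Node v (Leaf 1) (Leaf 2)) = Node u (Leaf 1) (Node v (Leaf 2) (Leaf 3))"
    by (simp_all add: tree_comp_def)
  have "pcomp (free_operad V) 2 2 1 (free_gen V v) (free_gen V u) =
      tree_class V 3 (mono (Node v (Node u (Leaf 1) (Leaf 2)) (Leaf 3)))"
    using pcomp_free_operad[of 1 2 "mono (Node v (Leaf 1) (Leaf 2))" "mono (Node u (Leaf 1) (Leaf 2))" 2] uv t2
    by (simp add: free_gen_def push2_eq_lin c)
  moreover have "pcomp (free_operad V) 2 2 2 (free_gen V u) (free_gen V v) =
      tree_class V 3 (mono (Node u (Leaf 1) (Node v (Leaf 2) (Leaf 3))))"
    using pcomp_free_operad[of 2 2 "mono (Node u (Leaf 1) (Leaf 2))" "mono (Node v (Leaf 1) (Leaf 2))" 2] uv t2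
    by (simp add: free_gen_def push2_eq_lin c)
  ultimately show "tree_class V 3 (mono (Node v (Node u (Leaf (\<sigma> 1)) (Leaf (\<sigma> 2))) (Leaf (\<sigma> 3)))) =
      act (free_operad V) 3 (inv \<sigma>) (pcomp (free_operad V) 2 2 1 (free_gen V v) (free_gen V u))"
    "tree_class V 3 (mono (Node u (Leaf (\<sigma> 1)) (Node v (Leaf (\<sigma> 2)) (Leaf (\<sigma> 3))))) =
      act (free_operad V) 3 (inv \<sigma>) (pcomp (free_operad V) 2 2 2 (free_gen V u) (free_gen V v))"
    using t3 by (simp_all add: act_free_operad[OF permutes_inv[OF \<sigma>]] permutes_inv_inv[OF \<sigma>])
qed

lemma free_gen_mem [simp]: "v \<in> carrier V \<Longrightarrow> free_gen V v \<in> carrier (ar (free_operad V) 2)"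
  unfolding free_gen_def by (rule tree_class_mem) (auto simp: trees_def)

lemma vlinear_free_gen: "vlinear V (ar (free_operad V) 2) (free_gen V)"
proof -
  have "Node v (Leaf 1) (Leaf 2) \<in> trees V 2" if "v \<in> carrier V" for v
    using that by (auto simp: trees_def)
  then show ?thesis
    using tree_class_label[of "\<lambda>t. t" _ "Leaf 1" "Leaf 2" 2, OF tree_contexts.intros(1)]
    by (auto simp: vlinear_def free_gen_def)
qed

lemma operad_hom_eq_3:
  assumes \<phi>: "operad_hom (free_operad V) Q \<phi>" and \<psi>: "operad_hom (free_operad V) Q \<psi>"
    and Q: "vector_space_on (ar Q 3)"
    and eq: "\<And>v. v \<in> carrier V \<Longrightarrow> \<phi> 2 (free_gen V v) = \<psi> 2 (free_gen V v)"
    and x: "x \<in> carrier (ar (free_operad V) 3)"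
  shows "\<phi> 3 x = \<psi> 3 x"
proof -
  note F = linear_operad_free
  have lin: "vlinear (free_vspace (trees V 3)) (ar Q 3) (\<lambda>p. \<chi> 3 (tree_class V 3 p))"
    if "operad_hom (free_operad V) Q \<chi>" for \<chi>
    using vlinear_comp[OF vlinear_tree_class operad_homD(1)[OF that]] unfolding tree_free_def .
  have pc: "pcomp (free_operad V) 2 2 i (free_gen V u) (free_gen V v) \<in> carrier (ar (free_operad V) 3)"
    "\<chi> 3 (pcomp (free_operad V) 2 2 i (free_gen V u) (free_gen V v)) =
      pcomp Q 2 2 i (\<chi> 2 (free_gen V u)) (\<chi> 2 (free_gen V v))"
    if "operad_hom (free_operad V) Q \<chi>" "1 \<le> i" "i \<le> 2" "u \<in> carrier V" "v \<in> carrier V" for \<chi> i u v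
    using linear_operad_pcomp_mem[OF F that(2,3), of "free_gen V u" "free_gen V v" 2] that
      operad_homD(3)[OF that(1-3), of "free_gen V u" "free_gen V v" 2] by simp_all
  obtain p where p: "Poly_Mapping.keys p \<subseteq> trees V 3" "x = tree_class V 3 p"
    using x by (auto simp: carrier_ar_free)
  have "\<phi> 3 (tree_class V 3 (mono t)) = \<psi> 3 (tree_class V 3 (mono t))" if "t \<in> trees V 3" for t
    using that
  proof (cases rule: trees_3_cases)
    case (left u v i j k)
    obtain \<sigma> where \<sigma>: "\<sigma> permutes {1..3}" and ijk: "\<sigma> 1 = i" "\<sigma> 2 = j" "\<sigma> 3 = k"
      using permutation_3[OF left(4,5)] .
    note \<sigma>' = permutes_inv[OF \<sigma>]
    show ?thesis
      using tree_class_3(1)[OF \<sigma> left(2,3)] left(2,3)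
      by (simp add: left(1) ijk operad_homD(2)[OF \<phi> \<sigma>'] operad_homD(2)[OF \<psi> \<sigma>'] pc[OF \<phi>] pc[OF \<psi>] eq)
  next
    case (right u v i j k)
    obtain \<sigma> where \<sigma>: "\<sigma> permutes {1..3}" and ijk: "\<sigma> 1 = i" "\<sigma> 2 = j" "\<sigma> 3 = k"
      using permutation_3[OF right(4,5)] .
    note \<sigma>' = permutes_inv[OF \<sigma>]
    show ?thesis
      using tree_class_3(2)[OF \<sigma> right(2,3)] right(2,3)
      by (simp add: right(1) ijk operad_homD(2)[OF \<phi> \<sigma>'] operad_homD(2)[OF \<psi> \<sigma>'] pc[OF \<phi>] pc[OF \<psi>] eq)
  qed
  then show ?thesis
    unfolding p(2) by (rule vlinear_free_eq[OF lin[OF \<phi>] lin[OF \<psi>] Q _ p(1)])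
qed

end

lemma (in s2_pair) white_map_3:
  assumes x: "x \<in> carrier (ar (free_operad (s2_tensor V W)) 3)"
  shows "white_map V W 3 x = white 3 x"
proof -
  let ?T = "s2_tensor V W"
  let ?P = "\<lambda>\<Phi>. operad_hom (free_operad ?T) (hadamard FV FW) \<Phi> \<and>
     (\<forall>v\<in>carrier V. \<forall>w\<in>carrier W. \<Phi> 2 (free_gen ?T (pure_tensor V W v w)) =
        pure_tensor (ar FV 2) (ar FW 2) (free_gen V v) (free_gen W w))"
  have "?P white"
    using operad_hom_white white_free_gen by blast
  then have "?P (SOME \<Phi>. ?P \<Phi>)"
    by (rule someI[of ?P])
  moreover have "white_map V W = (SOME \<Phi>. ?P \<Phi>)"
    by (rule white_map_def)
  ultimately have "?P (white_map V W)"
    by simp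
  then have \<Phi>: "operad_hom (free_operad ?T) (hadamard FV FW) (white_map V W)"
    and gen: "\<And>v w. v \<in> carrier V \<Longrightarrow> w \<in> carrier W \<Longrightarrow>
      white_map V W 2 (free_gen ?T (tensor_class V W (mono (v, w)))) =
      white 2 (free_gen ?T (tensor_class V W (mono (v, w))))"
    by (auto simp: white_free_gen simp flip: pure_tensor_eq)
  show ?thesis
  proof (rule VW.operad_hom_eq_3[OF \<Phi> operad_hom_white _ _ x])
    fix y assume "y \<in> carrier ?T"
    then obtain p where p: "Poly_Mapping.keys p \<subseteq> carrier V \<times> carrier W" "y = tensor_class V W p"
      by (auto simp: carrier_tensor)
    have "vlinear (tensor V W) (ar (free_operad ?T) 2) (free_gen ?T)"
      using VW.vlinear_free_gen by (simp add: vlinear_def)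
    from vlinear_comp[OF vlinear_tensor_class this]
    have lin: "vlinear (free_vspace (carrier V \<times> carrier W)) (tensor (ar FV 2) (ar FW 2))
        (\<lambda>p. \<chi> 2 (free_gen ?T (tensor_class V W p)))"
      if "operad_hom (free_operad ?T) (hadamard FV FW) \<chi>" for \<chi>
      using vlinear_comp[OF _ operad_homD(1)[OF that, of 2]] unfolding tensor_free_def by auto
    show "white_map V W 2 (free_gen ?T y) = white 2 (free_gen ?T y)"
      unfolding p(2) using gen
      by (intro vlinear_free_eq[OF lin[OF \<Phi>] lin[OF operad_hom_white] _ _ p(1)]) auto
  qed simp
qed

subsection \<open>Kernels of tensor products of functionals\<close>

lemma trivial_module_simps [simp]:
  "carrier trivial_module = UNIV" "vzero trivial_module = 0" "vadd trivial_module = (+)"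
  "vscale trivial_module = (*)" "swap trivial_module = (\<lambda>x. x)"
  by (simp_all add: trivial_module_def)

lemma vector_space_trivial [simp]: "vector_space_on (trivial_module :: ('k::field, 'k) s2_module)"
  unfolding vector_space_on_def by (auto simp: algebra_simps)

context tensor_pair
begin

lemma pure_tensor_mem [simp]:
  "v \<in> carrier V \<Longrightarrow> w \<in> carrier W \<Longrightarrow> pure_tensor V W v w \<in> carrier (tensor V W)"
  by (simp add: pure_tensor_eq)

lemma pure_tensor_bilinear:
  "v \<in> carrier V \<Longrightarrow> v' \<in> carrier V \<Longrightarrow> w \<in> carrier W \<Longrightarrow>
    pure_tensor V W (vadd V v v') w = vadd (tensor V W) (pure_tensor V W v w) (pure_tensor V W v' w)"
  "v \<in> carrier V \<Longrightarrow> w \<in> carrier W \<Longrightarrow> w' \<in> carrier W \<Longrightarrow>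
    pure_tensor V W v (vadd W w w') = vadd (tensor V W) (pure_tensor V W v w) (pure_tensor V W v w')"
  "v \<in> carrier V \<Longrightarrow> w \<in> carrier W \<Longrightarrow>
    pure_tensor V W (vscale V c v) w = vscale (tensor V W) c (pure_tensor V W v w)"
  "v \<in> carrier V \<Longrightarrow> w \<in> carrier W \<Longrightarrow>
    pure_tensor V W v (vscale W c w) = vscale (tensor V W) c (pure_tensor V W v w)"
  unfolding pure_tensor_eq using tensor_null_intros[of v]
  by (simp_all add: tensor_class_add tensor_class_scale tensor_class_eq_iff keys_add_subset diff_diff_eq
      del: keys_single)

lemma ev_tensor_null:
  assumes l: "vlinear V trivial_module l" and e: "vlinear W trivial_module e" and p: "p \<in> tensor_null V W"
  shows "ev (\<lambda>(a, b). l a * e b) p = 0"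
  using vlinearD[OF l] vlinearD[OF e] p by (intro tensor_null_ev) (auto simp: algebra_simps)

lemma tensor_functional:
  assumes l: "vlinear V trivial_module l" and e: "vlinear W trivial_module e"
  obtains h where "vlinear (tensor V W) trivial_module h"
    and "\<And>p. Poly_Mapping.keys p \<subseteq> carrier V \<times> carrier W \<Longrightarrow>
      h (tensor_class V W p) = ev (\<lambda>(a, b). l a * e b) p"
proof
  let ?h = "\<lambda>x. ev (\<lambda>(a, b). l a * e b) (tensor_rep V W x)"
  show h: "?h (tensor_class V W p) = ev (\<lambda>(a, b). l a * e b) p"
    if "Poly_Mapping.keys p \<subseteq> carrier V \<times> carrier W" for p
    using ev_tensor_null[OF l e tensor_rep_class[OF that]] by (simp add: ev_diff)
  have "vlinear (tensor_free V W) trivial_module (ev (\<lambda>(a, b). l a * e b))"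
    by (auto simp: vlinear_def ev_add ev_pscale)
  then show "vlinear (tensor V W) trivial_module ?h"
    unfolding tensor_def by (rule vlinear_vquot) (simp_all add: h flip: tensor_class_def)
qed

end

lemma tensor_kernel:
  assumes A: "vector_space_on A" and B: "vector_space_on B"
    and L: "\<And>l. l \<in> L \<Longrightarrow> vlinear A trivial_module l" and e: "vlinear B trivial_module e"
    and b0: "b0 \<in> carrier B" "e b0 = 1"
    and R: "R = {a \<in> carrier A. \<forall>l\<in>L. l a = 0}" and S: "S = {b \<in> carrier B. e b = 0}"
    and p: "Poly_Mapping.keys p \<subseteq> carrier A \<times> carrier B"
  shows "(\<exists>y\<in>tensor_sub A B R (carrier B). \<exists>z\<in>tensor_sub A B (carrier A) S.
      tensor_class A B p = vadd (tensor A B) y z) \<longleftrightarrow> (\<forall>l\<in>L. ev (\<lambda>(a, b). l a * e b) p = 0)"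
proof -
  interpret A: vsp A by (simp add: vsp_iff A)
  interpret B: vsp B by (simp add: vsp_iff B)
  interpret tensor_pair A B
    by (simp add: tensor_pair_def vclosed_vector_space A B)
  interpret T: vsp "tensor A B" by (simp add: vsp_iff)
  let ?pure = "pure_tensor A B"
  define Y Z where "Y = tensor_sub A B R (carrier B)" and "Z = tensor_sub A B (carrier A) S"
  have sub: "vsubspace (tensor A B) (tensor_sub A B A' B')" if "A' \<subseteq> carrier A" "B' \<subseteq> carrier B" for A' B'
    unfolding tensor_sub_def using that pure_tensor_mem by (intro vsubspace_vspan vector_space_tensor) blast
  have Y: "vsubspace (tensor A B) Y" and Z: "vsubspace (tensor A B) Z"
    unfolding Y_def Z_def R S by (auto intro!: sub)
  have pure_sub: "?pure a b \<in> tensor_sub A B A' B'" if "a \<in> A'" "b \<in> B'" for a b A' B'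
    unfolding tensor_sub_def using that by (intro subsetD[OF vspan_superset]) auto
  have vanish: "h y = 0" if h: "vlinear (tensor A B) trivial_module h"
      "\<And>a b. a \<in> A' \<Longrightarrow> b \<in> B' \<Longrightarrow> h (?pure a b) = 0"
    and AB: "A' \<subseteq> carrier A" "B' \<subseteq> carrier B" and y: "y \<in> tensor_sub A B A' B'" for h A' B' y
  proof -
    have "h ` tensor_sub A B A' B' \<subseteq> {0}"
      unfolding tensor_sub_def using h(2) AB
      by (intro vspan_image_subset[OF h(1)]) (auto simp: vsubspace_def intro!: pure_tensor_mem)
    then show ?thesis
      using y by auto
  qed
  have YZ_vanish: "h y = 0" "h z = 0" if l: "l \<in> L" and h: "vlinear (tensor A B) trivial_module h"
      "\<And>p. Poly_Mapping.keys p \<subseteq> carrier A \<times> carrier B \<Longrightarrow> h (tensor_class A B p) = ev (\<lambda>(a, b). l a * e b) p"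
    and y: "y \<in> Y" and z: "z \<in> Z" for h l y z
  proof -
    have pure: "h (?pure a b) = l a * e b" if "a \<in> carrier A" "b \<in> carrier B" for a b
      using that by (simp add: pure_tensor_eq h(2))
    show "h y = 0"
      by (rule vanish[OF h(1) _ _ _ y[unfolded Y_def]]) (use l pure in \<open>auto simp: R\<close>)
    show "h z = 0"
      by (rule vanish[OF h(1) _ _ _ z[unfolded Z_def]]) (use pure in \<open>auto simp: S\<close>)
  qed
  have decomp: "\<exists>a\<in>carrier A. \<exists>z\<in>Z. tensor_class A B p = vadd (tensor A B) (?pure a b0) z"
  proof -
    let ?N = "{p. Poly_Mapping.keys p \<subseteq> carrier A \<times> carrier B \<and>
      (\<exists>a\<in>carrier A. \<exists>z\<in>Z. tensor_class A B p = vadd (tensor A B) (?pure a b0) z)}"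
    note Zc = vsubspaceD(1)[OF Z, THEN subsetD]
    have "vsubspace (free_vspace (carrier A \<times> carrier B)) ?N"
      unfolding vsubspace_def
    proof (intro conjI ballI allI)
      have "?pure (vzero A) b0 = vzero (tensor A B)"
        using pure_tensor_bilinear(3)[of "vzero A" b0 0] b0 by simp
      moreover have "tensor_class A B 0 = vzero (tensor A B)"
        by (simp add: tensor_def tensor_class_def)
      ultimately show "vzero (free_vspace (carrier A \<times> carrier B)) \<in> ?N"
        using vsubspaceD(2)[OF Z] by (auto intro!: bexI[of _ "vzero A"] bexI[of _ "vzero (tensor A B)"])
    next
      fix p q assume "p \<in> ?N" "q \<in> ?N"
      then obtain a z a' z' where *: "Poly_Mapping.keys p \<subseteq> carrier A \<times> carrier B" "a \<in> carrier A" "z \<in> Z"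
          "tensor_class A B p = vadd (tensor A B) (?pure a b0) z"
          "Poly_Mapping.keys q \<subseteq> carrier A \<times> carrier B" "a' \<in> carrier A" "z' \<in> Z"
          "tensor_class A B q = vadd (tensor A B) (?pure a' b0) z'"
        by blast
      have "tensor_class A B (p + q) = vadd (tensor A B) (?pure (vadd A a a') b0) (vadd (tensor A B) z z')"
        unfolding tensor_class_add[OF *(1,5), symmetric] *(4,8)
        using * b0 Zc by (simp add: T.add_ac pure_tensor_bilinear)
      moreover have "vadd A a a' \<in> carrier A" "vadd (tensor A B) z z' \<in> Z"
          "Poly_Mapping.keys (p + q) \<subseteq> carrier A \<times> carrier B"
        using * vsubspaceD(3)[OF Z] by (simp_all add: keys_add_subset)
      ultimately show "vadd (free_vspace (carrier A \<times> carrier B)) p q \<in> ?N"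
        unfolding free_vspace_simps by blast
    next
      fix c p assume "p \<in> ?N"
      then obtain a z where *: "Poly_Mapping.keys p \<subseteq> carrier A \<times> carrier B" "a \<in> carrier A" "z \<in> Z"
          "tensor_class A B p = vadd (tensor A B) (?pure a b0) z"
        by blast
      have "tensor_class A B (pscale c p) = vadd (tensor A B) (?pure (vscale A c a) b0) (vscale (tensor A B) c z)"
        unfolding tensor_class_scale[OF *(1), symmetric] *(4)
        using * b0 Zc by (simp add: T.scale_add pure_tensor_bilinear)
      moreover have "vscale A c a \<in> carrier A" "vscale (tensor A B) c z \<in> Z"
          "Poly_Mapping.keys (pscale c p) \<subseteq> carrier A \<times> carrier B"
        using * vsubspaceD(4)[OF Z] by (simp_all add: keys_add_subset)
      ultimately show "vscale (free_vspace (carrier A \<times> carrier B)) c p \<in> ?N"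
        unfolding free_vspace_simps by blast
    qed auto
    then have "p \<in> ?N"
    proof (rule free_eq_sum_mono)
      fix x assume "x \<in> Poly_Mapping.keys p"
      then obtain a b where x: "x = (a, b)" and ab: "a \<in> carrier A" "b \<in> carrier B"
        using p by auto
      define b' where "b' = vadd B b (vscale B (- e b) b0)"
      have b': "b' \<in> carrier B" "e b' = 0" "b = vadd B (vscale B (e b) b0) b'"
        using ab b0 vlinearD[OF e]
        by (simp_all add: b'_def B.add_left_commute[of _ b] flip: B.scale_add_left)
      then have "?pure a b' \<in> Z"
        unfolding Z_def using ab by (intro pure_sub) (auto simp: S)
      moreover have "?pure a b = vadd (tensor A B) (?pure (vscale A (e b) a) b0) (?pure a b')"
        by (subst b'(3)) (use ab b0 b'(1) in \<open>simp add: pure_tensor_bilinear\<close>)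
      ultimately show "mono x \<in> ?N"
        unfolding pure_tensor_eq[of A B a b] using ab b0 by (auto simp: x)
    qed
    then show ?thesis by blast
  qed
  show ?thesis
    unfolding Y_def[symmetric] Z_def[symmetric]
  proof (intro iffI ballI)
    fix l assume "\<exists>y\<in>Y. \<exists>z\<in>Z. tensor_class A B p = vadd (tensor A B) y z" and l: "l \<in> L"
    then obtain y z where yz: "y \<in> Y" "z \<in> Z" "tensor_class A B p = vadd (tensor A B) y z" by blast
    obtain h where h: "vlinear (tensor A B) trivial_module h"
        "\<And>p. Poly_Mapping.keys p \<subseteq> carrier A \<times> carrier B \<Longrightarrow> h (tensor_class A B p) = ev (\<lambda>(a, b). l a * e b) p"
      using tensor_functional[OF L[OF l] e] by blast
    have "h (tensor_class A B p) = 0"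
      using yz(3) YZ_vanish[OF l h yz(1,2)] vlinearD(2)[OF h(1)]
        subsetD[OF vsubspaceD(1)[OF Y] yz(1)] subsetD[OF vsubspaceD(1)[OF Z] yz(2)] by simp
    then show "ev (\<lambda>(a, b). l a * e b) p = 0"
      using h(2)[OF p] by simp
  next
    assume *: "\<forall>l\<in>L. ev (\<lambda>(a, b). l a * e b) p = 0"
    obtain a z where az: "a \<in> carrier A" "z \<in> Z" "tensor_class A B p = vadd (tensor A B) (?pure a b0) z"
      using decomp by blast
    have "l a = 0" if l: "l \<in> L" for l
    proof -
      obtain h where h: "vlinear (tensor A B) trivial_module h"
          "\<And>p. Poly_Mapping.keys p \<subseteq> carrier A \<times> carrier B \<Longrightarrow> h (tensor_class A B p) = ev (\<lambda>(a, b). l a * e b) p"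
        using tensor_functional[OF L[OF l] e] by blast
      have "h (tensor_class A B p) = h (?pure a b0)"
        using az YZ_vanish(2)[OF l h vsubspaceD(2)[OF Y] az(2)] vlinearD(2)[OF h(1), of "?pure a b0" z]
          subsetD[OF vsubspaceD(1)[OF Z] az(2)] b0 by simp
      then show ?thesis
        using * l h(2)[OF p] az(1) b0 by (simp add: pure_tensor_eq h(2))
    qed
    then have "?pure a b0 \<in> Y"
      unfolding Y_def using az(1) b0 by (intro pure_sub) (auto simp: R)
    then show "\<exists>y\<in>Y. \<exists>z\<in>Z. tensor_class A B p = vadd (tensor A B) y z"
      using az by blast
  qed
qed

section \<open>Multilinear functionals on trees\<close>

lemma pscale_zero [simp]: "pscale c 0 = 0"
  by (rule poly_mapping_eqI) simp

definition tree_functional :: "('k::field, 'v) s2_module \<Rightarrow> nat \<Rightarrow> ('v tree \<Rightarrow> 'k) \<Rightarrow> bool" where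
  "tree_functional V n \<kappa> \<longleftrightarrow>
     (\<forall>C\<in>tree_contexts. \<forall>v\<in>carrier V. \<forall>l r. C (Node v l r) \<in> trees V n \<longrightarrow>
       (\<forall>v'\<in>carrier V. \<kappa> (C (Node (vadd V v v') l r)) = \<kappa> (C (Node v l r)) + \<kappa> (C (Node v' l r))) \<and>
       (\<forall>c. \<kappa> (C (Node (vscale V c v) l r)) = c * \<kappa> (C (Node v l r))) \<and>
       \<kappa> (C (Node (swap V v) l r)) = \<kappa> (C (Node v r l)))"

definition class_val :: "('v tree \<Rightarrow> 'k::field) \<Rightarrow> ('v tree \<Rightarrow>\<^sub>0 'k) set \<Rightarrow> 'k" where
  "class_val \<kappa> X = ev \<kappa> (rep X)"

context s2_mod
begin

lemma ev_tree_null: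
  assumes \<kappa>: "tree_functional V n \<kappa>" and p: "p \<in> tree_null V n"
  shows "ev \<kappa> p = 0"
proof -
  let ?h = "\<lambda>t. Poly_Mapping.single () (\<kappa> t)"
  have "lin ?h p \<in> {0}"
    using p
  proof (rule tree_null_lin[where X = UNIV, rotated 5])
    show "vsubspace (free_vspace UNIV) {0 :: unit \<Rightarrow>\<^sub>0 'k}"
      by (auto simp: vsubspace_def)
  qed (use \<kappa> in \<open>auto simp: tree_functional_def single_add intro!: poly_mapping_eqI\<close>)
  then have "Poly_Mapping.lookup (lin ?h p) () = 0"
    by simp
  then show ?thesis
    by (simp add: lookup_lin)
qed

lemma class_val_class:
  assumes \<kappa>: "tree_functional V n \<kappa>" and p: "Poly_Mapping.keys p \<subseteq> trees V n"
  shows "class_val \<kappa> (tree_class V n p) = ev \<kappa> p"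
proof -
  have "rep (tree_class V n p) - p \<in> tree_null V n"
    using mem_tree_class[OF p rep_mem[OF tree_class_nonempty[OF p]]] by simp
  from ev_tree_null[OF \<kappa> this] show ?thesis
    by (simp add: class_val_def ev_diff)
qed

lemma vlinear_class_val:
  assumes \<kappa>: "tree_functional V n \<kappa>"
  shows "vlinear (ar (free_operad V) n) trivial_module (class_val \<kappa>)"
proof -
  have "vlinear (tree_free V n) trivial_module (ev \<kappa>)"
    by (auto simp: vlinear_def ev_add ev_pscale)
  then show ?thesis
    unfolding ar_free_operad by (rule vlinear_vquot) (simp_all add: class_val_class[OF \<kappa>] flip: tree_class_def)
qed

end

text \<open>The coefficient of the word \<open>w\<close> after substituting \<open>a v \<cdot> l r + b v \<cdot> r l\<close>, in the free
  associative algebra, for each vertex \<open>v (l, r)\<close>.\<close>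

primrec coef :: "('v \<Rightarrow> 'k::field) \<Rightarrow> ('v \<Rightarrow> 'k) \<Rightarrow> 'v tree \<Rightarrow> nat list \<Rightarrow> 'k" where
  "coef a b (Leaf k) w = (if w = [k] then 1 else 0)"
| "coef a b (Node v l r) w =
     a v * coef a b l (take (length (leaves l)) w) * coef a b r (drop (length (leaves l)) w) +
     b v * coef a b l (drop (length (leaves r)) w) * coef a b r (take (length (leaves r)) w)"

primrec label_prod :: "('v \<Rightarrow> 'k::field) \<Rightarrow> 'v tree \<Rightarrow> 'k" where
  "label_prod e (Leaf k) = 1"
| "label_prod e (Node v l r) = e v * label_prod e l * label_prod e r"

lemma context_length:
  "C \<in> tree_contexts \<Longrightarrow> length (leaves t) = length (leaves u) \<Longrightarrow>
    length (leaves (C t)) = length (leaves (C u))"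
  using context_leaves[of C] by fastforce

lemma coef_context:
  assumes len: "length (leaves t) = length (leaves u)" "length (leaves t) = length (leaves u')"
    and t: "\<And>w. coef a b t w = c * coef a b u w + d * coef a b u' w"
  shows "C \<in> tree_contexts \<Longrightarrow> coef a b (C t) w = c * coef a b (C u) w + d * coef a b (C u') w"
proof (induction arbitrary: w rule: tree_contexts.induct)
  case (2 C v r)
  then show ?case
    using context_length[OF 2(1) len(1)] context_length[OF 2(1) len(2)] by (simp add: algebra_simps)
next
  case (3 C v l)
  then show ?case
    using context_length[OF 3(1) len(1)] context_length[OF 3(1) len(2)] by (simp add: algebra_simps)
qed (rule t)

lemma label_prod_context:
  assumes t: "label_prod e t = c * label_prod e u + d * label_prod e u'"
  shows "C \<in> tree_contexts \<Longrightarrow> label_prod e (C t) = c * label_prod e (C u) + d * label_prod e (C u')"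
  by (induction rule: tree_contexts.induct) (simp_all add: t algebra_simps)

lemma tree_functional_coef:
  fixes V :: "('k::field, 'v) s2_module"
  assumes a: "vlinear V trivial_module a" and b: "vlinear V trivial_module b"
    and swap: "\<And>v. v \<in> carrier V \<Longrightarrow> a (swap V v) = b v" "\<And>v. v \<in> carrier V \<Longrightarrow> b (swap V v) = a v"
  shows "tree_functional V n (\<lambda>t. coef a b t w)"
  unfolding tree_functional_def
proof (intro ballI allI impI conjI)
  fix C :: "'v tree \<Rightarrow> 'v tree" and v l r assume C: "C \<in> tree_contexts" and v: "v \<in> carrier V"
  note lin = vlinearD[OF a] vlinearD[OF b]
  show "coef a b (C (Node (vadd V v v') l r)) w = coef a b (C (Node v l r)) w + coef a b (C (Node v' l r)) w"
    if "v' \<in> carrier V" for v'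
    using coef_context[of "Node (vadd V v v') l r" "Node v l r" "Node v' l r" a b 1 1 C w] C v that
    by (simp add: lin algebra_simps)
  show "coef a b (C (Node (vscale V c v) l r)) w = c * coef a b (C (Node v l r)) w" for c
    using coef_context[of "Node (vscale V c v) l r" "Node v l r" "Node v l r" a b c 0 C w] C v
    by (simp add: lin algebra_simps)
  show "coef a b (C (Node (swap V v) l r)) w = coef a b (C (Node v r l)) w"
    using coef_context[of "Node (swap V v) l r" "Node v r l" "Node v r l" a b 1 0 C w] C v
    by (simp add: swap algebra_simps)
qed

lemma tree_functional_label_prod:
  fixes V :: "('k::field, 'v) s2_module"
  assumes e: "vlinear V trivial_module e" and swap: "\<And>v. v \<in> carrier V \<Longrightarrow> e (swap V v) = e v"
  shows "tree_functional V n (label_prod e)"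
  unfolding tree_functional_def
proof (intro ballI allI impI conjI)
  fix C :: "'v tree \<Rightarrow> 'v tree" and v l r assume C: "C \<in> tree_contexts" and v: "v \<in> carrier V"
  note lin = vlinearD[OF e]
  show "label_prod e (C (Node (vadd V v v') l r)) = label_prod e (C (Node v l r)) + label_prod e (C (Node v' l r))"
    if "v' \<in> carrier V" for v'
    using label_prod_context[of e "Node (vadd V v v') l r" 1 "Node v l r" 1 "Node v' l r" C] C v that
    by (simp add: lin algebra_simps)
  show "label_prod e (C (Node (vscale V c v) l r)) = c * label_prod e (C (Node v l r))" for c
    using label_prod_context[of e "Node (vscale V c v) l r" c "Node v l r" 0 "Node v l r" C] C v
    by (simp add: lin algebra_simps)
  show "label_prod e (C (Node (swap V v) l r)) = label_prod e (C (Node v r l))"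
    using label_prod_context[of e "Node (swap V v) l r" 1 "Node v r l" 0 "Node v r l" C] C v
    by (simp add: swap algebra_simps)
qed

lemma ev_expand_coef:
  assumes \<rho>: "\<And>x. Poly_Mapping.keys (\<rho> x) \<subseteq> A \<times> B"
  shows "ev (\<lambda>y. coef a b (fst y) w * label_prod e (snd y)) (expand \<rho> t) =
    coef (\<lambda>x. ev (\<lambda>y. a (fst y) * e (snd y)) (\<rho> x)) (\<lambda>x. ev (\<lambda>y. b (fst y) * e (snd y)) (\<rho> x)) t w"
proof (induction t arbitrary: w)
  case (Node x l r)
  let ?m = "length (leaves l)" and ?n = "length (leaves r)"
  have leaf: "leaves (fst y) = leaves t" if "y \<in> Poly_Mapping.keys (expand \<rho> t)" for y t
    using subsetD[OF keys_expand[OF \<rho>] that] by simp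
  have "ev (\<lambda>y. coef a b (fst y) w * label_prod e (snd y)) (expand \<rho> (Node x l r)) =
    ev (\<lambda>v. ev (\<lambda>y. ev (\<lambda>z.
      (a (fst v) * e (snd v)) * (coef a b (fst y) (take ?m w) * label_prod e (snd y)) *
        (coef a b (fst z) (drop ?m w) * label_prod e (snd z)) +
      (b (fst v) * e (snd v)) * (coef a b (fst y) (drop ?n w) * label_prod e (snd y)) *
        (coef a b (fst z) (take ?n w) * label_prod e (snd z)))
      (expand \<rho> r)) (expand \<rho> l)) (\<rho> x)"
    unfolding expand.simps ev_lin ev_mono
    by (intro ev_cong) (simp add: leaf algebra_simps)
  also have "\<dots> = coef (\<lambda>x. ev (\<lambda>y. a (fst y) * e (snd y)) (\<rho> x))
      (\<lambda>x. ev (\<lambda>y. b (fst y) * e (snd y)) (\<rho> x)) (Node x l r) w"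
    unfolding coef.simps Node.IH[symmetric] ev_fun_add ev_fun_scale ev_fun_scale_right ..
  finally show ?case .
qed simp

lemma ev_expand_label_prod:
  "ev (\<lambda>y. label_prod a (fst y) * label_prod e (snd y)) (expand \<rho> t) =
    label_prod (\<lambda>x. ev (\<lambda>y. a (fst y) * e (snd y)) (\<rho> x)) t"
proof (induction t)
  case (Node x l r)
  have "ev (\<lambda>y. label_prod a (fst y) * label_prod e (snd y)) (expand \<rho> (Node x l r)) =
    ev (\<lambda>v. ev (\<lambda>y. ev (\<lambda>z. (a (fst v) * e (snd v)) * (label_prod a (fst y) * label_prod e (snd y)) *
        (label_prod a (fst z) * label_prod e (snd z))) (expand \<rho> r)) (expand \<rho> l)) (\<rho> x)"
    unfolding expand.simps ev_lin ev_mono by (intro ev_cong) (simp add: algebra_simps)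
  also have "\<dots> = label_prod (\<lambda>x. ev (\<lambda>y. a (fst y) * e (snd y)) (\<rho> x)) (Node x l r)"
    unfolding label_prod.simps Node.IH[symmetric] ev_fun_scale ev_fun_scale_right ..
  finally show ?case .
qed simp

lemma coef_map_tree: "coef a b (map_tree f t) w = coef (\<lambda>v. a (f v)) (\<lambda>v. b (f v)) t w"
  by (induction t arbitrary: w) simp_all

lemma label_prod_map_tree: "label_prod e (map_tree f t) = label_prod (\<lambda>v. e (f v)) t"
  by (induction t) simp_all

section \<open>Relations as common kernels\<close>

definition common_kernel ::
    "('k::field, 'v) s2_module \<Rightarrow> ('v tree \<Rightarrow> 'k) set \<Rightarrow> ('v tree \<Rightarrow>\<^sub>0 'k) set set" where
  "common_kernel V L = {x \<in> carrier (ar (free_operad V) 3). \<forall>\<kappa>\<in>L. class_val \<kappa> x = 0}"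

context s2_mod
begin

lemma mem_common_kernel:
  "Poly_Mapping.keys p \<subseteq> trees V 3 \<Longrightarrow> (\<And>\<kappa>. \<kappa> \<in> L \<Longrightarrow> tree_functional V 3 \<kappa>) \<Longrightarrow>
    tree_class V 3 p \<in> common_kernel V L \<longleftrightarrow> (\<forall>\<kappa>\<in>L. ev \<kappa> p = 0)"
  by (simp add: common_kernel_def class_val_class)

lemma vsubspace_common_kernel:
  assumes "\<And>\<kappa>. \<kappa> \<in> L \<Longrightarrow> tree_functional V 3 \<kappa>"
  shows "vsubspace (ar (free_operad V) 3) (common_kernel V L)"
proof -
  interpret vsp "ar (free_operad V) 3" by (simp add: vsp_iff)
  show ?thesis
    using vlinearD(2,3)[OF vlinear_class_val[OF assms]] vlinear_zero[OF vlinear_class_val[OF assms]]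
    by (auto simp: vsubspace_def common_kernel_def)
qed

lemma lmono_trees [simp]:
  assumes "u \<in> carrier V" "v \<in> carrier V" "distinct [i, j, k]" "{i, j, k} = {1..3}"
  shows "Node v (Node u (Leaf i) (Leaf j)) (Leaf k) \<in> trees V 3"
    and "Node u (Leaf i) (Node v (Leaf j) (Leaf k)) \<in> trees V 3"
  using assms by (auto simp: trees_def)

lemma vlinear_lmono_rmono:
  assumes ijk: "distinct [i, j, k]" "{i, j, k} = {1..3}"
  shows "v \<in> carrier V \<Longrightarrow> vlinear V (ar (free_operad V) 3) (\<lambda>u. tree_class V 3 (lmono u v i j k))"
    and "u \<in> carrier V \<Longrightarrow> vlinear V (ar (free_operad V) 3) (\<lambda>v. tree_class V 3 (lmono u v i j k))"
    and "v \<in> carrier V \<Longrightarrow> vlinear V (ar (free_operad V) 3) (\<lambda>u. tree_class V 3 (rmono u v i j k))"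
    and "u \<in> carrier V \<Longrightarrow> vlinear V (ar (free_operad V) 3) (\<lambda>v. tree_class V 3 (rmono u v i j k))"
  unfolding vlinear_def lmono_def rmono_def
  using tree_class_label(1,2)[of "\<lambda>t. Node _ t (Leaf k)" _ "Leaf i" "Leaf j" 3]
    tree_class_label(1,2)[of "\<lambda>t. t" _ "Node _ (Leaf i) (Leaf j)" "Leaf k" 3]
    tree_class_label(1,2)[of "\<lambda>t. t" _ "Leaf i" "Node _ (Leaf j) (Leaf k)" 3]
    tree_class_label(1,2)[of "\<lambda>t. Node _ (Leaf i) t" _ "Leaf j" "Leaf k" 3]
    lmono_trees[OF _ _ ijk]
  by (auto simp: tree_contexts.intros)

lemma swap_lmono_rmono:
  assumes ijk: "distinct [i, j, k]" "{i, j, k} = {1..3}" and uv: "u \<in> carrier V" "v \<in> carrier V"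
  shows "tree_class V 3 (lmono (swap V u) v i j k) = tree_class V 3 (lmono u v j i k)"
    and "tree_class V 3 (lmono u (swap V v) i j k) = tree_class V 3 (rmono v u k i j)"
    and "tree_class V 3 (rmono (swap V u) v i j k) = tree_class V 3 (lmono v u j k i)"
    and "tree_class V 3 (rmono u (swap V v) i j k) = tree_class V 3 (rmono u v i k j)"
  unfolding lmono_def rmono_def
  using lmono_trees[OF _ _ ijk] uv
  by (simp_all add: tree_contexts.intros
      tree_class_label(3)[of "\<lambda>t. Node v t (Leaf k)" u "Leaf i" "Leaf j"]
      tree_class_label(3)[of "\<lambda>t. t" v "Node u (Leaf i) (Leaf j)" "Leaf k"]
      tree_class_label(3)[of "\<lambda>t. t" u "Leaf i" "Node v (Leaf j) (Leaf k)"]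
      tree_class_label(3)[of "\<lambda>t. Node u (Leaf i) t" v "Leaf j" "Leaf k"])

lemma arity_3_induct:
  assumes V: "vector_space_on V" and M: "M \<subseteq> carrier V" and span: "carrier V = vspan V (M \<union> swap V ` M)"
    and N: "vsubspace (ar (free_operad V) 3) N"
    and lr: "\<And>u v i j k. u \<in> M \<Longrightarrow> v \<in> M \<Longrightarrow> distinct [i, j, k] \<Longrightarrow> {i, j, k} = {1..3} \<Longrightarrow>
      tree_class V 3 (lmono u v i j k) \<in> N \<and> tree_class V 3 (rmono u v i j k) \<in> N"
    and x: "x \<in> carrier (ar (free_operad V) 3)"
  shows "x \<in> N"
proof -
  define P where "P u v \<longleftrightarrow> (\<forall>i j k. distinct [i, j, k] \<longrightarrow> {i, j, k} = {1..3} \<longrightarrow>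
    tree_class V 3 (lmono u v i j k) \<in> N \<and> tree_class V 3 (rmono u v i j k) \<in> N)" for u v
  note sw = s2_closedD(3)[OF closed]
  have P_swap: "P (swap V u) v \<and> P v (swap V u)" if "P u v" "P v u" "u \<in> carrier V" "v \<in> carrier V" for u v
    unfolding P_def
  proof (intro conjI allI impI)
    fix i j k assume ijk: "distinct [i, j, k]" "{i, j, k} = {1..3::nat}"
    then have perm: "distinct [j, i, k]" "{j, i, k} = {1..3}" "distinct [k, i, j]" "{k, i, j} = {1..3}"
      "distinct [j, k, i]" "{j, k, i} = {1..3}" "distinct [i, k, j]" "{i, k, j} = {1..3}"
      by auto
    show "tree_class V 3 (lmono (swap V u) v i j k) \<in> N" "tree_class V 3 (rmono (swap V u) v i j k) \<in> N"
      "tree_class V 3 (lmono v (swap V u) i j k) \<in> N" "tree_class V 3 (rmono v (swap V u) i j k) \<in> N"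
      using that perm unfolding P_def by (simp_all add: swap_lmono_rmono[OF ijk])
  qed
  have P_M: "P u v" if "u \<in> M" "v \<in> M" for u v
    using lr that unfolding P_def by blast
  have P1: "P u v \<and> P v u" if "u \<in> M \<union> swap V ` M" "v \<in> M" for u v
    using that P_swap P_M M by blast
  have P2: "P u v" if "u \<in> M \<union> swap V ` M" "v \<in> M \<union> swap V ` M" for u v
    using that P_swap P1 M sw by blast
  have sub: "vsubspace V {u \<in> carrier V. f u \<in> N}" if "vlinear V (ar (free_operad V) 3) f" for f
    using that by (rule vsubspace_vimage[OF _ V vector_space_ar_free N])
  have P_span: "P u v" if uv: "u \<in> carrier V" "v \<in> carrier V" for u v
    unfolding P_def
  proof (intro allI impI)
    fix i j k assume ijk: "distinct [i, j, k]" "{i, j, k} = {1..3::nat}"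
    have MM: "M \<union> swap V ` M \<subseteq> carrier V"
      using M sw by blast
    have "tree_class V 3 (lmono u v i j k) \<in> N \<and> tree_class V 3 (rmono u v i j k) \<in> N"
      if v: "v \<in> M \<union> swap V ` M" for v
      using vspan_least[OF sub[OF vlinear_lmono_rmono(1)[OF ijk]], of v "M \<union> swap V ` M"]
        vspan_least[OF sub[OF vlinear_lmono_rmono(3)[OF ijk]], of v "M \<union> swap V ` M"] v MM P2[OF _ v] ijk uv(1)
      unfolding P_def span[symmetric] by blast
    then show "tree_class V 3 (lmono u v i j k) \<in> N \<and> tree_class V 3 (rmono u v i j k) \<in> N"
      using vspan_least[OF sub[OF vlinear_lmono_rmono(2)[OF ijk]], of u "M \<union> swap V ` M"]
        vspan_least[OF sub[OF vlinear_lmono_rmono(4)[OF ijk]], of u "M \<union> swap V ` M"] MM uv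
      unfolding span[symmetric] by blast
  qed
  obtain p where p: "Poly_Mapping.keys p \<subseteq> trees V 3" "x = tree_class V 3 p"
    using x by (auto simp: carrier_ar_free)
  have "vsubspace (free_vspace (trees V 3)) {p \<in> carrier (tree_free V 3). tree_class V 3 p \<in> N}"
    using vsubspace_vimage[OF vlinear_tree_class _ _ N] by (simp add: tree_free_def)
  moreover have "tree_class V 3 (mono t) \<in> N" if "t \<in> trees V 3" for t
    using that
  proof (cases rule: trees_3_cases)
    case (left u v i j k)
    then show ?thesis using P_span[of u v] unfolding P_def lmono_def by blast
  next
    case (right u v i j k)
    then show ?thesis using P_span[of u v] unfolding P_def rmono_def by blast
  qed
  ultimately have "p \<in> {p \<in> carrier (tree_free V 3). tree_class V 3 p \<in> N}"
    using p(1) by (elim free_eq_sum_mono) auto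
  then show ?thesis
    using p by simp
qed

lemma rels_presentation: "rels (presentation V S) = vspan (ar (free_operad V) 3)
    {act (free_operad V) 3 \<sigma> (tree_class V 3 s) | \<sigma> s. \<sigma> permutes {1..3} \<and> s \<in> S}"
  by (simp add: presentation_def)

lemma relation_mem:
  assumes "s \<in> S" "\<sigma> permutes {1..3}" "Poly_Mapping.keys s \<subseteq> trees V 3"
  shows "tree_class V 3 (push (relabel \<sigma>) s) \<in> rels (presentation V S)"
proof -
  have "tree_class V 3 (push (relabel \<sigma>) s) = act (free_operad V) 3 (inv \<sigma>) (tree_class V 3 s)"
    using assms act_free_operad[OF permutes_inv] by (simp add: permutes_inv_inv)
  then show ?thesis
    unfolding rels_presentation using assms permutes_inv
    by (intro subsetD[OF vspan_superset]) blast
qed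

lemma vsubspace_rels:
  assumes "\<And>s. s \<in> S \<Longrightarrow> Poly_Mapping.keys s \<subseteq> trees V 3"
  shows "vsubspace (ar (free_operad V) 3) (rels (presentation V S))"
  unfolding rels_presentation
  using assms vlinearD(1)[OF linear_operadD(2)[OF linear_operad_free]]
  by (intro vsubspace_vspan) auto

text \<open>The map \<open>\<nu>\<close> sends a tree to its normal form; the coefficients of the normal form are
  combinations of the functionals in \<open>L\<close>.\<close>

lemma rels_eq_common_kernel:
  assumes V: "vector_space_on V" and M: "M \<subseteq> carrier V" and span: "carrier V = vspan V (M \<union> swap V ` M)"
    and S: "\<And>s. s \<in> S \<Longrightarrow> Poly_Mapping.keys s \<subseteq> trees V 3"
    and L: "\<And>\<kappa>. \<kappa> \<in> L \<Longrightarrow> tree_functional V 3 \<kappa>"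
    and vanish: "\<And>\<kappa> \<sigma> s. \<kappa> \<in> L \<Longrightarrow> \<sigma> permutes {1..3} \<Longrightarrow> s \<in> S \<Longrightarrow> ev (\<lambda>t. \<kappa> (relabel \<sigma> t)) s = 0"
    and keys: "\<And>t. Poly_Mapping.keys (\<nu> t) \<subseteq> trees V 3"
    and \<nu>: "\<And>p. (\<And>\<kappa>. \<kappa> \<in> L \<Longrightarrow> ev \<kappa> p = 0) \<Longrightarrow> lin \<nu> p = 0"
    and red: "\<And>u v i j k. u \<in> M \<Longrightarrow> v \<in> M \<Longrightarrow> distinct [i, j, k] \<Longrightarrow> {i, j, k} = {1..3} \<Longrightarrow>
      tree_class V 3 (lmono u v i j k - lin \<nu> (lmono u v i j k)) \<in> rels (presentation V S) \<and>
      tree_class V 3 (rmono u v i j k - lin \<nu> (rmono u v i j k)) \<in> rels (presentation V S)"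
  shows "rels (presentation V S) = common_kernel V L"
proof
  let ?R = "rels (presentation V S)"
  note R = vsubspace_rels[OF S]
  have "act (free_operad V) 3 \<sigma> (tree_class V 3 s) \<in> common_kernel V L"
    if \<sigma>: "\<sigma> permutes {1..3}" and s: "s \<in> S" for \<sigma> s
  proof -
    have "Poly_Mapping.keys (push (relabel (inv \<sigma>)) s) \<subseteq> trees V 3"
      using S[OF s] relabel_trees[OF permutes_inv[OF \<sigma>]] by (intro keys_push) auto
    then show ?thesis
      using mem_common_kernel[OF _ L] vanish[OF _ permutes_inv[OF \<sigma>] s]
      by (simp add: act_free_operad[OF \<sigma> S[OF s]] ev_push)
  qed
  then show "?R \<subseteq> common_kernel V L"
    unfolding rels_presentation by (intro vspan_least[OF vsubspace_common_kernel[OF L]]) auto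
  define h where "h X = tree_class V 3 (rep X - lin \<nu> (rep X))" for X
  have null: "lin \<nu> p = 0" if "p \<in> tree_null V 3" for p
    using that ev_tree_null[OF L] by (intro \<nu>) auto
  have keys_lin: "Poly_Mapping.keys (p - lin \<nu> p) \<subseteq> trees V 3" if "Poly_Mapping.keys p \<subseteq> trees V 3" for p
    using that keys by (intro keys_add_subset keys_lin)
  have h: "h (tree_class V 3 p) = tree_class V 3 (p - lin \<nu> p)" if p: "Poly_Mapping.keys p \<subseteq> trees V 3" for p
  proof -
    let ?q = "rep (tree_class V 3 p)"
    have q: "Poly_Mapping.keys ?q \<subseteq> trees V 3" "?q - p \<in> tree_null V 3"
      using mem_tree_class[OF p rep_mem[OF tree_class_nonempty[OF p]]] by auto
    then have "lin \<nu> ?q = lin \<nu> p"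
      using null[OF q(2)] by (simp add: lin_diff)
    then show ?thesis
      unfolding h_def using q keys_lin[OF q(1)] keys_lin[OF p] by (simp add: tree_class_eq_iff)
  qed
  have "vlinear (tree_free V 3) (tree_free V 3) (\<lambda>p. p - lin \<nu> p)"
    using keys_lin unfolding vlinear_def
    by (auto simp: lin_add lin_pscale algebra_simps subset_iff intro!: poly_mapping_eqI simp: lookup_minus lookup_add)
  from vlinear_comp[OF this vlinear_tree_class]
  have "vlinear (ar (free_operad V) 3) (ar (free_operad V) 3) h"
    unfolding ar_free_operad[of 3]
    by (rule vlinear_vquot) (simp_all add: h flip: tree_class_def)
  then have N: "vsubspace (ar (free_operad V) 3) {x \<in> carrier (ar (free_operad V) 3). h x \<in> ?R}"
    by (rule vsubspace_vimage[OF _ _ _ R]) simp_all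
  show "common_kernel V L \<subseteq> ?R"
  proof
    fix x assume x: "x \<in> common_kernel V L"
    then obtain p where p: "Poly_Mapping.keys p \<subseteq> trees V 3" "x = tree_class V 3 p"
      by (auto simp: common_kernel_def carrier_ar_free)
    have "lin \<nu> p = 0"
      using x mem_common_kernel[OF p(1) L] p(2) by (intro \<nu>) auto
    then have "h x = x"
      using h p by simp
    moreover have "x \<in> {x \<in> carrier (ar (free_operad V) 3). h x \<in> ?R}"
    proof (rule arity_3_induct[OF V M span N])
      fix u v i j k assume uv: "u \<in> M" "v \<in> M" and ijk: "distinct [i, j, k]" "{i, j, k} = {1..3::nat}"
      have "Poly_Mapping.keys (lmono u v i j k :: _ \<Rightarrow>\<^sub>0 'k) \<subseteq> trees V 3"
        "Poly_Mapping.keys (rmono u v i j k :: _ \<Rightarrow>\<^sub>0 'k) \<subseteq> trees V 3"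
        unfolding lmono_def rmono_def using lmono_trees[OF _ _ ijk, of u v] uv M by auto
      then show "tree_class V 3 (lmono u v i j k) \<in> {x \<in> carrier (ar (free_operad V) 3). h x \<in> ?R} \<and>
          tree_class V 3 (rmono u v i j k) \<in> {x \<in> carrier (ar (free_operad V) 3). h x \<in> ?R}"
        using red[OF uv ijk] by (simp add: h)
    qed (use p in simp)
    ultimately show "x \<in> ?R" by simp
  qed
qed

end

section \<open>A criterion for white products\<close>

lemma (in s2_pair) rels_white_product:
  assumes D: "gens D = V" "rels D = common_kernel V L" and L: "\<And>\<kappa>. \<kappa> \<in> L \<Longrightarrow> tree_functional V 3 \<kappa>"
    and E: "gens E = W" "rels E = common_kernel W {\<epsilon>}" and \<epsilon>: "tree_functional W 3 \<epsilon>"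
    and b0: "Poly_Mapping.keys b0 \<subseteq> trees W 3" "ev \<epsilon> b0 = 1"
    and p: "Poly_Mapping.keys p \<subseteq> trees (s2_tensor V W) 3"
  shows "tree_class (s2_tensor V W) 3 p \<in> rels (white_product D E) \<longleftrightarrow>
    (\<forall>\<kappa>\<in>L. ev (\<lambda>t. ev (\<lambda>y. \<kappa> (fst y) * \<epsilon> (snd y)) (expand (tensor_rep V W) t)) p = 0)"
proof -
  let ?A = "ar FV 3" and ?B = "ar FW 3" and ?p = "lin (expand_class 3) p"
  have "tree_class (s2_tensor V W) 3 p \<in> rels (white_product D E) \<longleftrightarrow>
      (\<exists>y\<in>tensor_sub ?A ?B (common_kernel V L) (carrier ?B).
       \<exists>z\<in>tensor_sub ?A ?B (carrier ?A) (common_kernel W {\<epsilon>}).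
         tensor_class ?A ?B ?p = vadd (tensor ?A ?B) y z)"
    using p by (simp add: white_product_def Let_def D E white_map_3 white_class)
  also have "\<dots> \<longleftrightarrow> (\<forall>l\<in>class_val ` L. ev (\<lambda>(a, b). l a * class_val \<epsilon> b) ?p = 0)"
  proof (rule tensor_kernel[OF V.vector_space_ar_free W.vector_space_ar_free])
    show "vlinear ?B trivial_module (class_val \<epsilon>)"
      by (rule W.vlinear_class_val[OF \<epsilon>])
    show "tree_class W 3 b0 \<in> carrier ?B" "class_val \<epsilon> (tree_class W 3 b0) = 1"
      using b0 by (simp_all add: W.class_val_class[OF \<epsilon>])
    show "Poly_Mapping.keys ?p \<subseteq> carrier ?A \<times> carrier ?B"
      by (rule keys_lin_expand_class[OF p])
  qed (auto simp: common_kernel_def intro: V.vlinear_class_val L)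
  also have "\<dots> \<longleftrightarrow> (\<forall>\<kappa>\<in>L. ev (\<lambda>t. ev (\<lambda>y. \<kappa> (fst y) * \<epsilon> (snd y)) (expand (tensor_rep V W) t)) p = 0)"
  proof -
    have "ev (\<lambda>(a, b). class_val \<kappa> a * class_val \<epsilon> b) ?p =
        ev (\<lambda>t. ev (\<lambda>y. \<kappa> (fst y) * \<epsilon> (snd y)) (expand (tensor_rep V W) t)) p" if "\<kappa> \<in> L" for \<kappa>
    proof -
      have "ev (\<lambda>(a, b). class_val \<kappa> a * class_val \<epsilon> b) (expand_class 3 t) =
          ev (\<lambda>y. \<kappa> (fst y) * \<epsilon> (snd y)) (expand (tensor_rep V W) t)" if "t \<in> trees (s2_tensor V W) 3" for t
        unfolding expand_class_def ev_lin ev_mono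
        using expand_trees[OF that]
        by (intro ev_cong) (simp add: pair_class_def V.class_val_class[OF L[OF \<open>\<kappa> \<in> L\<close>]] W.class_val_class[OF \<epsilon>])
      then show ?thesis
        unfolding ev_lin using p by (intro ev_cong) auto
    qed
    then show ?thesis by simp
  qed
  finally show ?thesis .
qed

lemma (in s2_pair) white_product_iso:
  assumes D: "gens D = V" "rels D = common_kernel V (\<kappa> ` I)"
    and L: "\<And>i. i \<in> I \<Longrightarrow> tree_functional V 3 (\<kappa> i)"
    and E: "gens E = W" "rels E = common_kernel W {\<epsilon>}" and \<epsilon>: "tree_functional W 3 \<epsilon>"
    and b0: "Poly_Mapping.keys b0 \<subseteq> trees W 3" "ev \<epsilon> b0 = 1"
    and U: "s2_mod U" and f: "s2_hom U (s2_tensor V W) f" and g: "s2_hom (s2_tensor V W) U g"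
    and gf: "\<And>u. u \<in> carrier U \<Longrightarrow> g (f u) = u" and fg: "\<And>x. x \<in> carrier (tensor V W) \<Longrightarrow> f (g x) = x"
    and G: "gens G = U" "rels G = common_kernel U (\<kappa>' ` I)"
    and L': "\<And>i. i \<in> I \<Longrightarrow> tree_functional U 3 (\<kappa>' i)"
    and LL': "\<And>i t. i \<in> I \<Longrightarrow> t \<in> trees U 3 \<Longrightarrow>
      ev (\<lambda>y. \<kappa> i (fst y) * \<epsilon> (snd y)) (expand (tensor_rep V W) (map_tree f t)) = \<kappa>' i t"
  shows "\<exists>\<phi>. operad_iso (operad_of G) (operad_of (white_product D E)) \<phi> \<and>
    (\<forall>u\<in>carrier U. \<phi> 2 (gen_op G u) = gen_op (white_product D E) (f u))"
proof -
  interpret U: s2_mod U by (rule U)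
  let ?T = "s2_tensor V W"
  let ?FU = "free_operad U" and ?FT = "free_operad ?T" and ?\<phi> = "free_map ?T f"
  let ?H = "white_product D E"
  have T: "gens ?H = ?T"
    by (simp add: white_product_def Let_def D E)
  have iso: "operad_iso ?FU ?FT ?\<phi>"
    using gf fg by (intro operad_iso_free_map[OF U VW.s2_mod_axioms f g]) auto
  have RG: "rels G \<subseteq> carrier (ar ?FU 3)" and RH: "rels ?H \<subseteq> carrier (ar ?FT 3)"
    by (auto simp: G common_kernel_def white_product_def Let_def D E)
  have mem: "?\<phi> 3 x \<in> rels ?H \<longleftrightarrow> x \<in> rels G" if x: "x \<in> carrier (ar ?FU 3)" for x
  proof -
    obtain p where p: "Poly_Mapping.keys p \<subseteq> trees U 3" "x = tree_class U 3 p"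
      using x by (auto simp: U.carrier_ar_free)
    have q: "Poly_Mapping.keys (push (map_tree f) p) \<subseteq> trees ?T 3"
      using p map_tree_hom_trees[OF U VW.s2_mod_axioms f] by (intro keys_push) auto
    have *: "ev (\<lambda>t. ev (\<lambda>y. \<kappa> i (fst y) * \<epsilon> (snd y)) (expand (tensor_rep V W) t)) (push (map_tree f) p) =
        ev (\<kappa>' i) p" if "i \<in> I" for i
      unfolding ev_push using p that by (intro ev_cong LL') auto
    have "tree_class ?T 3 (push (map_tree f) p) \<in> rels ?H \<longleftrightarrow> (\<forall>\<kappa>\<in>\<kappa> ` I. ev (\<lambda>t. ev (\<lambda>y. \<kappa> (fst y) * \<epsilon> (snd y))
        (expand (tensor_rep V W) t)) (push (map_tree f) p) = 0)"
      using L by (intro rels_white_product[OF D _ E \<epsilon> b0 q]) auto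
    moreover have "x \<in> rels G \<longleftrightarrow> (\<forall>\<kappa>\<in>\<kappa>' ` I. ev \<kappa> p = 0)"
      unfolding G(2) p(2) using L' by (intro U.mem_common_kernel[OF p(1)]) auto
    ultimately show ?thesis
      unfolding p(2) free_map_class[OF U VW.s2_mod_axioms f p(1)] using * by simp
  qed
  have "?\<phi> 3 ` rels G = rels ?H"
  proof
    show "?\<phi> 3 ` rels G \<subseteq> rels ?H"
      using RG mem by auto
    show "rels ?H \<subseteq> ?\<phi> 3 ` rels G"
    proof
      fix y assume y: "y \<in> rels ?H"
      then obtain x where "x \<in> carrier (ar ?FU 3)" "y = ?\<phi> 3 x"
        using RH iso unfolding operad_iso_def bij_betw_def by blast
      then show "y \<in> ?\<phi> 3 ` rels G"
        using mem y by auto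
    qed
  qed
  then have ideal: "?\<phi> n ` gen_ideal ?FU 3 (rels G) n = gen_ideal ?FT 3 (rels ?H) n" for n
    using gen_ideal_image[OF U.linear_operad_free VW.linear_operad_free iso RG] by simp
  note quot = operad_iso_quot[OF U.linear_operad_free VW.linear_operad_free iso
      operad_ideal_gen_ideal[OF U.linear_operad_free RG] operad_ideal_gen_ideal[OF VW.linear_operad_free RH] ideal]
  show ?thesis
  proof (intro exI conjI ballI)
    show "operad_iso (operad_of G) (operad_of ?H)
        (\<lambda>n. qlift (ar ?FT n) (gen_ideal ?FT 3 (rels ?H) n) (?\<phi> n))"
      using quot(1) by (simp add: operad_of_def G T)
    show "qlift (ar ?FT 2) (gen_ideal ?FT 3 (rels ?H) 2) (?\<phi> 2) (gen_op G u) = gen_op ?H (f u)"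
      if u: "u \<in> carrier U" for u
      using quot(2)[OF U.free_gen_mem[OF u]] free_map_free_gen[OF U VW.s2_mod_axioms f u]
      by (simp add: gen_op_def G T)
  qed
qed

section \<open>The generating modules\<close>

lemma sign_module_simps [simp]:
  "carrier sign_module = UNIV" "vzero sign_module = 0" "vadd sign_module = (+)"
  "vscale sign_module = (*)" "swap sign_module = uminus"
  by (simp_all add: sign_module_def)

lemma regular_module_simps [simp]:
  "carrier regular_module = UNIV" "vzero regular_module = 0" "vadd regular_module = (+)"
  "vscale regular_module = pscale" "swap regular_module = push (\<lambda>(g, b). (g, \<not> b))"
  by (simp_all add: regular_module_def vspace.defs s2_module.defs free_vspace_def)

lemma vector_space_modules [simp]:
  "vector_space_on (sign_module :: ('k::field, 'k) s2_module)"
  "vector_space_on (regular_module :: ('k::field, 'g \<times> bool \<Rightarrow>\<^sub>0 'k) s2_module)"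
  using vector_space_free[of "UNIV :: ('g \<times> bool) set"]
  unfolding vector_space_on_def by (auto simp: algebra_simps)

lemma s2_linear_modules [simp]:
  "s2_linear (trivial_module :: ('k::field, 'k) s2_module)"
  "s2_linear (sign_module :: ('k::field, 'k) s2_module)"
  "s2_linear (regular_module :: ('k::field, 'g \<times> bool \<Rightarrow>\<^sub>0 'k) s2_module)"
  by (auto simp: s2_linear_def vclosed_def vlinear_def push_eq_lin lin_add lin_pscale)

lemma vspan_scalar:
  assumes "1 \<in> M" and V: "vector_space_on V" "carrier V = (UNIV :: 'k::field set)" "vscale V = (*)"
  shows "carrier V = vspan V M"
proof -
  have "c \<in> vspan V M" for c
    using vsubspaceD(4)[OF vsubspace_vspan[OF V(1), of M], of 1 c] vspan_superset[of M V] assms by auto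
  then show ?thesis
    using V by auto
qed

lemma vspan_regular_mono:
  assumes M: "\<And>x. mono x \<in> M"
  shows "carrier regular_module = vspan regular_module (M :: ('g \<times> bool \<Rightarrow>\<^sub>0 'k::field) set)" (is "_ = vspan ?V _")
proof -
  have "vsubspace ?V (vspan ?V M)"
    by (intro vsubspace_vspan) simp_all
  then have N: "vsubspace (free_vspace UNIV) (vspan ?V M)"
    by (simp add: vsubspace_def)
  have "mono x \<in> vspan ?V M" for x
    by (rule subsetD[OF vspan_superset M])
  then have "p \<in> vspan ?V M" for p
    by (rule free_eq_sum_mono[OF N])
  then show ?thesis
    unfolding regular_module_simps(1) by (intro set_eqI) simp
qed

lemma vspan_regular:
  "carrier regular_module = vspan regular_module
    (range mul \<union> swap regular_module ` range mul :: ('g \<times> bool \<Rightarrow>\<^sub>0 'k::field) set)" (is "_ = vspan ?V ?M")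
proof (rule vspan_regular_mono)
  fix x :: "'g \<times> bool"
  obtain g b where x: "x = (g, b)" by (cases x)
  show "mono x \<in> ?M"
  proof (cases b)
    case True
    then have "mono x = swap ?V (mul g)"
      by (simp add: mul_def x)
    then show ?thesis by blast
  next
    case False
    then have "mono x = mul g"
      by (simp add: mul_def x)
    then show ?thesis by blast
  qed
qed

lemma range_mul_unit: "range mul = {mul ()}"
  by auto

lemma vspan_regular_unit:
  "carrier regular_module = vspan regular_module
    ({mul ()} \<union> swap regular_module ` {mul ()} :: (unit \<times> bool \<Rightarrow>\<^sub>0 'k::field) set)"
  unfolding range_mul_unit[symmetric] by (rule vspan_regular)

lemma vlinear_regular_ev: "vlinear regular_module trivial_module (ev h)"
  by (auto simp: vlinear_def ev_add ev_pscale)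

section \<open>Normal forms in arity 3\<close>

definition perm3 :: "nat \<Rightarrow> nat \<Rightarrow> nat \<Rightarrow> bool" where
  "perm3 i j k \<longleftrightarrow> distinct [i, j, k] \<and> {i, j, k} = {1..3}"

lemma perm3_cases:
  assumes "perm3 i j k"
  shows "i = 1 \<and> j = 2 \<and> k = 3 \<or> i = 1 \<and> j = 3 \<and> k = 2 \<or> i = 2 \<and> j = 1 \<and> k = 3 \<or>
    i = 2 \<and> j = 3 \<and> k = 1 \<or> i = 3 \<and> j = 1 \<and> k = 2 \<or> i = 3 \<and> j = 2 \<and> k = 1"
proof -
  have "i \<in> {1, 2, 3}" "j \<in> {1, 2, 3}" "k \<in> {1, 2, 3}" "distinct [i, j, k]"
    using assms unfolding perm3_def atLeastAtMost_1_3 by blast+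
  then show ?thesis by auto
qed

lemma perm3_simps [simp]:
  "perm3 1 2 3" "perm3 1 3 2" "perm3 2 1 3" "perm3 2 3 1" "perm3 3 1 2" "perm3 3 2 1"
  by (auto simp: perm3_def atLeastAtMost_1_3)

lemma perm3_permute:
  "perm3 i j k \<Longrightarrow> perm3 j i k" "perm3 i j k \<Longrightarrow> perm3 i k j" "perm3 i j k \<Longrightarrow> perm3 j k i"
  "perm3 i j k \<Longrightarrow> perm3 k i j"
  by (auto simp: perm3_def)

lemma push_relabel_lmono [simp]:
  "push (relabel \<sigma>) (lmono u v i j k) = lmono u v (\<sigma> i) (\<sigma> j) (\<sigma> k)"
  "push (relabel \<sigma>) (rmono u v i j k) = rmono u v (\<sigma> i) (\<sigma> j) (\<sigma> k)"
  by (simp_all add: lmono_def rmono_def)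

lemma lin_fun_pscale_const: "lin (\<lambda>t. pscale (h t) q) p = pscale (ev h p) q"
  by (rule poly_mapping_eqI) (simp add: lookup_lin ev_fun_scale_right)

definition words3 :: "nat list set" where
  "words3 = {w. length w = 3}"

lemma words3E: "w \<in> words3 \<Longrightarrow> (\<And>x y z. w = [x, y, z] \<Longrightarrow> P) \<Longrightarrow> P"
  by (auto simp: words3_def length_Suc_conv numeral_3_eq_3)

lemma words3I [simp]: "[x, y, z] \<in> words3"
  by (simp add: words3_def)

context s2_mod
begin

lemma keys_lmono [simp]:
  assumes "u \<in> carrier V" "v \<in> carrier V" "perm3 i j k"
  shows "Poly_Mapping.keys (lmono u v i j k :: _ \<Rightarrow>\<^sub>0 'k) \<subseteq> trees V 3"
    and "Poly_Mapping.keys (rmono u v i j k :: _ \<Rightarrow>\<^sub>0 'k) \<subseteq> trees V 3"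
  using assms lmono_trees[of u v i j k] by (auto simp: lmono_def rmono_def perm3_def)

definition relators :: "('v tree \<Rightarrow>\<^sub>0 'k) set \<Rightarrow> ('v tree \<Rightarrow>\<^sub>0 'k) set" where
  "relators S = {p. Poly_Mapping.keys p \<subseteq> trees V 3 \<and> tree_class V 3 p \<in> rels (presentation V S)}"

context
  fixes S :: "('v tree \<Rightarrow>\<^sub>0 'k) set"
  assumes S: "\<forall>s\<in>S. Poly_Mapping.keys s \<subseteq> trees V 3"
begin

lemma vsubspace_relators: "vsubspace (free_vspace (trees V 3)) (relators S)"
  using vsubspace_vimage[OF vlinear_tree_class vector_space_tree_free vector_space_ar_free vsubspace_rels[OF S[rule_format]]]
  by (simp add: relators_def tree_free_def)

lemma relator_mem:
  assumes "s \<in> S" "perm3 i j k"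
  shows "\<exists>\<sigma>. push (relabel \<sigma>) s \<in> relators S \<and> \<sigma> 1 = i \<and> \<sigma> 2 = j \<and> \<sigma> 3 = k"
proof -
  obtain \<sigma> where \<sigma>: "\<sigma> permutes {1..3}" "\<sigma> 1 = i" "\<sigma> 2 = j" "\<sigma> 3 = k"
    using assms(2) permutation_3 unfolding perm3_def by metis
  moreover have "Poly_Mapping.keys (push (relabel \<sigma>) s) \<subseteq> trees V 3"
    using bspec[OF S assms(1)] relabel_trees[OF \<sigma>(1)] by (intro keys_push) auto
  ultimately show ?thesis
    using relation_mem[OF assms(1) \<sigma>(1) bspec[OF S assms(1)]] unfolding relators_def by blast
qed

lemma relator_class_eq:
  assumes "Poly_Mapping.keys p \<subseteq> trees V 3" "Poly_Mapping.keys q \<subseteq> trees V 3"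
    and "tree_class V 3 p = tree_class V 3 q"
  shows "p - q \<in> relators S"
proof -
  have "tree_class V 3 (p - q) = tree_class V 3 0"
    using assms keys_add_subset(2)[OF assms(1,2)] by (simp add: tree_class_eq_iff)
  also have "\<dots> = vzero (ar (free_operad V) 3)"
    by (simp add: ar_free_operad tree_class_def)
  finally show ?thesis
    using assms keys_add_subset(2) vsubspaceD(2)[OF vsubspace_rels[OF S[rule_format]]] by (simp add: relators_def)
qed

lemma rels_eq_common_kernel':
  assumes V: "vector_space_on V" and M: "M \<subseteq> carrier V" and span: "carrier V = vspan V (M \<union> swap V ` M)"
    and L: "\<And>\<kappa>. \<kappa> \<in> L \<Longrightarrow> tree_functional V 3 \<kappa>"
    and vanish: "\<And>\<kappa> \<sigma> s. \<kappa> \<in> L \<Longrightarrow> s \<in> S \<Longrightarrow> inj \<sigma> \<Longrightarrow> ev (\<lambda>t. \<kappa> (relabel \<sigma> t)) s = 0"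
    and keys: "\<And>t. Poly_Mapping.keys (\<nu> t) \<subseteq> trees V 3"
    and \<nu>: "\<And>p. (\<And>\<kappa>. \<kappa> \<in> L \<Longrightarrow> ev \<kappa> p = 0) \<Longrightarrow> lin \<nu> p = 0"
    and red: "\<And>u v i j k. u \<in> M \<Longrightarrow> v \<in> M \<Longrightarrow> perm3 i j k \<Longrightarrow>
      lmono u v i j k - lin \<nu> (lmono u v i j k) \<in> relators S \<and>
      rmono u v i j k - lin \<nu> (rmono u v i j k) \<in> relators S"
  shows "rels (presentation V S) = common_kernel V L"
  using red
  by (intro rels_eq_common_kernel[OF V M span S[rule_format] L _ keys \<nu>])
    (auto simp: relators_def perm3_def intro!: vanish permutes_inj)

text \<open>Modulo the relations \<open>L 2 3 1\<close> and \<open>L 3 1 2\<close> form a basis, dual to the coefficients of the words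
  \<open>123\<close> (up to sign) and \<open>213\<close> of iterated commutators.\<close>

lemma rels_eq_commutator_kernel:
  fixes m
  defines "L \<equiv> lmono m m" and "R \<equiv> rmono m m"
  assumes V: "vector_space_on V" and m: "m \<in> carrier V" and span: "carrier V = vspan V ({m} \<union> swap V ` {m})"
    and fn: "\<And>w. tree_functional V 3 (\<lambda>t. coef a b t w)" and ab: "a m = 1" "b m = - 1"
    and vanish: "\<And>\<sigma> s x y z. s \<in> S \<Longrightarrow> inj \<sigma> \<Longrightarrow> ev (\<lambda>t. coef a b (relabel \<sigma> t) [x, y, z]) s = 0"
    and anti: "\<And>i j k. perm3 i j k \<Longrightarrow> L i j k + L j i k \<in> relators S"
    and right: "\<And>i j k. perm3 i j k \<Longrightarrow> R i j k + L j k i \<in> relators S"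
    and jacobi: "L 1 2 3 + L 2 3 1 + L 3 1 2 \<in> relators S"
  shows "rels (presentation V S) = common_kernel V ((\<lambda>w t. coef a b t w) ` words3)"
proof -
  define \<nu> where "\<nu> t = pscale (coef a b t [2, 1, 3]) (L 3 1 2) - pscale (coef a b t [1, 2, 3]) (L 2 3 1)" for t
  have lin: "lin \<nu> p = pscale (ev (\<lambda>t. coef a b t [2, 1, 3]) p) (L 3 1 2) -
      pscale (ev (\<lambda>t. coef a b t [1, 2, 3]) p) (L 2 3 1)" for p
    unfolding \<nu>_def lin_fun_diff lin_fun_pscale_const ..
  note sub = free_sub[OF vsubspace_relators]
  have one [simp]: "pscale 1 p = p" and neg [simp]: "pscale (- 1) p = - p" for p :: "'v tree \<Rightarrow>\<^sub>0 'k"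
    by (rule poly_mapping_eqI, simp)+
  have zero [simp]: "pscale 0 p = 0" for p :: "'v tree \<Rightarrow>\<^sub>0 'k"
    by (rule poly_mapping_eqI) simp
  have L_red: "L i j k - lin \<nu> (L i j k) \<in> relators S" if "perm3 i j k" for i j k
    using perm3_cases[OF that]
  proof (elim disjE conjE)
    assume "i = 1" "j = 2" "k = 3"
    then show ?thesis
      using jacobi unfolding lin by (simp add: L_def lmono_def ab algebra_simps del: pscale_mono)
  next
    assume "i = 2" "j = 1" "k = 3"
    then show ?thesis
      using sub(6)[OF anti[of 1 2 3] jacobi] unfolding lin by (simp add: L_def lmono_def ab algebra_simps del: pscale_mono)
  next
    assume "i = 2" "j = 3" "k = 1"
    then show ?thesis
      using sub(2) unfolding lin by (simp add: L_def lmono_def ab del: pscale_mono)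
  next
    assume "i = 3" "j = 1" "k = 2"
    then show ?thesis
      using sub(2) unfolding lin by (simp add: L_def lmono_def ab del: pscale_mono)
  next
    assume "i = 1" "j = 3" "k = 2"
    then show ?thesis
      using anti[of 1 3 2] unfolding lin by (simp add: L_def lmono_def ab algebra_simps del: pscale_mono)
  next
    assume "i = 3" "j = 2" "k = 1"
    then show ?thesis
      using anti[of 3 2 1] unfolding lin by (simp add: L_def lmono_def ab algebra_simps del: pscale_mono)
  qed
  have R_red: "R i j k - lin \<nu> (R i j k) \<in> relators S" if ijk: "perm3 i j k" for i j k
  proof -
    have "coef a b (Node m (Leaf i) (Node m (Leaf j) (Leaf k))) [x, y, z] =
        - coef a b (Node m (Node m (Leaf j) (Leaf k)) (Leaf i)) [x, y, z]" for x y z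
      by (simp add: ab)
    then have "ev (\<lambda>t. coef a b t [x, y, z]) (R i j k) = - ev (\<lambda>t. coef a b t [x, y, z]) (L j k i)" for x y z
      unfolding L_def R_def lmono_def rmono_def ev_mono .
    then have "lin \<nu> (R i j k) = - lin \<nu> (L j k i)"
      unfolding lin by (intro poly_mapping_eqI) (simp add: lookup_minus)
    then have eq: "R i j k - lin \<nu> (R i j k) = (R i j k + L j k i) - (L j k i - lin \<nu> (L j k i))"
      by simp
    show ?thesis
      unfolding eq by (rule sub(6)[OF right[OF ijk] L_red[OF perm3_permute(3)[OF ijk]]])
  qed
  show ?thesis
  proof (rule rels_eq_common_kernel'[OF V _ span])
    show "Poly_Mapping.keys (\<nu> t) \<subseteq> trees V 3" for t
      unfolding \<nu>_def L_def using m by (intro keys_add_subset keys_lmono) simp_all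
    fix p assume "\<And>\<kappa>. \<kappa> \<in> (\<lambda>w t. coef a b t w) ` words3 \<Longrightarrow> ev \<kappa> p = 0"
    then have "ev (\<lambda>t. coef a b t w) p = 0" if "w \<in> words3" for w
      using that by blast
    then show "lin \<nu> p = 0"
      unfolding lin by simp
  qed (use m fn L_red R_red vanish in \<open>auto simp: L_def R_def elim!: words3E\<close>)
qed

lemma rels_eq_word_kernel:
  assumes V: "vector_space_on V" and M: "M \<subseteq> carrier V" and span: "carrier V = vspan V (M \<union> swap V ` M)"
    and m: "m \<in> M"
    and fn: "\<And>w. tree_functional V 3 (\<lambda>t. coef a b t w)"
    and ab: "\<And>u. u \<in> M \<Longrightarrow> a u = 1" "\<And>u. u \<in> M \<Longrightarrow> b u = 0"
    and vanish: "\<And>\<sigma> s x y z. s \<in> S \<Longrightarrow> inj \<sigma> \<Longrightarrow> ev (\<lambda>t. coef a b (relabel \<sigma> t) [x, y, z]) s = 0"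
    and assoc: "\<And>u v u' v' i j k. u \<in> M \<Longrightarrow> v \<in> M \<Longrightarrow> u' \<in> M \<Longrightarrow> v' \<in> M \<Longrightarrow> perm3 i j k \<Longrightarrow>
      lmono u v i j k - rmono u' v' i j k \<in> relators S"
  shows "rels (presentation V S) = common_kernel V ((\<lambda>w t. coef a b t w) ` words3)"
proof -
  let ?L = "lmono m m :: _ \<Rightarrow> _ \<Rightarrow> _ \<Rightarrow> _ \<Rightarrow>\<^sub>0 'k"
  let ?n = "\<lambda>f. f 1 2 3 + f 1 3 2 + f 2 1 3 + f 2 3 1 + f 3 1 2 + f (3::nat) (2::nat) (1::nat)"
  define \<nu> where "\<nu> t = ?n (\<lambda>i j k. pscale (coef a b t [i, j, k]) (?L i j k))" for t
  have lin: "lin \<nu> p = ?n (\<lambda>i j k. pscale (ev (\<lambda>t. coef a b t [i, j, k]) p) (?L i j k))" for p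
    unfolding \<nu>_def lin_fun_add lin_fun_pscale_const ..
  note sub = free_sub[OF vsubspace_relators]
  have one [simp]: "pscale 1 p = p" and zero [simp]: "pscale 0 p = 0" for p :: "'v tree \<Rightarrow>\<^sub>0 'k"
    by (rule poly_mapping_eqI, simp)+
  have lin_L: "lin \<nu> (lmono u v i j k) = ?L i j k" and lin_R: "lin \<nu> (rmono u v i j k) = ?L i j k"
    if "u \<in> M" "v \<in> M" "perm3 i j k" for u v i j k
    using perm3_cases[OF that(3)] that(1,2) unfolding lin
    by (elim disjE conjE; simp add: lmono_def rmono_def ab del: pscale_mono)+
  show ?thesis
  proof (rule rels_eq_common_kernel'[OF V M span])
    show "Poly_Mapping.keys (\<nu> t) \<subseteq> trees V 3" for t
      unfolding \<nu>_def using m M by (intro keys_add_subset keys_lmono) auto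
    fix p assume "\<And>\<kappa>. \<kappa> \<in> (\<lambda>w t. coef a b t w) ` words3 \<Longrightarrow> ev \<kappa> p = 0"
    then have "ev (\<lambda>t. coef a b t w) p = 0" if "w \<in> words3" for w
      using that by blast
    then show "lin \<nu> p = 0"
      unfolding lin by simp
  next
    fix u v i j k assume uv: "u \<in> M" "v \<in> M" and ijk: "perm3 i j k"
    have "lmono u v i j k - ?L i j k = (lmono u v i j k - rmono m m i j k) - (?L i j k - rmono m m i j k)"
      "rmono u v i j k - ?L i j k = - (?L i j k - rmono u v i j k)"
      by simp_all
    then show "lmono u v i j k - lin \<nu> (lmono u v i j k) \<in> relators S \<and>
        rmono u v i j k - lin \<nu> (rmono u v i j k) \<in> relators S"
      using sub(6)[OF assoc[OF uv m m ijk] assoc[OF m m m m ijk]] sub(5)[OF assoc[OF m m uv ijk]]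
      by (simp add: lin_L[OF uv ijk] lin_R[OF uv ijk])
  qed (use fn vanish in \<open>auto elim!: words3E\<close>)
qed

lemma rels_eq_label_prod_kernel:
  fixes m
  defines "L \<equiv> lmono m m" and "R \<equiv> rmono m m"
  assumes V: "vector_space_on V" and m: "m \<in> carrier V" and span: "carrier V = vspan V ({m} \<union> swap V ` {m})"
    and fn: "tree_functional V 3 (label_prod e)" and e: "e m = 1"
    and vanish: "\<And>\<sigma> s. s \<in> S \<Longrightarrow> inj \<sigma> \<Longrightarrow> ev (\<lambda>t. label_prod e (relabel \<sigma> t)) s = 0"
    and swap: "\<And>i j k. perm3 i j k \<Longrightarrow> L i j k - L j i k \<in> relators S"
    and cycle: "\<And>i j k. perm3 i j k \<Longrightarrow> L i j k - L j k i \<in> relators S"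
    and assoc: "\<And>i j k. perm3 i j k \<Longrightarrow> L i j k - R i j k \<in> relators S"
  shows "rels (presentation V S) = common_kernel V {label_prod e}"
proof -
  define \<nu> where "\<nu> t = pscale (label_prod e t) (L 1 2 3)" for t
  have lin: "lin \<nu> p = pscale (ev (label_prod e) p) (L 1 2 3)" for p
    unfolding \<nu>_def lin_fun_pscale_const ..
  note sub = free_sub[OF vsubspace_relators]
  have one [simp]: "pscale 1 p = p" and zero [simp]: "pscale 0 p = 0" for p :: "'v tree \<Rightarrow>\<^sub>0 'k"
    by (rule poly_mapping_eqI, simp)+
  have trans: "p - r \<in> relators S" if "p - q \<in> relators S" "q - r \<in> relators S" for p q r
    using sub(3)[OF that] by simp
  have L231: "L 2 3 1 - L 1 2 3 \<in> relators S"
    by (rule trans[OF cycle cycle]) simp_all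
  have L312: "L 3 1 2 - L 1 2 3 \<in> relators S"
    by (rule cycle) simp
  have L_red: "L i j k - L 1 2 3 \<in> relators S" if "perm3 i j k" for i j k
    using perm3_cases[OF that] sub(2) L231 L312 trans[OF swap[of 1 3 2] L312] trans[OF swap[of 3 2 1] L231]
      swap[of 2 1 3] by (elim disjE conjE) simp_all
  have R_red: "R i j k - L 1 2 3 \<in> relators S" if ijk: "perm3 i j k" for i j k
    using trans[OF _ L_red[OF ijk], of "R i j k"] sub(5)[OF assoc[OF ijk]] by simp
  show ?thesis
  proof (rule rels_eq_common_kernel'[OF V _ span])
    show "Poly_Mapping.keys (\<nu> t) \<subseteq> trees V 3" for t
      unfolding \<nu>_def L_def using m by (intro keys_add_subset keys_lmono) simp_all
    have "lin \<nu> (L i j k) = L 1 2 3" "lin \<nu> (R i j k) = L 1 2 3" for i j k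
      unfolding lin by (simp_all add: L_def R_def lmono_def rmono_def e del: pscale_mono)
    then show "lmono u v i j k - lin \<nu> (lmono u v i j k) \<in> relators S \<and>
        rmono u v i j k - lin \<nu> (rmono u v i j k) \<in> relators S"
      if "u \<in> {m}" "v \<in> {m}" "perm3 i j k" for u v i j k
      using that L_red R_red by (simp add: L_def R_def)
  qed (use m fn vanish in \<open>auto simp: lin\<close>)
qed

end

end

section \<open>The relations of the six operads\<close>

context s2_mod
begin

lemma swap_relators:
  assumes S: "\<forall>s\<in>S. Poly_Mapping.keys s \<subseteq> trees V 3"
    and uv: "u \<in> carrier V" "v \<in> carrier V" and ijk: "perm3 i j k"
  shows "lmono (swap V u) v i j k - lmono u v j i k \<in> relators S"
    and "lmono u (swap V v) i j k - rmono v u k i j \<in> relators S"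
  using relator_class_eq[OF S] swap_lmono_rmono(1,2)[of i j k u v] uv ijk s2_closedD(3)[OF closed]
    perm3_permute[OF ijk]
  by (simp_all add: perm3_def)

end

lemma (in s2_mod) lmono_scale_relators:
  assumes S: "\<forall>s\<in>S. Poly_Mapping.keys s \<subseteq> trees V 3"
    and uv: "u \<in> carrier V" "v \<in> carrier V" and ijk: "perm3 i j k"
  shows "lmono (vscale V c u) v i j k - pscale c (lmono u v i j k) \<in> relators S"
    and "lmono u (vscale V c v) i j k - pscale c (lmono u v i j k) \<in> relators S"
proof -
  note ijk' = ijk[unfolded perm3_def, THEN conjunct1] ijk[unfolded perm3_def, THEN conjunct2]
  have c: "vscale V c u \<in> carrier V" "vscale V c v \<in> carrier V"
    using uv s2_closedD(2)[OF closed] by auto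
  note keys = keys_lmono(1)[OF uv ijk] keys_lmono(1)[OF c(1) uv(2) ijk] keys_lmono(1)[OF uv(1) c(2) ijk]
  show "lmono (vscale V c u) v i j k - pscale c (lmono u v i j k) \<in> relators S"
    "lmono u (vscale V c v) i j k - pscale c (lmono u v i j k) \<in> relators S"
    using vlinearD(3)[OF vlinear_lmono_rmono(1)[OF ijk' uv(2)] uv(1), of c]
      vlinearD(3)[OF vlinear_lmono_rmono(2)[OF ijk' uv(1)] uv(2), of c] keys
    by (intro relator_class_eq[OF S]; simp add: tree_class_scale keys_add_subset)+
qed

lemma s2_mod_modules:
  "s2_mod (trivial_module :: ('k::field, 'k) s2_module)"
  "s2_mod (sign_module :: ('k::field, 'k) s2_module)"
  "s2_mod (regular_module :: ('k::field, 'g \<times> bool \<Rightarrow>\<^sub>0 'k) s2_module)"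
  by (simp_all add: s2_mod_linear)

abbreviation commutator_sign :: "'g \<times> bool \<Rightarrow> 'k::field" where
  "commutator_sign x \<equiv> if snd x then - 1 else 1"

lemma tree_functional_sign:
  "tree_functional (sign_module :: ('k::field, 'k) s2_module) n (\<lambda>t. coef (\<lambda>c. c) uminus t w)"
  by (intro tree_functional_coef) (auto simp: vlinear_def)

lemma tree_functional_regular:
  assumes "\<And>g b. h' (g, b) = h (g, \<not> b)"
  shows "tree_functional (regular_module :: ('k::field, 'g \<times> bool \<Rightarrow>\<^sub>0 'k) s2_module) n
    (\<lambda>t. coef (ev h) (ev h') t w)"
  using assms
  by (intro tree_functional_coef vlinear_regular_ev) (auto simp: ev_push split_def intro!: ev_cong)

lemma tree_functional_label_prod_regular:
  "tree_functional (regular_module :: ('k::field, 'g \<times> bool \<Rightarrow>\<^sub>0 'k) s2_module) n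
    (label_prod (ev (\<lambda>_. 1)))"
  by (intro tree_functional_label_prod vlinear_regular_ev) (simp add: ev_push split_def)

lemma tree_functional_label_prod_trivial:
  "tree_functional (trivial_module :: ('k::field, 'k) s2_module) n (label_prod (\<lambda>c. c))"
  by (intro tree_functional_label_prod) (auto simp: vlinear_def)

lemma rels_Lie:
  "rels (Lie :: ('k::field, 'k) quadratic) =
    common_kernel sign_module ((\<lambda>w t. coef (\<lambda>c. c) uminus t w) ` words3)"
proof -
  interpret s2_mod "sign_module :: ('k, 'k) s2_module" by (rule s2_mod_modules)
  let ?S = "{lmono 1 1 1 2 3 + lmono 1 1 2 3 1 + lmono 1 1 3 1 2} :: ('k tree \<Rightarrow>\<^sub>0 'k) set"
  have S: "\<forall>s\<in>?S. Poly_Mapping.keys s \<subseteq> trees sign_module 3"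
    by (clarsimp simp: keys_add_subset)
  note sub = free_sub[OF vsubspace_relators[OF S]]
  have neg: "pscale (- 1) p = - p" for p :: "'k tree \<Rightarrow>\<^sub>0 'k"
    by (rule pscale_minus)
  have anti: "lmono 1 1 i j k + lmono 1 1 j i k \<in> relators ?S"
    and right: "rmono 1 1 i j k + lmono 1 1 j k i \<in> relators ?S" if ijk: "perm3 i j k" for i j k
  proof -
    have 1: "lmono (- 1) 1 i j k - lmono 1 1 j i k \<in> relators ?S"
      "lmono (- 1) 1 i j k + lmono 1 1 i j k \<in> relators ?S"
      using swap_relators(1)[OF S _ _ ijk, of 1 1] lmono_scale_relators(1)[OF S _ _ ijk, of 1 1 "- 1"]
      by (simp_all add: neg)
    show "lmono 1 1 i j k + lmono 1 1 j i k \<in> relators ?S"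
      using sub(6)[OF 1(2,1)] by (simp add: algebra_simps)
    have 2: "lmono 1 (- 1) j k i - rmono 1 1 i j k \<in> relators ?S"
      "lmono 1 (- 1) j k i + lmono 1 1 j k i \<in> relators ?S"
      using swap_relators(2)[OF S _ _ perm3_permute(3)[OF ijk], of 1 1]
        lmono_scale_relators(2)[OF S _ _ perm3_permute(3)[OF ijk], of 1 1 "- 1"]
      by (simp_all add: neg)
    show "rmono 1 1 i j k + lmono 1 1 j k i \<in> relators ?S"
      using sub(6)[OF 2(2,1)] by (simp add: algebra_simps)
  qed
  have jacobi: "lmono 1 1 1 2 3 + lmono 1 1 2 3 1 + lmono 1 1 3 1 2 \<in> relators ?S"
    using relator_mem[OF S, of "lmono 1 1 1 2 3 + lmono 1 1 2 3 1 + lmono 1 1 3 1 2" 1 2 3]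
    by (auto simp: push_add)
  have "rels (presentation sign_module ?S) =
      common_kernel sign_module ((\<lambda>w t. coef (\<lambda>c. c) uminus t w) ` words3)"
  proof (rule rels_eq_commutator_kernel[OF S _ _ _ tree_functional_sign _ _ _ anti right jacobi])
    show "carrier sign_module = vspan sign_module ({1} \<union> swap sign_module ` {1 :: 'k})"
      by (rule vspan_scalar) simp_all
    fix \<sigma> :: "nat \<Rightarrow> nat" and s x y z assume "inj \<sigma>" "s \<in> ?S"
    then show "ev (\<lambda>t. coef (\<lambda>c. c) uminus (relabel \<sigma> t) [x, y, z]) s = 0"
      by (auto simp: ev_add lmono_def)
  qed simp_all
  then show ?thesis
    by (simp add: Lie_def)
qed

lemma rels_sLeib:
  "rels (sLeib :: ('k::field, unit \<times> bool \<Rightarrow>\<^sub>0 'k) quadratic) = common_kernel regular_module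
    ((\<lambda>w t. coef (ev commutator_sign) (ev (\<lambda>x. - commutator_sign x)) t w) ` words3)"
proof -
  interpret s2_mod "regular_module :: ('k, unit \<times> bool \<Rightarrow>\<^sub>0 'k) s2_module" by (rule s2_mod_modules)
  let ?m = "mul () :: unit \<times> bool \<Rightarrow>\<^sub>0 'k"
  let ?L = "lmono ?m ?m :: _ \<Rightarrow> _ \<Rightarrow> _ \<Rightarrow> _ \<Rightarrow>\<^sub>0 'k" and ?R = "rmono ?m ?m :: _ \<Rightarrow> _ \<Rightarrow> _ \<Rightarrow> _ \<Rightarrow>\<^sub>0 'k"
  let ?S = "{?R 1 2 3 - ?L 1 2 3 - ?R 2 1 3, ?L 1 2 3 - ?R 1 2 3 - ?L 1 3 2}"
  have S: "\<forall>s\<in>?S. Poly_Mapping.keys s \<subseteq> trees regular_module 3"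
    by (clarsimp simp: keys_add_subset)
  note sub = free_sub[OF vsubspace_relators[OF S]]
  have left_Leibniz: "?R i j k - ?L i j k - ?R j i k \<in> relators ?S"
    and right_Leibniz: "?L i j k - ?R i j k - ?L i k j \<in> relators ?S" if ijk: "perm3 i j k" for i j k
    using relator_mem[OF S _ ijk, of "?R 1 2 3 - ?L 1 2 3 - ?R 2 1 3"]
      relator_mem[OF S _ ijk, of "?L 1 2 3 - ?R 1 2 3 - ?L 1 3 2"] by (auto simp: push_diff)
  have anti: "?L i j k + ?L j i k \<in> relators ?S" and anti': "?R i j k + ?R i k j \<in> relators ?S"
    if ijk: "perm3 i j k" for i j k
    using sub(5)[OF sub(3)[OF left_Leibniz[OF ijk] left_Leibniz[OF perm3_permute(1)[OF ijk]]]]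
      sub(5)[OF sub(3)[OF right_Leibniz[OF ijk] right_Leibniz[OF perm3_permute(2)[OF ijk]]]]
    by (simp_all add: algebra_simps)
  have R: "?R i j k - ?L i j k - ?L k i j \<in> relators ?S" if ijk: "perm3 i j k" for i j k
  proof -
    have eq: "?R i j k - ?L i j k - ?L k i j =
        - ((?L i j k - ?R i j k - ?L i k j) + (?L k i j + ?L i k j))"
      by simp
    show ?thesis
      unfolding eq by (intro sub(3,5) right_Leibniz anti ijk perm3_permute(4)[OF ijk])
  qed
  have jacobi: "?L i j k + ?L j k i + ?L k i j \<in> relators ?S" if ijk: "perm3 i j k" for i j k
  proof -
    have eq: "?L i j k + ?L j k i + ?L k i j =
        ((?R i j k - ?L i j k - ?R j i k) + (?R j i k + ?R j k i)) -
        ((?R i j k - ?L i j k - ?L k i j) + (?R j k i - ?L j k i - ?L i j k))"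
      by simp
    show ?thesis
      unfolding eq
      by (intro sub(3,6) left_Leibniz anti' R ijk perm3_permute(1,3)[OF ijk])
  qed
  have right: "?R i j k + ?L j k i \<in> relators ?S" if ijk: "perm3 i j k" for i j k
    using sub(3)[OF R[OF ijk] jacobi[OF ijk]] by (simp add: algebra_simps)
  have "rels (presentation regular_module ?S) = common_kernel regular_module
      ((\<lambda>w t. coef (ev commutator_sign) (ev (\<lambda>x. - commutator_sign x)) t w) ` words3)"
  proof (rule rels_eq_commutator_kernel[OF S _ _ _ tree_functional_regular _ _ _ anti right jacobi])
    show "carrier regular_module = vspan regular_module ({?m} \<union> swap regular_module ` {?m})"
      by (rule vspan_regular_unit)
    fix \<sigma> :: "nat \<Rightarrow> nat" and s x y z assume "inj \<sigma>" "s \<in> ?S"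
    then show "ev (\<lambda>t. coef (ev commutator_sign) (ev (\<lambda>x. - commutator_sign x)) (relabel \<sigma> t) [x, y, z]) s = 0"
      by (auto simp: ev_diff lmono_def rmono_def mul_def)
  qed (simp_all add: mul_def)
  then show ?thesis
    by (simp add: sLeib_def Let_def)
qed

lemma rels_Ass:
  "rels (Ass :: ('k::field, unit \<times> bool \<Rightarrow>\<^sub>0 'k) quadratic) = common_kernel regular_module
    ((\<lambda>w t. coef (ev (\<lambda>x. if snd x then 0 else 1)) (ev (\<lambda>x. if snd x then 1 else 0)) t w) ` words3)"
proof -
  interpret s2_mod "regular_module :: ('k, unit \<times> bool \<Rightarrow>\<^sub>0 'k) s2_module" by (rule s2_mod_modules)
  let ?m = "mul () :: unit \<times> bool \<Rightarrow>\<^sub>0 'k"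
  let ?S = "{lmono ?m ?m 1 2 3 - rmono ?m ?m 1 2 3} :: (_ \<Rightarrow>\<^sub>0 'k) set"
  have S: "\<forall>s\<in>?S. Poly_Mapping.keys s \<subseteq> trees regular_module 3"
    by (clarsimp simp: keys_add_subset)
  have assoc: "lmono ?m ?m i j k - rmono ?m ?m i j k \<in> relators ?S" if ijk: "perm3 i j k" for i j k
    using relator_mem[OF S insertI1 ijk] by (auto simp: push_diff)
  have "rels (presentation regular_module ?S) = common_kernel regular_module
      ((\<lambda>w t. coef (ev (\<lambda>x. if snd x then 0 else 1)) (ev (\<lambda>x. if snd x then 1 else 0)) t w) ` words3)"
  proof (rule rels_eq_word_kernel[OF S _ _ vspan_regular_unit _ tree_functional_regular])
    fix \<sigma> :: "nat \<Rightarrow> nat" and s x y z assume "inj \<sigma>" "s \<in> ?S"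
    then show "ev (\<lambda>t. coef (ev (\<lambda>x. if snd x then 0 else 1)) (ev (\<lambda>x. if snd x then 1 else 0))
        (relabel \<sigma> t) [x, y, z]) s = 0"
      by (auto simp: ev_diff lmono_def rmono_def mul_def)
  qed (use assoc in \<open>auto simp: mul_def\<close>)
  then show ?thesis
    by (simp add: Ass_def Let_def)
qed

lemma rels_sDiAss:
  "rels (sDiAss :: ('k::field, dimult \<times> bool \<Rightarrow>\<^sub>0 'k) quadratic) = common_kernel regular_module
    ((\<lambda>w t. coef (ev (\<lambda>x. if snd x then 0 else 1)) (ev (\<lambda>x. if snd x then 1 else 0)) t w) ` words3)"
proof -
  interpret s2_mod "regular_module :: ('k, dimult \<times> bool \<Rightarrow>\<^sub>0 'k) s2_module" by (rule s2_mod_modules)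
  let ?S = "{lmono (mul a) (mul b) 1 2 3 - rmono (mul c) (mul d) 1 2 3 | a b c d. True}
    :: ((dimult \<times> bool \<Rightarrow>\<^sub>0 'k) tree \<Rightarrow>\<^sub>0 'k) set"
  have S: "\<forall>s\<in>?S. Poly_Mapping.keys s \<subseteq> trees regular_module 3"
    by (intro ballI, elim CollectE exE conjE) (simp add: keys_add_subset)
  have assoc: "lmono (mul a) (mul b) i j k - rmono (mul c) (mul d) i j k \<in> relators ?S"
    if ijk: "perm3 i j k" for a b c d i j k
    using relator_mem[OF S _ ijk, of "lmono (mul a) (mul b) 1 2 3 - rmono (mul c) (mul d) 1 2 3"]
    by (auto simp: push_diff)
  have "rels (presentation regular_module ?S) = common_kernel regular_module
      ((\<lambda>w t. coef (ev (\<lambda>x. if snd x then 0 else 1)) (ev (\<lambda>x. if snd x then 1 else 0)) t w) ` words3)"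
  proof (rule rels_eq_word_kernel[OF S _ _ vspan_regular _ tree_functional_regular])
    fix \<sigma> :: "nat \<Rightarrow> nat" and s x y z assume "inj \<sigma>" "s \<in> ?S"
    then show "ev (\<lambda>t. coef (ev (\<lambda>x. if snd x then 0 else 1)) (ev (\<lambda>x. if snd x then 1 else 0))
        (relabel \<sigma> t) [x, y, z]) s = 0"
      by (auto simp: ev_diff lmono_def rmono_def mul_def)
  qed (use assoc in \<open>auto simp: mul_def\<close>)
  then show ?thesis
    by (simp add: sDiAss_def)
qed

lemma rels_sPerm:
  "rels (sPerm :: ('k::field, unit \<times> bool \<Rightarrow>\<^sub>0 'k) quadratic) =
    common_kernel regular_module {label_prod (ev (\<lambda>_. 1))}"
proof -
  interpret s2_mod "regular_module :: ('k, unit \<times> bool \<Rightarrow>\<^sub>0 'k) s2_module" by (rule s2_mod_modules)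
  let ?m = "mul () :: unit \<times> bool \<Rightarrow>\<^sub>0 'k"
  let ?L = "lmono ?m ?m :: _ \<Rightarrow> _ \<Rightarrow> _ \<Rightarrow> _ \<Rightarrow>\<^sub>0 'k" and ?R = "rmono ?m ?m :: _ \<Rightarrow> _ \<Rightarrow> _ \<Rightarrow> _ \<Rightarrow>\<^sub>0 'k"
  let ?S = "{?L 1 2 3 - ?R 1 2 3, ?L 1 2 3 - ?L 1 3 2, ?L 1 2 3 - ?L 2 1 3}"
  have S: "\<forall>s\<in>?S. Poly_Mapping.keys s \<subseteq> trees regular_module 3"
    by (clarsimp simp: keys_add_subset)
  note sub = free_sub[OF vsubspace_relators[OF S]]
  have assoc: "?L i j k - ?R i j k \<in> relators ?S" and swap2: "?L i j k - ?L i k j \<in> relators ?S"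
    and swap1: "?L i j k - ?L j i k \<in> relators ?S" if ijk: "perm3 i j k" for i j k
    using relator_mem[OF S _ ijk, of "?L 1 2 3 - ?R 1 2 3"] relator_mem[OF S _ ijk, of "?L 1 2 3 - ?L 1 3 2"]
      relator_mem[OF S _ ijk, of "?L 1 2 3 - ?L 2 1 3"] by (auto simp: push_diff)
  have cycle: "?L i j k - ?L j k i \<in> relators ?S" if ijk: "perm3 i j k" for i j k
    using sub(3)[OF swap1[OF ijk] swap2[OF perm3_permute(1)[OF ijk]]] by simp
  have "rels (presentation regular_module ?S) = common_kernel regular_module {label_prod (ev (\<lambda>_. 1))}"
  proof (rule rels_eq_label_prod_kernel[OF S _ _ vspan_regular_unit tree_functional_label_prod_regular _ _
        swap1 cycle assoc])
    fix \<sigma> :: "nat \<Rightarrow> nat" and s assume "inj \<sigma>" "s \<in> ?S"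
    then show "ev (\<lambda>t. label_prod (ev (\<lambda>_. 1)) (relabel \<sigma> t)) s = 0"
      by (auto simp: ev_diff lmono_def rmono_def mul_def)
  qed (simp_all add: mul_def)
  then show ?thesis
    by (simp add: sPerm_def Let_def)
qed

lemma rels_Com:
  "rels (Com :: ('k::field, 'k) quadratic) = common_kernel trivial_module {label_prod (\<lambda>c. c)}"
proof -
  interpret s2_mod "trivial_module :: ('k, 'k) s2_module" by (rule s2_mod_modules)
  let ?L = "lmono 1 1 :: _ \<Rightarrow> _ \<Rightarrow> _ \<Rightarrow> 'k tree \<Rightarrow>\<^sub>0 'k" and ?R = "rmono 1 1 :: _ \<Rightarrow> _ \<Rightarrow> _ \<Rightarrow> 'k tree \<Rightarrow>\<^sub>0 'k"
  let ?S = "{?L 1 2 3 - ?R 1 2 3}"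
  have S: "\<forall>s\<in>?S. Poly_Mapping.keys s \<subseteq> trees trivial_module 3"
    by (clarsimp simp: keys_add_subset)
  note sub = free_sub[OF vsubspace_relators[OF S]]
  have assoc: "?L i j k - ?R i j k \<in> relators ?S" if ijk: "perm3 i j k" for i j k
    using relator_mem[OF S insertI1 ijk] by (auto simp: push_diff)
  have swap1: "?L i j k - ?L j i k \<in> relators ?S" and swap2: "?L i j k - ?R k i j \<in> relators ?S"
    if ijk: "perm3 i j k" for i j k
    using swap_relators[OF S _ _ ijk, of 1 1] by simp_all
  have cycle: "?L i j k - ?L j k i \<in> relators ?S" if ijk: "perm3 i j k" for i j k
    using sub(6)[OF assoc[OF ijk] swap2[OF perm3_permute(3)[OF ijk]]] by simp
  have "rels (presentation trivial_module ?S) = common_kernel trivial_module {label_prod (\<lambda>c. c)}"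
  proof (rule rels_eq_label_prod_kernel[OF S _ _ _ tree_functional_label_prod_trivial _ _ swap1 cycle assoc])
    show "carrier trivial_module = vspan trivial_module ({1} \<union> swap trivial_module ` {1 :: 'k})"
      by (rule vspan_scalar) simp_all
    fix \<sigma> :: "nat \<Rightarrow> nat" and s assume "inj \<sigma>" "s \<in> ?S"
    then show "ev (\<lambda>t. label_prod (\<lambda>c. c) (relabel \<sigma> t)) s = 0"
      by (auto simp: ev_diff lmono_def rmono_def)
  qed simp_all
  then show ?thesis
    by (simp add: Com_def)
qed

section \<open>Isomorphisms with regular modules\<close>

lemma vlinear_vspan_eq:
  assumes f: "vlinear V W f" and g: "vlinear V W g" and V: "vector_space_on V" and W: "vector_space_on W"
    and span: "carrier V = vspan V M" and M: "M \<subseteq> carrier V"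
    and eq: "\<And>x. x \<in> M \<Longrightarrow> f x = g x" and x: "x \<in> carrier V"
  shows "f x = g x"
proof -
  have "vsubspace V {x \<in> carrier V. f x = g x}"
    using vsubspaceD[OF vsubspace_carrier[OF V]] vlinearD[OF f] vlinearD[OF g]
      vlinear_zero[OF f V W] vlinear_zero[OF g V W]
    unfolding vsubspace_def by simp
  from vspan_least[OF this, of M] show ?thesis
    using span M eq x by auto
qed

lemma (in tensor_pair) vlinear_tensor_eq:
  assumes f: "vlinear (tensor V W) X f" and g: "vlinear (tensor V W) X g" and X: "vector_space_on X"
    and V: "vector_space_on V" "carrier V = vspan V M" "M \<subseteq> carrier V"
    and W: "vector_space_on W" "carrier W = vspan W N" "N \<subseteq> carrier W"
    and eq: "\<And>v w. v \<in> M \<Longrightarrow> w \<in> N \<Longrightarrow> f (pure_tensor V W v w) = g (pure_tensor V W v w)"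
    and x: "x \<in> carrier (tensor V W)"
  shows "f x = g x"
proof -
  have left: "vlinear V (tensor V W) (\<lambda>v. pure_tensor V W v w)" if "w \<in> carrier W" for w
    using that by (auto simp: vlinear_def pure_tensor_bilinear)
  have right: "vlinear W (tensor V W) (pure_tensor V W v)" if "v \<in> carrier V" for v
    using that by (auto simp: vlinear_def pure_tensor_bilinear)
  have 1: "f (pure_tensor V W v w) = g (pure_tensor V W v w)" if "v \<in> M" "w \<in> carrier W" for v w
  proof (rule vlinear_vspan_eq[OF _ _ W(1) X W(2,3)])
    have "v \<in> carrier V"
      using that V(3) by blast
    from vlinear_comp[OF right[OF this] f] vlinear_comp[OF right[OF this] g]
    show "vlinear W X (\<lambda>w. f (pure_tensor V W v w))" "vlinear W X (\<lambda>w. g (pure_tensor V W v w))" .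
  qed (fact eq[OF that(1)] that(2))+
  have 2: "f (pure_tensor V W v w) = g (pure_tensor V W v w)" if "v \<in> carrier V" "w \<in> carrier W" for v w
  proof (rule vlinear_vspan_eq[OF _ _ V(1) X V(2,3)])
    show "vlinear V X (\<lambda>v. f (pure_tensor V W v w))" "vlinear V X (\<lambda>v. g (pure_tensor V W v w))"
      by (rule vlinear_comp[OF left[OF that(2)] f], rule vlinear_comp[OF left[OF that(2)] g])
  qed (fact 1[OF _ that(2)] that(1))+
  obtain p where p: "Poly_Mapping.keys p \<subseteq> carrier V \<times> carrier W" "x = tensor_class V W p"
    using x by (auto simp: carrier_tensor)
  have "vlinear (free_vspace (carrier V \<times> carrier W)) X (\<lambda>p. f (tensor_class V W p))"
    "vlinear (free_vspace (carrier V \<times> carrier W)) X (\<lambda>p. g (tensor_class V W p))"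
    using vlinear_comp[OF vlinear_tensor_class f] vlinear_comp[OF vlinear_tensor_class g]
    by (simp_all add: tensor_free_def)
  then show ?thesis
    unfolding p(2)
  proof (rule vlinear_free_eq[OF _ _ X _ p(1)])
    show "f (tensor_class V W (mono y)) = g (tensor_class V W (mono y))" if "y \<in> carrier V \<times> carrier W" for y
      using 2[of "fst y" "snd y"] that by (auto simp: pure_tensor_eq)
  qed
qed

lemma (in tensor_pair) ev_tensor_rep:
  assumes "vlinear V trivial_module a" "vlinear W trivial_module e"
    and p: "Poly_Mapping.keys p \<subseteq> carrier V \<times> carrier W"
  shows "ev (\<lambda>y. a (fst y) * e (snd y)) (tensor_rep V W (tensor_class V W p)) =
    ev (\<lambda>y. a (fst y) * e (snd y)) p"
  using ev_tensor_null[OF assms(1,2) tensor_rep_class[OF p]] by (simp add: ev_diff split_def)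

text \<open>Here \<open>\<phi>\<close> gives the images of the basis of a regular module in \<open>V \<otimes> W\<close>, and \<open>\<gamma>\<close> induces the
  inverse isomorphism.\<close>

context s2_pair
begin

context
  fixes \<phi> :: "'g \<times> bool \<Rightarrow> 'v \<times> 'w \<Rightarrow>\<^sub>0 'k" and \<gamma> :: "'v \<Rightarrow> 'w \<Rightarrow> 'g \<times> bool \<Rightarrow>\<^sub>0 'k" and M N
  assumes V: "vector_space_on V" "carrier V = vspan V M" "M \<subseteq> carrier V"
    and W: "vector_space_on W" "carrier W = vspan W N" "N \<subseteq> carrier W"
    and \<phi>: "\<And>x. Poly_Mapping.keys (\<phi> x) \<subseteq> carrier V \<times> carrier W"
    and \<phi>_swap: "\<And>g b. tensor_class V W (\<phi> (g, \<not> b)) =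
      tensor_class V W (push (\<lambda>(v, w). (swap V v, swap W w)) (\<phi> (g, b)))"
    and \<gamma>: "vbilinear V W (free_vspace UNIV) \<gamma>"
    and \<gamma>\<phi>: "\<And>x. lin (\<lambda>y. \<gamma> (fst y) (snd y)) (\<phi> x) = mono x"
    and \<phi>\<gamma>: "\<And>v w. v \<in> M \<Longrightarrow> w \<in> N \<Longrightarrow> tensor_class V W (lin \<phi> (\<gamma> v w)) = pure_tensor V W v w"
begin

abbreviation (input) "reg_map p \<equiv> tensor_class V W (lin \<phi> p)"
abbreviation (input) "reg_inv x \<equiv> lin (\<lambda>y. \<gamma> (fst y) (snd y)) (tensor_rep V W x)"

lemma keys_lin_\<phi>: "Poly_Mapping.keys (lin \<phi> p) \<subseteq> carrier V \<times> carrier W"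
  using \<phi> by (intro keys_lin)

lemma vlinear_reg_map: "vlinear (free_vspace UNIV) (tensor V W) (\<lambda>p. reg_map p)"
  using vlinear_lin[of UNIV \<phi> "carrier V \<times> carrier W"] \<phi>
  by (intro vlinear_comp[OF _ vlinear_tensor_class]) (simp add: tensor_free_def)

lemma reg_inv_class:
  assumes p: "Poly_Mapping.keys p \<subseteq> carrier V \<times> carrier W"
  shows "reg_inv (tensor_class V W p) = lin (\<lambda>y. \<gamma> (fst y) (snd y)) p"
proof -
  note lin = vlinearD[OF vbilinearD(1)[OF \<gamma>]] vlinearD[OF vbilinearD(2)[OF \<gamma>]]
  have "lin (\<lambda>y. \<gamma> (fst y) (snd y)) (tensor_rep V W (tensor_class V W p) - p) \<in> {0}"
    by (rule tensor_null_lin[OF _ _ _ _ _ _ tensor_rep_class[OF p], of UNIV])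
      (simp_all add: lin vsubspace_def)
  then show ?thesis
    by (simp add: lin_diff)
qed

lemma vlinear_reg_inv: "vlinear (tensor V W) (free_vspace UNIV) (\<lambda>x. reg_inv x)"
proof -
  have "vlinear (tensor_free V W) (free_vspace UNIV) (lin (\<lambda>y. \<gamma> (fst y) (snd y)))"
    unfolding tensor_free_def by (intro vlinear_lin) simp
  then show ?thesis
    unfolding tensor_def
    by (rule vlinear_vquot) (simp_all add: reg_inv_class flip: tensor_class_def)
qed

lemma reg_inv_map: "reg_inv (reg_map p) = p"
  unfolding reg_inv_class[OF keys_lin_\<phi>] lin_lin \<gamma>\<phi> by simp

lemma reg_map_inv:
  assumes x: "x \<in> carrier (tensor V W)"
  shows "reg_map (reg_inv x) = x"
proof (rule vlinear_tensor_eq[OF _ _ vector_space_tensor V W _ x])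
  show "vlinear (tensor V W) (tensor V W) (\<lambda>x. reg_map (reg_inv x))"
    by (rule vlinear_comp[OF vlinear_reg_inv vlinear_reg_map])
  show "vlinear (tensor V W) (tensor V W) (\<lambda>x. x)"
    by (auto simp: vlinear_def)
  fix v w assume vw: "v \<in> M" "w \<in> N"
  then have "Poly_Mapping.keys (mono (v, w) :: _ \<Rightarrow>\<^sub>0 'k) \<subseteq> carrier V \<times> carrier W"
    using V(3) W(3) by auto
  from reg_inv_class[OF this] show "reg_map (reg_inv (pure_tensor V W v w)) = pure_tensor V W v w"
    unfolding pure_tensor_eq using \<phi>\<gamma>[OF vw] by (simp add: pure_tensor_eq)
qed

lemma reg_map_swap: "reg_map (swap regular_module p) = swap (s2_tensor V W) (reg_map p)"
proof -
  let ?s = "push (\<lambda>(v, w). (swap V v, swap W w)) :: _ \<Rightarrow> _ \<Rightarrow>\<^sub>0 'k"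
  have 1: "vlinear (free_vspace UNIV) (tensor V W) (\<lambda>p. reg_map (push (\<lambda>(g, b). (g, \<not> b)) p))"
    by (intro vlinear_comp[OF vlinear_push vlinear_reg_map]) simp
  have "vlinear (tensor_free V W) (tensor_free V W) ?s"
    unfolding tensor_free_def by (intro vlinear_push) auto
  moreover have "vlinear (free_vspace UNIV) (tensor_free V W) (lin \<phi>)"
    unfolding tensor_free_def using \<phi> by (intro vlinear_lin)
  ultimately have 2: "vlinear (free_vspace UNIV) (tensor V W) (\<lambda>p. tensor_class V W (?s (lin \<phi> p)))"
    by (intro vlinear_comp[OF vlinear_comp vlinear_tensor_class])
  have "reg_map (push (\<lambda>(g, b). (g, \<not> b)) p) = tensor_class V W (?s (lin \<phi> p))"
  proof (rule vlinear_free_eq[OF 1 2 vector_space_tensor])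
    show "reg_map (push (\<lambda>(g, b). (g, \<not> b)) (mono x)) = tensor_class V W (?s (lin \<phi> (mono x)))" for x
      by (cases x) (simp add: \<phi>_swap)
  qed simp
  then show ?thesis
    by (simp add: swap_s2_tensor[OF keys_lin_\<phi>])
qed

lemma s2_hom_reg_map: "s2_hom regular_module (s2_tensor V W) (\<lambda>p. reg_map p)"
  using vlinear_reg_map reg_map_swap unfolding s2_hom_def by (simp add: vlinear_def)

lemma s2_hom_reg_inv: "s2_hom (s2_tensor V W) regular_module (\<lambda>x. reg_inv x)"
proof -
  have "reg_inv (swap (s2_tensor V W) x) = swap regular_module (reg_inv x)" if "x \<in> carrier (tensor V W)" for x
    using reg_map_swap[of "reg_inv x"] reg_map_inv[OF that] reg_inv_map by metis
  then show ?thesis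
    using vlinear_reg_inv unfolding s2_hom_def by (simp add: vlinear_def)
qed

lemma white_product_iso_regular:
  assumes D: "gens D = V" "rels D = common_kernel V (\<kappa> ` I)"
    and L: "\<And>i. i \<in> I \<Longrightarrow> tree_functional V 3 (\<kappa> i)"
    and E: "gens E = W" "rels E = common_kernel W {\<epsilon>}" and \<epsilon>: "tree_functional W 3 \<epsilon>"
    and b0: "Poly_Mapping.keys b0 \<subseteq> trees W 3" "ev \<epsilon> b0 = 1"
    and G: "gens G = regular_module" "rels G = common_kernel regular_module (\<kappa>' ` I)"
    and L': "\<And>i. i \<in> I \<Longrightarrow> tree_functional regular_module 3 (\<kappa>' i)"
    and LL': "\<And>i t. i \<in> I \<Longrightarrow>
      ev (\<lambda>y. \<kappa> i (fst y) * \<epsilon> (snd y)) (expand (tensor_rep V W) (map_tree (\<lambda>p. reg_map p) t)) = \<kappa>' i t"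
  shows "\<exists>\<Phi>. operad_iso (operad_of G) (operad_of (white_product D E)) \<Phi> \<and>
    (\<forall>u. \<Phi> 2 (gen_op G u) = gen_op (white_product D E) (reg_map u))"
  using white_product_iso[OF D L E \<epsilon> b0 s2_mod_modules(3) s2_hom_reg_map s2_hom_reg_inv reg_inv_map reg_map_inv G L' LL']
  by simp

end

end

section \<open>The three white products\<close>

lemma sPerm_normal_form:
  "Poly_Mapping.keys (lmono (mul ()) (mul ()) 1 2 3 :: (unit \<times> bool \<Rightarrow>\<^sub>0 'k::field) tree \<Rightarrow>\<^sub>0 'k) \<subseteq> trees regular_module 3"
  "ev (label_prod (ev (\<lambda>_. 1))) (lmono (mul ()) (mul ()) 1 2 3 :: (unit \<times> bool \<Rightarrow>\<^sub>0 'k::field) tree \<Rightarrow>\<^sub>0 'k) = 1"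
  by (rule s2_mod.keys_lmono[OF s2_mod_modules(3)]; simp) (simp add: lmono_def mul_def)

lemma vspan_range_mono:
  "carrier regular_module = vspan regular_module (range mono :: ('g \<times> bool \<Rightarrow>\<^sub>0 'k::field) set)"
  by (rule vspan_regular_mono) (rule rangeI)

lemma gens_simps [simp]:
  "gens Lie = sign_module" "gens Com = trivial_module" "gens Ass = regular_module"
  "gens sLeib = regular_module" "gens sPerm = regular_module" "gens sDiAss = regular_module"
  by (simp_all add: Lie_def Com_def Ass_def sLeib_def sPerm_def sDiAss_def presentation_def Let_def)

lemma s2_pair_modules:
  "s2_pair (trivial_module :: ('k::field, 'k) s2_module) (regular_module :: ('k, 'h \<times> bool \<Rightarrow>\<^sub>0 'k) s2_module)"
  "s2_pair (sign_module :: ('k::field, 'k) s2_module) (regular_module :: ('k, 'h \<times> bool \<Rightarrow>\<^sub>0 'k) s2_module)"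
  "s2_pair (regular_module :: ('k::field, 'g \<times> bool \<Rightarrow>\<^sub>0 'k) s2_module) (regular_module :: ('k, 'h \<times> bool \<Rightarrow>\<^sub>0 'k) s2_module)"
  by (simp_all add: s2_pair_def)

lemma sLeib_iso:
  "\<exists>\<Phi>. operad_iso (operad_of (sLeib :: ('k::field, _) quadratic)) (operad_of (white_product Lie sPerm)) \<Phi> \<and>
    \<Phi> 2 (gen_op sLeib (mul ())) =
      gen_op (white_product Lie sPerm) (pure_tensor (gens Lie) (gens sPerm) 1 (mul ()))"
proof -
  let ?V = "sign_module :: ('k, 'k) s2_module" and ?W = "regular_module :: ('k, unit \<times> bool \<Rightarrow>\<^sub>0 'k) s2_module"
  interpret s2_pair ?V ?W by (rule s2_pair_modules)
  define \<phi> :: "unit \<times> bool \<Rightarrow> 'k \<times> (unit \<times> bool \<Rightarrow>\<^sub>0 'k) \<Rightarrow>\<^sub>0 'k"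
    where "\<phi> x = mono (commutator_sign x, mono x)" for x
  define \<gamma> :: "'k \<Rightarrow> (unit \<times> bool \<Rightarrow>\<^sub>0 'k) \<Rightarrow> unit \<times> bool \<Rightarrow>\<^sub>0 'k"
    where "\<gamma> c p = pscale c (lin (\<lambda>x. Poly_Mapping.single x (commutator_sign x)) p)" for c p
  have sgn: "commutator_sign x * commutator_sign x = (1 :: 'k)" for x :: "unit \<times> bool"
    by simp
  have \<phi>_swap: "tensor_class ?V ?W (\<phi> (g, \<not> b)) =
      tensor_class ?V ?W (push (\<lambda>(v, w). (swap ?V v, swap ?W w)) (\<phi> (g, b)))" for g b
    by (simp add: \<phi>_def)
  have \<gamma>: "vbilinear ?V ?W (free_vspace UNIV) \<gamma>"
    by (auto simp: vbilinear_def vlinear_def \<gamma>_def lin_add lin_pscale lookup_add algebra_simps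
        intro!: poly_mapping_eqI)
  have \<gamma>\<phi>: "lin (\<lambda>y. \<gamma> (fst y) (snd y)) (\<phi> x) = mono x" for x
    by (cases "snd x") (simp_all add: \<phi>_def \<gamma>_def, simp_all add: mono_def)
  have \<phi>\<gamma>: "tensor_class ?V ?W (lin \<phi> (\<gamma> v w)) = pure_tensor ?V ?W v w" if v: "v \<in> {1}" and w: "w \<in> range mono" for v w
  proof -
    obtain x where x: "w = mono x" using w by blast
    have "lin \<phi> (\<gamma> 1 (mono x)) = pscale (commutator_sign x) (mono (commutator_sign x, mono x))"
      by (simp add: \<gamma>_def lin_single \<phi>_def)
    then have "tensor_class ?V ?W (lin \<phi> (\<gamma> 1 (mono x))) =
        vscale (tensor ?V ?W) (commutator_sign x) (pure_tensor ?V ?W (commutator_sign x) (mono x))"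
      by (subst pure_tensor_eq, subst tensor_class_scale) simp_all
    also have "\<dots> = pure_tensor ?V ?W (vscale ?V (commutator_sign x) (commutator_sign x)) (mono x)"
      by (rule pure_tensor_bilinear(3)[symmetric]) simp_all
    finally show ?thesis
      using v by (simp add: x sgn)
  qed
  have a: "vlinear ?V trivial_module (\<lambda>c. c)" "vlinear ?V trivial_module uminus"
    by (auto simp: vlinear_def)
  have keys: "Poly_Mapping.keys (lin \<phi> p) \<subseteq> carrier ?V \<times> carrier ?W" for p
    by simp
  have val: "ev (\<lambda>y. fst y * ev (\<lambda>_. 1) (snd y)) (tensor_rep ?V ?W (tensor_class ?V ?W (lin \<phi> p))) = ev commutator_sign p"
    "ev (\<lambda>y. - fst y * ev (\<lambda>_. 1) (snd y)) (tensor_rep ?V ?W (tensor_class ?V ?W (lin \<phi> p))) =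
      ev (\<lambda>x. - commutator_sign x) p" for p
    unfolding ev_tensor_rep[OF a(1) vlinear_regular_ev keys] ev_tensor_rep[OF a(2) vlinear_regular_ev keys] ev_lin
    by (auto simp: \<phi>_def intro!: ev_cong)
  have span: "carrier ?V = vspan ?V {1}"
    by (rule vspan_scalar) simp_all
  have "\<exists>\<Phi>. operad_iso (operad_of (sLeib :: ('k, _) quadratic)) (operad_of (white_product Lie sPerm)) \<Phi> \<and>
    (\<forall>u. \<Phi> 2 (gen_op sLeib u) = gen_op (white_product Lie sPerm) (tensor_class ?V ?W (lin \<phi> u)))"
  proof (rule white_product_iso_regular[OF _ span _ _ vspan_range_mono _ _ \<phi>_swap \<gamma> \<gamma>\<phi> \<phi>\<gamma>
        _ rels_Lie tree_functional_sign _ rels_sPerm tree_functional_label_prod_regular sPerm_normal_form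
        _ rels_sLeib tree_functional_regular])
    show "ev (\<lambda>y. coef (\<lambda>c. c) uminus (fst y) w * label_prod (ev (\<lambda>_. 1)) (snd y))
        (expand (tensor_rep ?V ?W) (map_tree (\<lambda>p. tensor_class ?V ?W (lin \<phi> p)) t)) =
      coef (ev commutator_sign) (ev (\<lambda>x. - commutator_sign x)) t w" for w t
      unfolding ev_expand_coef[where \<rho> = "tensor_rep ?V ?W", OF keys_tensor_rep] coef_map_tree val ..
  qed simp_all
  moreover have "tensor_class ?V ?W (lin \<phi> (mul ())) = pure_tensor ?V ?W 1 (mul ())"
    by (simp add: pure_tensor_eq \<phi>_def mul_def)
  ultimately show ?thesis
    by (metis gens_simps)
qed

lemma sPerm_iso:
  "\<exists>\<Phi>. operad_iso (operad_of (sPerm :: ('k::field, _) quadratic)) (operad_of (white_product Com sPerm)) \<Phi> \<and>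
    \<Phi> 2 (gen_op sPerm (mul ())) =
      gen_op (white_product Com sPerm) (pure_tensor (gens Com) (gens sPerm) 1 (mul ()))"
proof -
  let ?V = "trivial_module :: ('k, 'k) s2_module" and ?W = "regular_module :: ('k, unit \<times> bool \<Rightarrow>\<^sub>0 'k) s2_module"
  interpret s2_pair ?V ?W by (rule s2_pair_modules)
  define \<phi> :: "unit \<times> bool \<Rightarrow> 'k \<times> (unit \<times> bool \<Rightarrow>\<^sub>0 'k) \<Rightarrow>\<^sub>0 'k" where "\<phi> x = mono (1, mono x)" for x
  have \<phi>_swap: "tensor_class ?V ?W (\<phi> (g, \<not> b)) =
      tensor_class ?V ?W (push (\<lambda>(v, w). (swap ?V v, swap ?W w)) (\<phi> (g, b)))" for g b
    by (simp add: \<phi>_def)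
  have \<gamma>: "vbilinear ?V ?W (free_vspace UNIV) pscale"
    by (auto simp: vbilinear_def vlinear_def lookup_add algebra_simps intro!: poly_mapping_eqI)
  have \<gamma>\<phi>: "lin (\<lambda>y. pscale (fst y) (snd y)) (\<phi> x) = mono x" for x
    by (simp add: \<phi>_def) (simp add: mono_def)
  have \<phi>\<gamma>: "tensor_class ?V ?W (lin \<phi> (pscale v w)) = pure_tensor ?V ?W v w" if "v \<in> {1}" "w \<in> range mono" for v w
    using that by (auto simp: lin_pscale \<phi>_def pure_tensor_eq simp flip: mono_def)
  have a: "vlinear ?V trivial_module (\<lambda>c. c)"
    by (auto simp: vlinear_def)
  have keys: "Poly_Mapping.keys (lin \<phi> p) \<subseteq> carrier ?V \<times> carrier ?W" for p
    by simp
  have val: "ev (\<lambda>y. fst y * ev (\<lambda>_. 1) (snd y)) (tensor_rep ?V ?W (tensor_class ?V ?W (lin \<phi> p))) = ev (\<lambda>_. 1) p" for p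
    unfolding ev_tensor_rep[OF a vlinear_regular_ev keys] ev_lin by (simp add: \<phi>_def)
  have span: "carrier ?V = vspan ?V {1}"
    by (rule vspan_scalar) simp_all
  have "\<exists>\<Phi>. operad_iso (operad_of (sPerm :: ('k, _) quadratic)) (operad_of (white_product Com sPerm)) \<Phi> \<and>
    (\<forall>u. \<Phi> 2 (gen_op sPerm u) = gen_op (white_product Com sPerm) (tensor_class ?V ?W (lin \<phi> u)))"
  proof (rule white_product_iso_regular[OF _ span _ _ vspan_range_mono _ _ \<phi>_swap \<gamma> \<gamma>\<phi> \<phi>\<gamma>,
        where I = "{()}" and ?b0.0 = "lmono (mul ()) (mul ()) 1 2 3" and \<kappa> = "\<lambda>_. label_prod (\<lambda>c. c)" and \<kappa>' = "\<lambda>_. label_prod (ev (\<lambda>_. 1))"])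
    show "ev (\<lambda>y. label_prod (\<lambda>c. c) (fst y) * label_prod (ev (\<lambda>_. 1)) (snd y))
        (expand (tensor_rep ?V ?W) (map_tree (\<lambda>p. tensor_class ?V ?W (lin \<phi> p)) t)) =
      label_prod (ev (\<lambda>_. 1)) t" for t
      unfolding ev_expand_label_prod label_prod_map_tree val ..
  qed (simp_all add: rels_Com rels_sPerm tree_functional_label_prod_trivial
      tree_functional_label_prod_regular sPerm_normal_form)
  moreover have "tensor_class ?V ?W (lin \<phi> (mul ())) = pure_tensor ?V ?W 1 (mul ())"
    by (simp add: pure_tensor_eq \<phi>_def mul_def)
  ultimately show ?thesis
    by (metis gens_simps)
qed

lemma sDiAss_iso:
  "\<exists>\<Phi>. operad_iso (operad_of (sDiAss :: ('k::field, _) quadratic)) (operad_of (white_product Ass sPerm)) \<Phi> \<and>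
    \<Phi> 2 (gen_op sDiAss (mul LeftTack)) =
      gen_op (white_product Ass sPerm) (pure_tensor (gens Ass) (gens sPerm) (mul ()) (mul ())) \<and>
    \<Phi> 2 (gen_op sDiAss (mul RightTack)) =
      gen_op (white_product Ass sPerm) (pure_tensor (gens Ass) (gens sPerm) (mul ()) (mul_op ()))"
proof -
  let ?V = "regular_module :: ('k, unit \<times> bool \<Rightarrow>\<^sub>0 'k) s2_module"
  let ?h = "\<lambda>x. if snd x then 0 else 1 :: 'k" and ?h' = "\<lambda>x. if snd x then 1 else 0 :: 'k"
  interpret s2_pair ?V ?V by (rule s2_pair_modules)
  define \<phi> :: "dimult \<times> bool \<Rightarrow> (unit \<times> bool \<Rightarrow>\<^sub>0 'k) \<times> (unit \<times> bool \<Rightarrow>\<^sub>0 'k) \<Rightarrow>\<^sub>0 'k"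
    where "\<phi> x = mono (mono ((), snd x), mono ((), snd x = (fst x = LeftTack)))" for x
  define \<beta> :: "unit \<times> bool \<Rightarrow> unit \<times> bool \<Rightarrow> dimult \<times> bool"
    where "\<beta> x y = (if snd x = snd y then LeftTack else RightTack, snd x)" for x y
  have \<phi>_swap: "tensor_class ?V ?V (\<phi> (g, \<not> b)) =
      tensor_class ?V ?V (push (\<lambda>(v, w). (swap ?V v, swap ?V w)) (\<phi> (g, b)))" for g b
    by (cases g) (simp_all add: \<phi>_def)
  have "vbilinear (free_vspace UNIV) (free_vspace UNIV) (free_vspace UNIV :: ('k, dimult \<times> bool \<Rightarrow>\<^sub>0 'k) vspace) (push2 \<beta>)"
    by (rule vbilinear_push2) simp
  then have \<gamma>: "vbilinear ?V ?V (free_vspace UNIV) (push2 \<beta>)"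
    by (simp add: vbilinear_def vlinear_def)
  have \<gamma>\<phi>: "lin (\<lambda>y. push2 \<beta> (fst y) (snd y)) (\<phi> x) = mono x" for x
    by (cases x; cases "fst x") (auto simp: \<phi>_def push2_eq_lin \<beta>_def)
  have \<phi>\<gamma>: "tensor_class ?V ?V (lin \<phi> (push2 \<beta> v w)) = pure_tensor ?V ?V v w"
    if v: "v \<in> range mono" and w: "w \<in> range mono" for v w
  proof -
    obtain b c where "v = mono ((), b)" "w = mono ((), c)"
      using v w by auto
    then show ?thesis
      by (cases b; cases c) (simp_all add: push2_eq_lin \<phi>_def \<beta>_def pure_tensor_eq)
  qed
  have keys: "Poly_Mapping.keys (lin \<phi> p) \<subseteq> carrier ?V \<times> carrier ?V" for p
    by simp
  have val: "ev (\<lambda>y. ev ?h (fst y) * ev (\<lambda>_. 1) (snd y)) (tensor_rep ?V ?V (tensor_class ?V ?V (lin \<phi> p))) = ev ?h p"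
    "ev (\<lambda>y. ev ?h' (fst y) * ev (\<lambda>_. 1) (snd y)) (tensor_rep ?V ?V (tensor_class ?V ?V (lin \<phi> p))) = ev ?h' p" for p
    unfolding ev_tensor_rep[OF vlinear_regular_ev vlinear_regular_ev keys] ev_lin by (simp_all add: \<phi>_def)
  have "\<exists>\<Phi>. operad_iso (operad_of (sDiAss :: ('k, _) quadratic)) (operad_of (white_product Ass sPerm)) \<Phi> \<and>
    (\<forall>u. \<Phi> 2 (gen_op sDiAss u) = gen_op (white_product Ass sPerm) (tensor_class ?V ?V (lin \<phi> u)))"
  proof (rule white_product_iso_regular[OF _ vspan_range_mono _ _ vspan_range_mono _ _ \<phi>_swap \<gamma> \<gamma>\<phi> \<phi>\<gamma>
        _ rels_Ass tree_functional_regular _ rels_sPerm tree_functional_label_prod_regular sPerm_normal_form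
        _ rels_sDiAss tree_functional_regular])
    show "ev (\<lambda>y. coef (ev ?h) (ev ?h') (fst y) w * label_prod (ev (\<lambda>_. 1)) (snd y))
        (expand (tensor_rep ?V ?V) (map_tree (\<lambda>p. tensor_class ?V ?V (lin \<phi> p)) t)) =
      coef (ev ?h) (ev ?h') t w" for w t
      unfolding ev_expand_coef[where \<rho> = "tensor_rep ?V ?V", OF keys_tensor_rep] coef_map_tree val ..
  qed simp_all
  moreover have "tensor_class ?V ?V (lin \<phi> (mul LeftTack)) = pure_tensor ?V ?V (mul ()) (mul ())"
    "tensor_class ?V ?V (lin \<phi> (mul RightTack)) = pure_tensor ?V ?V (mul ()) (mul_op ())"
    by (simp_all add: pure_tensor_eq \<phi>_def mul_def mul_op_def)
  ultimately show ?thesis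
    by (metis gens_simps)
qed

theorem proposition15:
  shows "(\<exists>\<phi>. operad_iso (operad_of (sLeib :: ('k::field_char_0, _) quadratic))
              (operad_of (white_product Lie sPerm)) \<phi> \<and>
            \<phi> 2 (gen_op sLeib (mul ())) =
              gen_op (white_product Lie sPerm)
                (pure_tensor (gens Lie) (gens sPerm) 1 (mul ())))
       \<and> (\<exists>\<phi>. operad_iso (operad_of (sDiAss :: ('k, _) quadratic))
              (operad_of (white_product Ass sPerm)) \<phi> \<and>
            \<phi> 2 (gen_op sDiAss (mul LeftTack)) =
              gen_op (white_product Ass sPerm)
                (pure_tensor (gens Ass) (gens sPerm) (mul ()) (mul ())) \<and>
            \<phi> 2 (gen_op sDiAss (mul RightTack)) =
              gen_op (white_product Ass sPerm)
                (pure_tensor (gens Ass) (gens sPerm) (mul ()) (mul_op ())))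
       \<and> (\<exists>\<phi>. operad_iso (operad_of (sPerm :: ('k, _) quadratic))
              (operad_of (white_product Com sPerm)) \<phi> \<and>
            \<phi> 2 (gen_op sPerm (mul ())) =
              gen_op (white_product Com sPerm)
                (pure_tensor (gens Com) (gens sPerm) 1 (mul ())))"
  using sLeib_iso sDiAss_iso sPerm_iso by blast

end
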